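(* Let $A$ be a commutative noetherian DG-ring with bounded cohomology. Then the following are equivalent: (1) The DG-ring $A$ is sequence-regular. (2) The DG-ring $A$ is Cohen–Macaulay and the ring $\mathrm{H}^0(A)$ is a regular ring.
   Context: All DG-rings are unital, non-positively graded, $A=\bigoplus_{n\le 0}A^n$ with differential of degree $+1$ satisfying the graded Leibniz rule, and commutative: $ba=(-1)^{\deg(a)\deg(b)}ab$ for homogeneous $a,b$, and $a^2=0$ for $a$ of odd degree. There is a natural surjection $\pi_A^0:A^0\to \mathrm{H}^0(A)$. For a DG-module $M$, $\inf(M)=\inf\{n\mid \mathrm{H}^n(M)\neq 0\}$. $\mathsf{D}(A)$ is the derived category of DG-modules over $A$, and $\mathsf{D}^+(A)$ is its full subcategory of DG-modules with bounded below cohomology. $A$ is noetherian if $\mathrm{H}^0(A)$ is a noetherian ring and each $\mathrm{H}^i(A)$, $i<0$, is a finitely generated $\mathrm{H}^0(A)$-module. $A$ has bounded cohomology if $\mathrm{H}^i(A)=0$ for $i\ll 0$. A noetherian local DG-ring $(A,\bar{\mathfrak{m}})$ is a noetherian DG-ring such that $\mathrm{H}^0(A)$ is a local ring with maximal ideal $\bar{\mathfrak{m}}$. Localization: for $\bar{\mathfrak{p}}\in\operatorname{Spec}(\mathrm{H}^0(A))$ put $\mathfrak{p}=(\pi_A^0)^{-1}(\bar{\mathfrak{p}})$ and $A_{\bar{\mathfrak{p}}}=A\otimes_{A^0}A^0_{\mathfrak{p}}$; then $\mathrm{H}^0(A_{\bar{\mathfrak{p}}})=\mathrm{H}^0(A)_{\bar{\mathfrak{p}}}$.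 Koszul complex: for $\bar a_1,\dots,\bar a_n\in \mathrm{H}^0(A)$ choose lifts $a_i\in A^0$ and set $K(A;\bar a_1,\dots,\bar a_n)=K(A^0;a_1,\dots,a_n)\otimes_{A^0}A$ (independent of the lifts up to isomorphism in the homotopy category of DG-rings); for $M\in\mathsf{D}(A)$, $K(M;\bar a_1,\dots,\bar a_n)=K(A;\bar a_1,\dots,\bar a_n)\otimes_A M$. Regular sequences: for a noetherian local DG-ring $(A,\bar{\mathfrak{m}})$ and $M\in\mathsf{D}^+(A)$, an element $\bar x\in\bar{\mathfrak{m}}$ is $M$-regular if multiplication by $\bar x$ on $\mathrm{H}^{\inf(M)}(M)$ is injective. A sequence $\bar a_1,\dots,\bar a_n\in\bar{\mathfrak{m}}$ is $M$-regular if $\bar a_1$ is $M$-regular and $\bar a_2,\dots,\bar a_n$ is $K(M;\bar a_1)$-regular. A noetherian local DG-ring $(A,\bar{\mathfrak{m}})$ with bounded cohomology is local-Cohen–Macaulay if the maximal length of an $A$-regular sequence in $\bar{\mathfrak{m}}$ (always at most $\dim \mathrm{H}^0(A)$) equals $\dim \mathrm{H}^0(A)$; it is sequence-regular if $\bar{\mathfrak{m}}$ can be generated by an $A$-regular sequence. A noetherian DG-ring $A$ with bounded cohomology is called Cohen–Macaulay (resp. sequence-regular) if for every $\bar{\mathfrak{p}}\in\operatorname{Spec}(\mathrm{H}^0(A))$ the local DG-ring $A_{\bar{\mathfrak{p}}}$ is local-Cohen–Macaulay (resp. sequence-regular). A noetherian ring is regular if all its localizations at primes are regular local rings. *)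

theory Defs
  imports "HOL-Algebra.QuotRing" "HOL-Algebra.Module" "HOL-Algebra.Ring_Divisibility"
    "HOL-Library.Extended_Nat"
begin

text \<open>Otherwise the record field \<open>mult\<close> is shadowed.\<close>

hide_const (open) Multiset.mult

section \<open>Commutative rings: localization, dimension, regularity\<close>

text \<open>
  Fractions \<open>a / s\<close>, as equivalence classes of pairs \<open>(a, s)\<close>. The ring \<open>R\<close> is not required to be
  commutative: the construction is also applied to graded-commutative rings, with \<open>S\<close> a
  multiplicative set of central elements.
\<close>

definition frac_rel :: "('a, 'b) ring_scheme \<Rightarrow> 'a set \<Rightarrow> (('a \<times> 'a) \<times> ('a \<times> 'a)) set" where
  "frac_rel R S = {((a, s), (b, t)).
     a \<in> carrier R \<and> s \<in> S \<and> b \<in> carrier R \<and> t \<in> S \<and>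
     (\<exists>u\<in>S. u \<otimes>\<^bsub>R\<^esub> (t \<otimes>\<^bsub>R\<^esub> a) = u \<otimes>\<^bsub>R\<^esub> (s \<otimes>\<^bsub>R\<^esub> b))}"

definition ring_frac :: "('a, 'b) ring_scheme \<Rightarrow> 'a set \<Rightarrow> 'a \<Rightarrow> 'a \<Rightarrow> ('a \<times> 'a) set" where
  "ring_frac R S a s = frac_rel R S `` {(a, s)}"

definition ring_of_fractions :: "('a, 'b) ring_scheme \<Rightarrow> 'a set \<Rightarrow> ('a \<times> 'a) set ring" where
  "ring_of_fractions R S =
    \<lparr>carrier = {ring_frac R S a s | a s. a \<in> carrier R \<and> s \<in> S},
     mult = (\<lambda>U V. \<Union>p\<in>U. \<Union>q\<in>V.
       (case (p, q) of ((a, s), (b, t)) \<Rightarrow> ring_frac R S (a \<otimes>\<^bsub>R\<^esub> b) (s \<otimes>\<^bsub>R\<^esub> t))),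
     one = ring_frac R S \<one>\<^bsub>R\<^esub> \<one>\<^bsub>R\<^esub>,
     zero = ring_frac R S \<zero>\<^bsub>R\<^esub> \<one>\<^bsub>R\<^esub>,
     add = (\<lambda>U V. \<Union>p\<in>U. \<Union>q\<in>V.
       (case (p, q) of ((a, s), (b, t)) \<Rightarrow>
         ring_frac R S ((t \<otimes>\<^bsub>R\<^esub> a) \<oplus>\<^bsub>R\<^esub> (s \<otimes>\<^bsub>R\<^esub> b)) (s \<otimes>\<^bsub>R\<^esub> t)))\<rparr>"

definition localize_at :: "('a, 'b) ring_scheme \<Rightarrow> 'a set \<Rightarrow> ('a \<times> 'a) set ring" where
  "localize_at R P = ring_of_fractions R (carrier R - P)"

definition local_ring :: "('a, 'b) ring_scheme \<Rightarrow> 'a set \<Rightarrow> bool" where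
  "local_ring R m \<longleftrightarrow> cring R \<and> maximalideal m R \<and> (\<forall>n. maximalideal n R \<longrightarrow> n = m)"

definition prime_chain :: "('a, 'b) ring_scheme \<Rightarrow> nat \<Rightarrow> (nat \<Rightarrow> 'a set) \<Rightarrow> bool" where
  "prime_chain R n P \<longleftrightarrow> (\<forall>i\<le>n. primeideal (P i) R) \<and> (\<forall>i<n. P i \<subset> P (Suc i))"

definition krull_dim :: "('a, 'b) ring_scheme \<Rightarrow> enat" where
  "krull_dim R = Sup {enat n | n. \<exists>P. prime_chain R n P}"

text \<open>
  By Krull's height theorem the maximal ideal never has fewer than \<open>krull_dim R\<close> generators.
\<close>

definition regular_local_ring :: "('a, 'b) ring_scheme \<Rightarrow> bool" where
  "regular_local_ring R \<longleftrightarrow> noetherian_ring R \<and>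
     (\<exists>m. local_ring R m \<and>
       (\<exists>G. finite G \<and> G \<subseteq> carrier R \<and> m = Idl\<^bsub>R\<^esub> G \<and> enat (card G) = krull_dim R))"

definition regular_ring :: "('a, 'b) ring_scheme \<Rightarrow> bool" where
  "regular_ring R \<longleftrightarrow> cring R \<and> noetherian_ring R \<and>
     (\<forall>P. primeideal P R \<longrightarrow> regular_local_ring (localize_at R P))"

definition fin_gen_module ::
    "('a, 'c) ring_scheme \<Rightarrow> ('a, 'm, 'd) module_scheme \<Rightarrow> bool" where
  "fin_gen_module R M \<longleftrightarrow> (\<exists>G. finite G \<and> G \<subseteq> carrier M \<and>
     (\<forall>x\<in>carrier M. \<exists>c. c \<in> G \<rightarrow> carrier R \<and>
        x = finsum M (\<lambda>g. c g \<odot>\<^bsub>M\<^esub> g) G))"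


section \<open>Commutative DG-rings and DG-modules\<close>

text \<open>
  Gradings are internal: \<open>dg_grade A n\<close> is the subset of homogeneous elements of degree \<open>n\<close>
  (including zero) of the underlying ring.
\<close>

record 'a dg_ring = "'a ring" +
  dg_grade :: "int \<Rightarrow> 'a set"
  dg_diff :: "'a \<Rightarrow> 'a"

definition koszul_sign :: "('a, 'b) ring_scheme \<Rightarrow> int \<Rightarrow> 'a \<Rightarrow> 'a" where
  "koszul_sign R n x = (if even n then x else \<ominus>\<^bsub>R\<^esub> x)"

definition homogeneous_parts ::
    "('a, 'b) ring_scheme \<Rightarrow> (int \<Rightarrow> 'a set) \<Rightarrow> 'a \<Rightarrow> (int \<Rightarrow> 'a) \<Rightarrow> bool" where
  "homogeneous_parts R gr x c \<longleftrightarrow>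
     (\<forall>n. c n \<in> gr n) \<and> finite {n. c n \<noteq> \<zero>\<^bsub>R\<^esub>} \<and>
     x = finsum R c {n. c n \<noteq> \<zero>\<^bsub>R\<^esub>}"

locale comm_dg_ring = ring A for A :: "'a dg_ring" (structure) +
  assumes grade_subgroup: "additive_subgroup (dg_grade A n) A"
    and direct_sum: "x \<in> carrier A \<Longrightarrow> \<exists>!c. homogeneous_parts A (dg_grade A) x c"
    and nonpositive: "n > 0 \<Longrightarrow> dg_grade A n = {\<zero>}"
    and one_grade: "\<one> \<in> dg_grade A 0"
    and mult_grade:
      "\<lbrakk>x \<in> dg_grade A m; y \<in> dg_grade A n\<rbrakk> \<Longrightarrow> x \<otimes> y \<in> dg_grade A (m + n)"
    and graded_comm:
      "\<lbrakk>x \<in> dg_grade A m; y \<in> dg_grade A n\<rbrakk> \<Longrightarrow> y \<otimes> x = koszul_sign A (m * n) (x \<otimes> y)"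
    and odd_square: "\<lbrakk>x \<in> dg_grade A n; odd n\<rbrakk> \<Longrightarrow> x \<otimes> x = \<zero>"
    and diff_add:
      "\<lbrakk>x \<in> carrier A; y \<in> carrier A\<rbrakk> \<Longrightarrow> dg_diff A (x \<oplus> y) = dg_diff A x \<oplus> dg_diff A y"
    and diff_grade: "x \<in> dg_grade A n \<Longrightarrow> dg_diff A x \<in> dg_grade A (n + 1)"
    and diff_diff: "x \<in> carrier A \<Longrightarrow> dg_diff A (dg_diff A x) = \<zero>"
    and leibniz:
      "\<lbrakk>x \<in> dg_grade A m; y \<in> carrier A\<rbrakk> \<Longrightarrow>
        dg_diff A (x \<otimes> y) = (dg_diff A x \<otimes> y) \<oplus> koszul_sign A m (x \<otimes> dg_diff A y)"

text \<open>
  Left DG-modules over \<open>A\<close> are represented by records extending the library's modules, whose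
  fields \<open>mult\<close> and \<open>one\<close> carry no meaning.
\<close>

record ('a, 'm) dg_module = "('a, 'm) module" +
  mod_grade :: "int \<Rightarrow> 'm set"
  mod_diff :: "'m \<Rightarrow> 'm"

definition dg_self :: "'a dg_ring \<Rightarrow> ('a, 'a) dg_module" where
  "dg_self A =
    \<lparr>carrier = carrier A, mult = mult A, one = one A, zero = zero A, add = add A,
     smult = mult A, mod_grade = dg_grade A, mod_diff = dg_diff A\<rparr>"


section \<open>Cohomology\<close>

definition cocycles :: "('a, 'm) dg_module \<Rightarrow> int \<Rightarrow> 'm set" where
  "cocycles M n = {z \<in> mod_grade M n. mod_diff M z = \<zero>\<^bsub>M\<^esub>}"

definition coboundaries :: "('a, 'm) dg_module \<Rightarrow> int \<Rightarrow> 'm set" where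
  "coboundaries M n = mod_diff M ` mod_grade M (n - 1)"

text \<open>In degree 0 every element is a cocycle, as \<open>A\<close> is concentrated in nonpositive degrees.\<close>

definition dg_zero_part :: "'a dg_ring \<Rightarrow> 'a ring" where
  "dg_zero_part A =
    \<lparr>carrier = dg_grade A 0, mult = mult A, one = one A, zero = zero A, add = add A\<rparr>"

definition H0 :: "'a dg_ring \<Rightarrow> 'a set ring" where
  "H0 A = dg_zero_part A Quot (coboundaries (dg_self A) 0)"

definition H0_proj :: "'a dg_ring \<Rightarrow> 'a \<Rightarrow> 'a set" where
  "H0_proj A a = coboundaries (dg_self A) 0 +>\<^bsub>A\<^esub> a"

text \<open>The \<open>n\<close>-th cohomology of a DG-module over \<open>A\<close>, as a module over \<open>H0 A\<close>.\<close>

definition cohomology :: "('a, 'm) dg_module \<Rightarrow> int \<Rightarrow> ('a set, 'm set) module" where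
  "cohomology M n =
    \<lparr>carrier = {coboundaries M n +>\<^bsub>M\<^esub> z | z. z \<in> cocycles M n},
     mult = undefined, one = undefined,
     zero = coboundaries M n,
     add = set_add M,
     smult = (\<lambda>U V. \<Union>x\<in>U. \<Union>y\<in>V. coboundaries M n +>\<^bsub>M\<^esub> (x \<odot>\<^bsub>M\<^esub> y))\<rparr>"

definition cohomology_vanishes :: "('a, 'm) dg_module \<Rightarrow> int \<Rightarrow> bool" where
  "cohomology_vanishes M n \<longleftrightarrow> carrier (cohomology M n) = {\<zero>\<^bsub>cohomology M n\<^esub>}"

text \<open>
  Only meaningful for modules with bounded below, nonzero cohomology. If all cohomology vanishes,
  the value is arbitrary.
\<close>

definition dg_inf :: "('a, 'm) dg_module \<Rightarrow> int" where
  "dg_inf M = Inf {n. \<not> cohomology_vanishes M n}"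

definition bounded_cohomology :: "'a dg_ring \<Rightarrow> bool" where
  "bounded_cohomology A \<longleftrightarrow> (\<exists>k. \<forall>n<k. cohomology_vanishes (dg_self A) n)"

definition noetherian_dg_ring :: "'a dg_ring \<Rightarrow> bool" where
  "noetherian_dg_ring A \<longleftrightarrow> comm_dg_ring A \<and> noetherian_ring (H0 A) \<and>
     (\<forall>n<0. fin_gen_module (H0 A) (cohomology (dg_self A) n))"

definition noetherian_local_dg_ring :: "'a dg_ring \<Rightarrow> 'a set set \<Rightarrow> bool" where
  "noetherian_local_dg_ring A m \<longleftrightarrow> noetherian_dg_ring A \<and> local_ring (H0 A) m"


section \<open>Localization of DG-rings\<close>

text \<open>
  For a multiplicative set \<open>S\<close> in degree 0, \<open>A \<otimes> S\<^sup>-\<^sup>1A\<^sup>0\<close> (tensor product over \<open>A\<^sup>0\<close>) is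
  the ring of fractions \<open>S\<^sup>-\<^sup>1A\<close>, with \<open>a / s\<close> corresponding to \<open>a \<otimes> 1/s\<close>. Its differential is
  \<open>d (a / s) = d a / s\<close>.
\<close>

definition dg_ring_of_fractions :: "'a dg_ring \<Rightarrow> 'a set \<Rightarrow> ('a \<times> 'a) set dg_ring" where
  "dg_ring_of_fractions A S =
     ring.extend (ring_of_fractions A S)
       (dg_ring.fields
         (\<lambda>n. {ring_frac A S a s | a s. a \<in> dg_grade A n \<and> s \<in> S})
         (\<lambda>U. \<Union>p\<in>U. (case p of (a, s) \<Rightarrow> ring_frac A S (dg_diff A a) s)))"

definition dg_localize_at :: "'a dg_ring \<Rightarrow> 'a set set \<Rightarrow> ('a \<times> 'a) set dg_ring" where
  "dg_localize_at A P =
     dg_ring_of_fractions A (dg_grade A 0 - {a \<in> dg_grade A 0. H0_proj A a \<in> P})"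


section \<open>Koszul complexes\<close>

text \<open>
  \<open>K(A\<^sup>0; a)\<close> is free over \<open>A\<^sup>0\<close> on \<open>1\<close> and an element \<open>e\<close> of degree \<open>-1\<close> with \<open>d e = a\<close>.
  Hence every element of \<open>K(M; a)\<close>, the tensor product of \<open>K(A\<^sup>0; a)\<close> and \<open>M\<close> over \<open>A\<^sup>0\<close>, is uniquely
  \<open>1 \<otimes> x + e \<otimes> y\<close>; it is written \<open>Kos x y\<close>. The differential is
  \<open>d (1 \<otimes> x + e \<otimes> y) = 1 \<otimes> (d x + a y) - e \<otimes> d y\<close>, and a homogeneous \<open>b\<close> in \<open>A\<close>
  acts by \<open>b (e \<otimes> y) = (-1)\<^sup>|\<^sup>b\<^sup>| e \<otimes> (b y)\<close>.

  To iterate the construction without changing the type of elements, all iterates over \<open>M\<close> live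
  in one datatype, in which \<open>Base\<close> embeds the elements of \<open>M\<close> itself.
\<close>

datatype 'm kos = Base (kos_base: 'm) | Kos (kos_fst: "'m kos") (kos_snd: "'m kos")

definition sign_twist :: "'a dg_ring \<Rightarrow> 'a \<Rightarrow> 'a" where
  "sign_twist A b =
     (let c = (THE c. homogeneous_parts A (dg_grade A) b c)
      in finsum A (\<lambda>n. koszul_sign A n (c n)) {n. c n \<noteq> \<zero>\<^bsub>A\<^esub>})"

definition base_module :: "('a, 'm) dg_module \<Rightarrow> ('a, 'm kos) dg_module" where
  "base_module M =
    \<lparr>carrier = Base ` carrier M,
     mult = undefined, one = undefined,
     zero = Base \<zero>\<^bsub>M\<^esub>,
     add = (\<lambda>u v. Base (kos_base u \<oplus>\<^bsub>M\<^esub> kos_base v)),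
     smult = (\<lambda>b u. Base (b \<odot>\<^bsub>M\<^esub> kos_base u)),
     mod_grade = (\<lambda>n. Base ` mod_grade M n),
     mod_diff = (\<lambda>u. Base (mod_diff M (kos_base u)))\<rparr>"

definition koszul :: "'a dg_ring \<Rightarrow> ('a, 'm kos) dg_module \<Rightarrow> 'a \<Rightarrow> ('a, 'm kos) dg_module" where
  "koszul A M a =
    \<lparr>carrier = {Kos x y | x y. x \<in> carrier M \<and> y \<in> carrier M},
     mult = undefined, one = undefined,
     zero = Kos \<zero>\<^bsub>M\<^esub> \<zero>\<^bsub>M\<^esub>,
     add = (\<lambda>u v. Kos (kos_fst u \<oplus>\<^bsub>M\<^esub> kos_fst v) (kos_snd u \<oplus>\<^bsub>M\<^esub> kos_snd v)),
     smult = (\<lambda>b u. Kos (b \<odot>\<^bsub>M\<^esub> kos_fst u) (sign_twist A b \<odot>\<^bsub>M\<^esub> kos_snd u)),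
     mod_grade = (\<lambda>n. {Kos x y | x y. x \<in> mod_grade M n \<and> y \<in> mod_grade M (n + 1)}),
     mod_diff = (\<lambda>u. Kos (mod_diff M (kos_fst u) \<oplus>\<^bsub>M\<^esub> (a \<odot>\<^bsub>M\<^esub> kos_snd u))
                         (\<ominus>\<^bsub>M\<^esub> mod_diff M (kos_snd u)))\<rparr>"

text \<open>An element of \<open>H0 A\<close> is a coset in \<open>A\<^sup>0\<close>; its lifts are its elements.\<close>

definition H0_lift :: "'a set \<Rightarrow> 'a" where
  "H0_lift x = (SOME a. a \<in> x)"


section \<open>Regular sequences\<close>

text \<open>Here \<open>m\<close> is the maximal ideal of \<open>H0 A\<close>.\<close>

definition regular_element ::
    "'a dg_ring \<Rightarrow> 'a set set \<Rightarrow> ('a, 'm) dg_module \<Rightarrow> 'a set \<Rightarrow> bool" where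
  "regular_element A m M x \<longleftrightarrow> x \<in> m \<and>
     inj_on (\<lambda>y. x \<odot>\<^bsub>cohomology M (dg_inf M)\<^esub> y) (carrier (cohomology M (dg_inf M)))"

primrec kos_regular_seq ::
    "'a dg_ring \<Rightarrow> 'a set set \<Rightarrow> ('a, 'm kos) dg_module \<Rightarrow> 'a set list \<Rightarrow> bool" where
  "kos_regular_seq A m M [] \<longleftrightarrow> True"
| "kos_regular_seq A m M (x # xs) \<longleftrightarrow>
     regular_element A m M x \<and> kos_regular_seq A m (koszul A M (H0_lift x)) xs"

definition dg_regular_seq ::
    "'a dg_ring \<Rightarrow> 'a set set \<Rightarrow> ('a, 'm) dg_module \<Rightarrow> 'a set list \<Rightarrow> bool" where
  "dg_regular_seq A m M xs \<longleftrightarrow> kos_regular_seq A m (base_module M) xs"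


section \<open>Cohen--Macaulay and sequence-regular DG-rings\<close>

definition local_cohen_macaulay :: "'a dg_ring \<Rightarrow> bool" where
  "local_cohen_macaulay A \<longleftrightarrow> bounded_cohomology A \<and>
     (\<exists>m. noetherian_local_dg_ring A m \<and>
       Sup {enat (length xs) | xs. dg_regular_seq A m (dg_self A) xs} = krull_dim (H0 A))"

definition local_sequence_regular :: "'a dg_ring \<Rightarrow> bool" where
  "local_sequence_regular A \<longleftrightarrow> bounded_cohomology A \<and>
     (\<exists>m. noetherian_local_dg_ring A m \<and>
       (\<exists>xs. dg_regular_seq A m (dg_self A) xs \<and> m = Idl\<^bsub>H0 A\<^esub> (set xs)))"

definition cohen_macaulay :: "'a dg_ring \<Rightarrow> bool" where
  "cohen_macaulay A \<longleftrightarrow> noetherian_dg_ring A \<and> bounded_cohomology A \<and>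
     (\<forall>P. primeideal P (H0 A) \<longrightarrow> local_cohen_macaulay (dg_localize_at A P))"

definition sequence_regular :: "'a dg_ring \<Rightarrow> bool" where
  "sequence_regular A \<longleftrightarrow> noetherian_dg_ring A \<and> bounded_cohomology A \<and>
     (\<forall>P. primeideal P (H0 A) \<longrightarrow> local_sequence_regular (dg_localize_at A P))"

end

theory Submission
  imports Defs
begin

text \<open>
  In \<open>K(M; x)\<close> the infimum of the cohomology drops by one exactly when \<open>x\<close> is not \<open>M\<close>-regular, and
  by Nakayama's lemma it never rises if \<open>x\<close> lies in the maximal ideal \<open>m\<close>. If \<open>x\<close> acts locally
  nilpotently on the cohomology of \<open>M\<close>, the infimum does drop. Let \<open>ys\<close> be an \<open>M\<close>-regular sequence and
  let \<open>xs\<close> in \<open>m\<close> generate an \<open>m\<close>-primary ideal. Computing the infimum of \<open>K(M; xs, ys)\<close> in both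
  orders gives \<open>inf K(M; xs) \<ge> inf M + |ys| - |xs|\<close>, whereas \<open>inf K(M; xs) \<le> inf M\<close>. Hence
  \<open>|ys| \<le> |xs|\<close>, and if equality holds then \<open>xs\<close> is itself \<open>M\<close>-regular.

  Taking for \<open>xs\<close> a system of parameters of \<open>H0 A\<close> bounds the length of regular sequences by the
  dimension; together with Krull's height theorem this makes a regular sequence generating \<open>m\<close> a
  minimal generating system of length \<open>krull_dim (H0 A)\<close>. Conversely, if \<open>A\<close> is local-Cohen--Macaulay
  and \<open>H0 A\<close> is regular, take for \<open>xs\<close> a minimal system of generators of \<open>m\<close>.
\<close>

section \<open>Krull's height theorem and systems of parameters\<close>

text \<open>The ring \<open>A\<^sup>0\<close> need not be noetherian; finiteness is available only
  over \<open>H0 A\<close>. Complexes are therefore kept as modules over \<open>A\<^sup>0\<close>,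
  and two facts are carried along from a complex to its Koszul complexes: coboundaries of
  \<open>A\<close> act null-homotopically, so that the action on cohomology factors through
  \<open>H0 A\<close>, and the submodules between coboundaries and cocycles satisfy the ascending
  chain condition. Chain conditions are stated as well-foundedness, because a filtration with two
  steps then becomes a lexicographic pair; \<open>wf_by_pair\<close> serves saturated ideals, Koszul
  complexes and spans alike. The two orders of the comparison play different roles. Starting with
  \<open>ys\<close> costs nothing, by regularity, and \<open>xs\<close> then lowers the infimum by
  at most one per element. Starting with \<open>xs\<close> makes the elements of \<open>xs\<close>,
  and with them all of \<open>m\<close>, act locally nilpotently, so that each element of
  \<open>ys\<close> lowers it by a full degree. If the lengths agree, no drop is left for
  \<open>xs\<close>, and Nakayama's lemma applied backwards turns this into regularity at every
  stage.\<close>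

lemma wf_by_pair:
  assumes "wf rA" "wf rB"
    and "\<And>x y. (x, y) \<in> r \<Longrightarrow> (f x, f y) \<in> rA \<or> (f x = f y \<and> (g x, g y) \<in> rB)"
  shows "wf r"
proof -
  have "r \<subseteq> inv_image (rA <*lex*> rB) (\<lambda>x. (f x, g x))"
    using assms(3) by (auto simp: inv_image_def)
  then show ?thesis
    using wf_subset[OF wf_inv_image[OF wf_lex_prod[OF assms(1,2)]]] by blast
qed

lemma wf_by_map:
  assumes "wf s" "\<And>x y. (x, y) \<in> r \<Longrightarrow> (f x, f y) \<in> s"
  shows "wf r"
  using wf_subset[OF wf_inv_image[OF assms(1)], of r f] assms(2) by (auto simp: inv_image_def)

lemma (in cring) cring_idealI:
  assumes "I \<subseteq> carrier R" "\<zero> \<in> I" "\<And>a b. \<lbrakk>a \<in> I; b \<in> I\<rbrakk> \<Longrightarrow> a \<oplus> b \<in> I"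
    "\<And>a r. \<lbrakk>a \<in> I; r \<in> carrier R\<rbrakk> \<Longrightarrow> r \<otimes> a \<in> I"
  shows "ideal I R"
proof (rule idealI)
  show "subgroup I (add_monoid R)"
  proof (rule add.subgroupI)
    show "\<ominus> a \<in> I" if "a \<in> I" for a
    proof -
      have "\<ominus> a = (\<ominus> \<one>) \<otimes> a" using that assms(1) by (simp add: l_minus subsetD)
      then show ?thesis using assms(4)[OF that, of "\<ominus> \<one>"] by simp
    qed
  qed (use assms in auto)
  show "x \<otimes> a \<in> I" if "a \<in> I" "x \<in> carrier R" for a x using assms that by blast
  show "a \<otimes> x \<in> I" if "a \<in> I" "x \<in> carrier R" for a x
    using assms that by (metis m_comm subsetD)
qed (rule ring_axioms)

section \<open>Adjoining an element to an ideal, and saturation at a prime\<close>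

definition ideal_adjoin :: "('a, 'b) ring_scheme \<Rightarrow> 'a set \<Rightarrow> 'a \<Rightarrow> 'a set" where
  "ideal_adjoin R I x = {a \<oplus>\<^bsub>R\<^esub> r \<otimes>\<^bsub>R\<^esub> x | a r. a \<in> I \<and> r \<in> carrier R}"

lemma ideal_adjoinE:
  assumes "z \<in> ideal_adjoin R I x"
  obtains a r where "a \<in> I" "r \<in> carrier R" "z = a \<oplus>\<^bsub>R\<^esub> r \<otimes>\<^bsub>R\<^esub> x"
  using assms by (auto simp: ideal_adjoin_def)

context cring begin

lemma ideal_adjoin:
  assumes "ideal I R" "x \<in> carrier R"
  shows ideal_adjoin_ideal: "ideal (ideal_adjoin R I x) R"
    and ideal_adjoin_incl: "I \<subseteq> ideal_adjoin R I x"
    and ideal_adjoin_mem: "x \<in> ideal_adjoin R I x"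
proof -
  interpret I: ideal I R by fact
  show sub: "I \<subseteq> ideal_adjoin R I x"
  proof
    fix a assume "a \<in> I"
    then have "a = a \<oplus> \<zero> \<otimes> x" using assms by simp
    then show "a \<in> ideal_adjoin R I x" using \<open>a \<in> I\<close> unfolding ideal_adjoin_def by blast
  qed
  have "x = \<zero> \<oplus> \<one> \<otimes> x" using assms by simp
  then show "x \<in> ideal_adjoin R I x" unfolding ideal_adjoin_def using I.zero_closed by blast
  show "ideal (ideal_adjoin R I x) R"
  proof (rule cring_idealI)
    show "ideal_adjoin R I x \<subseteq> carrier R" using assms unfolding ideal_adjoin_def by auto
    show "\<zero> \<in> ideal_adjoin R I x" using sub by auto
  next
    fix u v assume "u \<in> ideal_adjoin R I x" "v \<in> ideal_adjoin R I x"
    then obtain a r b s where *: "a \<in> I" "r \<in> carrier R" "u = a \<oplus> r \<otimes> x"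
        "b \<in> I" "s \<in> carrier R" "v = b \<oplus> s \<otimes> x" by (auto elim!: ideal_adjoinE)
    then have "u \<oplus> v = (a \<oplus> b) \<oplus> (r \<oplus> s) \<otimes> x"
      using assms(2) I.Icarr by (simp add: l_distr a_ac)
    then show "u \<oplus> v \<in> ideal_adjoin R I x" unfolding ideal_adjoin_def using * I.a_closed by blast
  next
    fix u t assume "u \<in> ideal_adjoin R I x" "t \<in> carrier R"
    then obtain a r where *: "a \<in> I" "r \<in> carrier R" "u = a \<oplus> r \<otimes> x" "t \<in> carrier R"
      by (auto elim!: ideal_adjoinE)
    then have "t \<otimes> u = t \<otimes> a \<oplus> (t \<otimes> r) \<otimes> x"
      using assms(2) I.Icarr by (simp add: r_distr m_assoc)
    then show "t \<otimes> u \<in> ideal_adjoin R I x"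
      unfolding ideal_adjoin_def using * I.I_l_closed by blast
  qed
qed

lemma ideal_adjoin_minimal:
  assumes "ideal J R" "I \<subseteq> J" "x \<in> J"
  shows "ideal_adjoin R I x \<subseteq> J"
proof -
  interpret J: ideal J R by fact
  show ?thesis using assms(2,3) J.a_closed J.I_l_closed by (auto simp: ideal_adjoin_def)
qed

lemma ideal_adjoin_mono: "I \<subseteq> J \<Longrightarrow> ideal_adjoin R I x \<subseteq> ideal_adjoin R J x"
  by (auto simp: ideal_adjoin_def)

end

text \<open>The contraction to \<open>R\<close> of the extension of \<open>J\<close> to the
  localization at \<open>p\<close>. Saturated ideals stand for the ideals of that localization, so
  that arguments over the local ring can be carried out inside \<open>R\<close>.\<close>

definition ideal_saturation :: "('a, 'b) ring_scheme \<Rightarrow> 'a set \<Rightarrow> 'a set \<Rightarrow> 'a set" where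
  "ideal_saturation R p J = {r \<in> carrier R. \<exists>s\<in>carrier R - p. s \<otimes>\<^bsub>R\<^esub> r \<in> J}"

definition saturated_ideal :: "('a, 'b) ring_scheme \<Rightarrow> 'a set \<Rightarrow> 'a set \<Rightarrow> bool" where
  "saturated_ideal R p J \<longleftrightarrow> ideal J R \<and>
     (\<forall>s\<in>carrier R - p. \<forall>r\<in>carrier R. s \<otimes>\<^bsub>R\<^esub> r \<in> J \<longrightarrow> r \<in> J)"

lemma saturated_idealD:
  assumes "saturated_ideal R p J" "s \<in> carrier R" "s \<notin> p" "r \<in> carrier R" "s \<otimes>\<^bsub>R\<^esub> r \<in> J"
  shows "r \<in> J"
  using assms by (auto simp: saturated_ideal_def)

context primeideal begin

lemma not_mem_mult:
  "\<lbrakk>s \<in> carrier R; t \<in> carrier R; s \<notin> I; t \<notin> I\<rbrakk> \<Longrightarrow> s \<otimes> t \<notin> I"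
  using I_prime by blast

lemma one_not_mem: "\<one> \<notin> I"
  using one_imp_carrier I_notcarr by blast

lemma pow_mem: "\<lbrakk>x \<in> carrier R; x [^] (n::nat) \<in> I\<rbrakk> \<Longrightarrow> x \<in> I"
proof (induction n)
  case 0 then show ?case using one_not_mem by simp
next
  case (Suc n) then show ?case using I_prime[of "x [^] n" x] by auto
qed

lemma saturation:
  assumes "ideal J R"
  shows saturated_ideal_saturation: "saturated_ideal R I (ideal_saturation R I J)"
    and saturation_incl: "J \<subseteq> ideal_saturation R I J"
proof -
  interpret J: ideal J R by fact
  show incl: "J \<subseteq> ideal_saturation R I J"
  proof
    fix r assume "r \<in> J"
    then show "r \<in> ideal_saturation R I J" unfolding ideal_saturation_def
      using one_not_mem J.Icarr by (auto intro!: bexI[of _ \<one>])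
  qed
  have "ideal (ideal_saturation R I J) R"
  proof (rule cring_idealI)
    show "ideal_saturation R I J \<subseteq> carrier R" by (auto simp: ideal_saturation_def)
    show "\<zero> \<in> ideal_saturation R I J" using incl by auto
  next
    fix a b assume "a \<in> ideal_saturation R I J" "b \<in> ideal_saturation R I J"
    then obtain s t where *: "a \<in> carrier R" "b \<in> carrier R" "s \<in> carrier R" "t \<in> carrier R"
      "s \<notin> I" "t \<notin> I" "s \<otimes> a \<in> J" "t \<otimes> b \<in> J" by (auto simp: ideal_saturation_def)
    have "(s \<otimes> t) \<otimes> (a \<oplus> b) = t \<otimes> (s \<otimes> a) \<oplus> s \<otimes> (t \<otimes> b)"
      using * by (simp add: r_distr m_ac)
    also have "\<dots> \<in> J" using * J.I_l_closed J.a_closed by blast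
    finally show "a \<oplus> b \<in> ideal_saturation R I J"
      unfolding ideal_saturation_def using * not_mem_mult by (auto intro!: bexI[of _ "s \<otimes> t"])
  next
    fix a r assume "a \<in> ideal_saturation R I J" "r \<in> carrier R"
    then obtain s where *: "a \<in> carrier R" "s \<in> carrier R" "s \<notin> I" "s \<otimes> a \<in> J" "r \<in> carrier R"
      by (auto simp: ideal_saturation_def)
    have "s \<otimes> (r \<otimes> a) = r \<otimes> (s \<otimes> a)" using * by (simp add: m_ac)
    also have "\<dots> \<in> J" using * J.I_l_closed by blast
    finally show "r \<otimes> a \<in> ideal_saturation R I J"
      unfolding ideal_saturation_def using * by auto
  qed
  moreover have "r \<in> ideal_saturation R I J"
    if "s \<in> carrier R - I" "r \<in> carrier R" and sr: "s \<otimes> r \<in> ideal_saturation R I J" for s r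
  proof -
    obtain t where "t \<in> carrier R - I" "t \<otimes> (s \<otimes> r) \<in> J"
      using sr by (auto simp: ideal_saturation_def)
    then have "(t \<otimes> s) \<otimes> r \<in> J" "t \<otimes> s \<in> carrier R - I"
      using that not_mem_mult by (auto simp: m_assoc)
    then show ?thesis using that unfolding ideal_saturation_def by blast
  qed
  ultimately show "saturated_ideal R I (ideal_saturation R I J)"
    by (auto simp: saturated_ideal_def)
qed

lemma saturation_minimal:
  "\<lbrakk>saturated_ideal R I K; J \<subseteq> K\<rbrakk> \<Longrightarrow> ideal_saturation R I J \<subseteq> K"
  by (auto simp: ideal_saturation_def saturated_ideal_def)

lemma saturation_mono: "J \<subseteq> K \<Longrightarrow> ideal_saturation R I J \<subseteq> ideal_saturation R I K"
  by (auto simp: ideal_saturation_def)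

end

section \<open>Noetherian arguments, existence of primes and the height theorem\<close>

locale noetherian_cring = cring R + noetherian_ring R for R (structure)

context noetherian_cring begin

text \<open>In a noetherian ring a nonempty chain of ideals contains its own union, so Zorn's lemma
  applies to every nonempty family of ideals.\<close>

lemma ideal_max:
  assumes "F \<noteq> {}" "\<And>I. I \<in> F \<Longrightarrow> ideal I R"
  shows "\<exists>I\<in>F. \<forall>J\<in>F. I \<subseteq> J \<longrightarrow> J = I"
proof (rule subset_Zorn_nonempty[OF assms(1)])
  fix C assume C: "C \<noteq> {}" "subset.chain F C"
  then have "subset.chain {I. ideal I R} C" using assms(2) by (auto simp: subset.chain_def)
  then have "\<Union>C \<in> C" using C(1) ideal_chain_is_trivial by blast
  then show "\<Union>C \<in> F" using C(2) by (auto simp: subset.chain_def)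
qed

lemma wf_ideal: "wf {(J, I). ideal I R \<and> ideal J R \<and> I \<subset> J}"
proof (rule wfI_min)
  fix x and Q :: "'a set set" assume x: "x \<in> Q"
  show "\<exists>z\<in>Q. \<forall>y. (y, z) \<in> {(J, I). ideal I R \<and> ideal J R \<and> I \<subset> J} \<longrightarrow> y \<notin> Q"
  \<comment> \<open>Only ideals have predecessors, so any other member of \<open>Q\<close> is
    already minimal.\<close>
  proof (cases "\<exists>z\<in>Q. \<not> ideal z R")
    case False
    then obtain I where "I \<in> Q" "\<forall>J\<in>Q. I \<subseteq> J \<longrightarrow> J = I" using ideal_max[of Q] x by blast
    then show ?thesis by blast
  qed auto
qed

end

definition minimal_prime_over :: "('a, 'b) ring_scheme \<Rightarrow> 'a set \<Rightarrow> 'a set \<Rightarrow> bool" where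
  "minimal_prime_over R G p \<longleftrightarrow> primeideal p R \<and> G \<subseteq> p \<and>
     (\<forall>q. primeideal q R \<and> G \<subseteq> q \<and> q \<subseteq> p \<longrightarrow> q = p)"

lemma minimal_prime_overD:
  assumes "minimal_prime_over R G p"
  shows "primeideal p R" "G \<subseteq> p" "\<And>q. \<lbrakk>primeideal q R; G \<subseteq> q; q \<subseteq> p\<rbrakk> \<Longrightarrow> q = p"
  using assms by (auto simp: minimal_prime_over_def)

context noetherian_cring begin

text \<open>An ideal maximal among those that contain \<open>J\<close> and miss \<open>S\<close> is
  prime: if \<open>a\<close> and \<open>b\<close> lie outside it, adjoining either one produces an
  element of \<open>S\<close>. The product of these two elements lies in \<open>S\<close>, and it
  would lie in the ideal if \<open>a \<otimes> b\<close> did.\<close>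

lemma prime_avoiding_multiplicative_set:
  assumes J: "ideal J R" and S: "S \<subseteq> carrier R" "\<one> \<in> S" "\<And>a b. \<lbrakk>a \<in> S; b \<in> S\<rbrakk> \<Longrightarrow> a \<otimes> b \<in> S"
    and disj: "J \<inter> S = {}"
  shows "\<exists>q. primeideal q R \<and> J \<subseteq> q \<and> q \<inter> S = {}"
proof -
  let ?F = "{K. ideal K R \<and> J \<subseteq> K \<and> K \<inter> S = {}}"
  have "J \<in> ?F" using J disj by blast
  then have "\<exists>q\<in>?F. \<forall>K\<in>?F. q \<subseteq> K \<longrightarrow> K = q" by (intro ideal_max) auto
  then obtain q where qF: "q \<in> ?F" and max': "\<forall>K\<in>?F. q \<subseteq> K \<longrightarrow> K = q" by (rule bexE)
  then have q: "ideal q R" "J \<subseteq> q" "q \<inter> S = {}" by blast+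
  have max: "\<And>K. \<lbrakk>ideal K R; J \<subseteq> K; K \<inter> S = {}; q \<subseteq> K\<rbrakk> \<Longrightarrow> K = q"
    using max' by blast
  interpret q: ideal q R by fact
  have meets: "\<exists>c\<in>S. \<exists>u\<in>q. \<exists>r\<in>carrier R. c = u \<oplus> r \<otimes> a"
    if "a \<in> carrier R" "a \<notin> q" for a
  proof (rule ccontr)
    assume "\<not> ?thesis"
    then have "ideal_adjoin R q a \<inter> S = {}" by (force elim!: ideal_adjoinE)
    then show False using max ideal_adjoin[OF q(1) that(1)] q(2) that(2) by blast
  qed
  have "primeideal q R"
  proof (rule primeidealI[OF q(1) is_cring])
    show "carrier R \<noteq> q" using S q(3) by blast
    fix a b assume ab: "a \<in> carrier R" "b \<in> carrier R" "a \<otimes> b \<in> q"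
    show "a \<in> q \<or> b \<in> q"
    proof (rule ccontr)
      assume "\<not> (a \<in> q \<or> b \<in> q)"
      then obtain c u r c' u' r' where *: "c \<in> S" "u \<in> q" "r \<in> carrier R" "c = u \<oplus> r \<otimes> a"
        "c' \<in> S" "u' \<in> q" "r' \<in> carrier R" "c' = u' \<oplus> r' \<otimes> b"
        using meets ab by metis
      have "c \<otimes> c' = u \<otimes> c' \<oplus> (r \<otimes> a) \<otimes> u' \<oplus> (r \<otimes> r') \<otimes> (a \<otimes> b)"
        using * ab q.Icarr by (simp add: l_distr r_distr m_ac a_ac)
      also have "\<dots> \<in> q"
      proof -
        have "c' \<in> carrier R" using * S by blast
        then show ?thesis using * ab(1,3) q.I_l_closed q.I_r_closed q.a_closed by simp
      qed
      finally show False using S(3)[OF *(1,5)] q(3) by blast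
    qed
  qed
  then show ?thesis using q by blast
qed

text \<open>In the localization at \<open>p\<close> the only prime above \<open>J\<close> is that of
  \<open>p\<close>, so every element of \<open>p\<close> is nilpotent modulo \<open>J\<close>; the
  factor \<open>s\<close> clears the denominator. Inside \<open>R\<close>: a prime above
  \<open>J\<close> avoiding all products \<open>s \<otimes> g [^] n\<close> would lie in
  \<open>p\<close> and miss \<open>g\<close>, against minimality.\<close>

lemma minimal_prime_power:
  assumes "minimal_prime_over R J p" "ideal J R" "g \<in> p"
  shows "\<exists>s\<in>carrier R - p. \<exists>n::nat. s \<otimes> g [^] n \<in> J"
proof (rule ccontr)
  assume neg: "\<not> ?thesis"
  interpret p: primeideal p R using minimal_prime_overD[OF assms(1)] by blast
  have g: "g \<in> carrier R" using assms(3) p.Icarr by blast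
  \<comment> \<open>Generated by \<open>g\<close> and the complement of \<open>p\<close>: the
    exponent 0 will confine the prime to \<open>p\<close>, and \<open>s = \<one>\<close> will
    exclude \<open>g\<close> from it.\<close>
  let ?S = "{s \<otimes> g [^] n | s n. s \<in> carrier R - p \<and> n \<in> (UNIV :: nat set)}"
  have "\<exists>q. primeideal q R \<and> J \<subseteq> q \<and> q \<inter> ?S = {}"
  proof (rule prime_avoiding_multiplicative_set[OF assms(2)])
    show "?S \<subseteq> carrier R" using g by auto
    have "\<one> = \<one> \<otimes> g [^] (0::nat)" by simp
    then show "\<one> \<in> ?S" using p.one_not_mem by blast
    show "J \<inter> ?S = {}" using neg by blast
    fix a b assume "a \<in> ?S" "b \<in> ?S"
    then obtain s t and m n :: nat where "s \<in> carrier R - p" "t \<in> carrier R - p"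
      "a = s \<otimes> g [^] m" "b = t \<otimes> g [^] n" by blast
    then have "a \<otimes> b = (s \<otimes> t) \<otimes> g [^] (m + n)" "s \<otimes> t \<in> carrier R - p"
      using g p.not_mem_mult by (auto simp: nat_pow_mult[symmetric] m_ac)
    then show "a \<otimes> b \<in> ?S" by blast
  qed
  then obtain q where q: "primeideal q R" "J \<subseteq> q" "q \<inter> ?S = {}" by blast
  interpret q: primeideal q R by fact
  have "q \<subseteq> p"
  proof
    fix s assume s: "s \<in> q"
    show "s \<in> p"
    proof (rule ccontr)
      assume "s \<notin> p"
      moreover have "s = s \<otimes> g [^] (0::nat)" "s \<in> carrier R" using s q.Icarr by auto
      ultimately have "s \<in> ?S" by blast
      then show False using s q(3) by blast
    qed
  qed
  then have "q = p" using minimal_prime_overD(3)[OF assms(1)] q by blast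
  moreover have "g \<in> ?S"
  proof -
    have "g = \<one> \<otimes> g [^] (1::nat)" using g by simp
    then show ?thesis using p.one_not_mem by blast
  qed
  ultimately show False using q(3) assms(3) by blast
qed

text \<open>A maximal element among the annihilators of nonzero classes modulo \<open>J\<close> is
  prime: if \<open>b\<close> does not kill the class of \<open>r\<close>, then
  \<open>b \<otimes> r\<close> has an annihilator containing that of \<open>r\<close>, hence the
  same one, so whatever kills \<open>b \<otimes> r\<close> already kills \<open>r\<close>.\<close>

lemma associated_prime:
  assumes "ideal J R" "J \<noteq> carrier R"
  shows "\<exists>r\<in>carrier R - J. primeideal {a \<in> carrier R. a \<otimes> r \<in> J} R"
proof -
  interpret J: ideal J R by fact
  let ?c = "\<lambda>r. {a \<in> carrier R. a \<otimes> r \<in> J}"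
  have idl: "ideal (?c r) R" if "r \<in> carrier R" for r
    by (rule cring_idealI) (use that in \<open>auto simp: l_distr m_assoc J.I_l_closed\<close>)
  have ne: "?c ` (carrier R - J) \<noteq> {}" using assms(2) J.Icarr by blast
  obtain I where I: "I \<in> ?c ` (carrier R - J)" "\<forall>K\<in>?c ` (carrier R - J). I \<subseteq> K \<longrightarrow> K = I"
    using ideal_max[OF ne] idl by blast
  then obtain r where r: "r \<in> carrier R" "r \<notin> J" "I = ?c r" by blast
  then have max: "\<And>t. \<lbrakk>t \<in> carrier R; t \<notin> J; ?c r \<subseteq> ?c t\<rbrakk> \<Longrightarrow> ?c t = ?c r"
    using I(2) by blast
  have "primeideal (?c r) R"
  proof (rule primeidealI[OF idl[OF r(1)] is_cring])
    have "\<one> \<notin> ?c r" using r by simp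
    then show "carrier R \<noteq> ?c r" by blast
    fix a b assume ab: "a \<in> carrier R" "b \<in> carrier R" "a \<otimes> b \<in> ?c r"
    show "a \<in> ?c r \<or> b \<in> ?c r"
    proof (rule disjCI)
      assume "b \<notin> ?c r"
      then have "b \<otimes> r \<in> carrier R" "b \<otimes> r \<notin> J" using ab r by auto
      moreover have "?c r \<subseteq> ?c (b \<otimes> r)"
      proof
        fix x assume x: "x \<in> ?c r"
        then have "x \<otimes> (b \<otimes> r) = b \<otimes> (x \<otimes> r)" using ab r by (simp add: m_ac)
        then show "x \<in> ?c (b \<otimes> r)" using x ab J.I_l_closed by auto
      qed
      ultimately have "?c (b \<otimes> r) = ?c r" using max by blast
      moreover have "a \<in> ?c (b \<otimes> r)" using ab r by (simp add: m_assoc)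
      ultimately show "a \<in> ?c r" by blast
    qed
  qed
  then show ?thesis using r by blast
qed

text \<open>The localization of \<open>R / J\<close> at \<open>p\<close> is artinian, since it is filtered by copies of the residue
  field: in the induction, \<open>r\<close> generates such a copy modulo \<open>J\<close>.\<close>

lemma wf_saturated_ideals:
  assumes "minimal_prime_over R J0 p" "J0 \<subseteq> J" "saturated_ideal R p J"
  shows "wf {(D, E). saturated_ideal R p D \<and> saturated_ideal R p E \<and> J \<subseteq> D \<and> D \<subset> E}"
  using assms(2,3)
proof (induction J rule: wf_induct_rule[OF wf_ideal])
  case (1 J)
  interpret p: primeideal p R using minimal_prime_overD[OF assms(1)] by blast
  have J: "ideal J R" using 1(3) by (simp add: saturated_ideal_def)
  interpret J: ideal J R by fact
  show ?case
  proof (cases "J = carrier R")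
    case True
    then have "{(D, E). saturated_ideal R p D \<and> saturated_ideal R p E \<and> J \<subseteq> D \<and> D \<subset> E} = {}"
      by (auto simp: saturated_ideal_def dest: ideal.Icarr)
    then show ?thesis by (metis wf_on_bot)
  next
    case False
    obtain r where r: "r \<in> carrier R" "r \<notin> J" "primeideal {a \<in> carrier R. a \<otimes> r \<in> J} R"
      using associated_prime[OF J False] by blast
    \<comment> \<open>Saturation of \<open>J\<close> puts this annihilator inside \<open>p\<close>,
      and it contains \<open>J0\<close>; minimality of \<open>p\<close> then identifies the
      two.\<close>
    have "{a \<in> carrier R. a \<otimes> r \<in> J} \<subseteq> p"
      using saturated_idealD[OF 1(3) _ _ r(1)] r(2) by blast
    moreover have "J0 \<subseteq> {a \<in> carrier R. a \<otimes> r \<in> J}"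
      using 1(2) J.Icarr J.I_r_closed r(1) by blast
    ultimately have p: "{a \<in> carrier R. a \<otimes> r \<in> J} = p"
      using minimal_prime_overD(3)[OF assms(1) r(3)] by blast
    let ?g = "\<lambda>D. ideal_saturation R p (ideal_adjoin R D r)"
    have g: "saturated_ideal R p (?g D)" "D \<subseteq> ?g D" "r \<in> ?g D" if "saturated_ideal R p D" for D
    proof -
      have D: "ideal D R" using that by (simp add: saturated_ideal_def)
      show "saturated_ideal R p (?g D)" "D \<subseteq> ?g D" "r \<in> ?g D"
        using p.saturation[OF ideal_adjoin_ideal[OF D r(1)]] ideal_adjoin[OF D r(1)] by auto
    qed
    have wfJ: "wf {(D, E). saturated_ideal R p D \<and> saturated_ideal R p E \<and> ?g J \<subseteq> D \<and> D \<subset> E}"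
    proof (rule 1(1))
      show "(?g J, J) \<in> {(J, I). ideal I R \<and> ideal J R \<and> I \<subset> J}"
        using g[OF 1(3)] J r(2) by (auto simp: saturated_ideal_def)
      show "J0 \<subseteq> ?g J" using g[OF 1(3)] 1(2) by blast
      show "saturated_ideal R p (?g J)" using g[OF 1(3)] by blast
    qed
    show ?thesis
    \<comment> \<open>Along a strictly descending chain either \<open>r\<close> is lost, which can
      happen only once, or the saturation of \<open>D\<close> with \<open>r\<close> adjoined
      shrinks. The latter stays above \<open>?g J\<close>, where the induction hypothesis
      applies.\<close>
    proof (rule wf_by_pair[where f = "\<lambda>D. r \<in> D" and g = ?g and rA = "{(False, True)}", OF _ wfJ])
      show "wf {(False, True)}" by (rule wfI_min) auto
      fix D E
      assume "(D, E) \<in> {(D, E). saturated_ideal R p D \<and> saturated_ideal R p E \<and> J \<subseteq> D \<and> D \<subset> E}"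
      then have D: "saturated_ideal R p D" and E: "saturated_ideal R p E"
        and JD: "J \<subseteq> D" and DE: "D \<subset> E" by auto
      interpret D: ideal D R using D by (simp add: saturated_ideal_def)
      interpret E: ideal E R using E by (simp add: saturated_ideal_def)
      have sub: "?g D \<subseteq> ?g E" "?g J \<subseteq> ?g D"
        using DE JD by (auto intro!: p.saturation_mono ideal_adjoin_mono)
      have False if rr: "r \<in> D \<longleftrightarrow> r \<in> E" and eq: "?g D = ?g E"
      proof -
        obtain x where x: "x \<in> E" "x \<notin> D" using DE by blast
        then have "x \<in> ?g D" using eq g[OF E] by blast
        then obtain s where s: "s \<in> carrier R" "s \<notin> p" "s \<otimes> x \<in> ideal_adjoin R D r"
          and xc: "x \<in> carrier R" by (auto simp: ideal_saturation_def)
        then obtain y c where yc: "y \<in> D" "c \<in> carrier R" "s \<otimes> x = y \<oplus> c \<otimes> r"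
          by (auto elim: ideal_adjoinE)
        have crE: "c \<otimes> r \<in> E"
        proof -
          have "c \<otimes> r = s \<otimes> x \<ominus> y"
            using yc r s xc D.Icarr by (simp add: minus_eq a_ac r_neg1 r_neg2 r_neg)
          also have "\<dots> \<in> E" using yc(1) DE x s E.I_l_closed E.a_closed by (auto simp: minus_eq)
          finally show ?thesis .
        qed
        \<comment> \<open>Either \<open>c\<close> kills \<open>r\<close> modulo \<open>J\<close>, or
          \<open>c\<close> is invertible at \<open>p\<close>, which puts \<open>r\<close> into
          \<open>E\<close> and hence into \<open>D\<close>.\<close>
        have "c \<otimes> r \<in> D"
        proof (cases "c \<in> p")
          case True then show ?thesis using p JD by blast
        next
          case False
          then have "r \<in> E" using saturated_idealD[OF E yc(2) _ r(1) crE] by blast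
          then show ?thesis using rr yc D.I_l_closed by blast
        qed
        then have "s \<otimes> x \<in> D" using yc D.a_closed by simp
        then show False using saturated_idealD[OF D s(1,2) xc] x by blast
      qed
      then show "(r \<in> D, r \<in> E) \<in> {(False, True)} \<or> (r \<in> D) = (r \<in> E) \<and> (?g D, ?g E) \<in>
         {(D, E). saturated_ideal R p D \<and> saturated_ideal R p E \<and> ?g J \<subseteq> D \<and> D \<subset> E}"
        using DE sub g[OF D] g[OF E] by blast
    qed
  qed
qed


text \<open>The usual proof with the symbolic powers of \<open>q\<close> replaced by the \<open>q\<close>-saturations of the ideals
  \<open>q' + (y\<^sup>n)\<close> for some \<open>y\<close> in \<open>q\<close> but not in \<open>q'\<close>.\<close>

lemma krull_principal_ideal:
  assumes "primeideal q' R" "primeideal q R" "q' \<subset> q" "q \<subset> p"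
    and min: "minimal_prime_over R (insert x q') p"
  shows False
proof -
  interpret p: primeideal p R using minimal_prime_overD[OF min] by blast
  interpret q: primeideal q R by fact
  interpret q': primeideal q' R by fact
  have xp: "x \<in> p" "q' \<subseteq> p" using minimal_prime_overD(2)[OF min] by auto
  then have x: "x \<in> carrier R" using p.Icarr by blast
  have xq: "x \<notin> q" using minimal_prime_overD(3)[OF min assms(2)] assms(3,4) by blast
  obtain y where y: "y \<in> q" "y \<notin> q'" using assms(3) by blast
  then have yc: "y \<in> carrier R" using q.Icarr by blast
  define Q where "Q n = ideal_saturation R q (ideal_adjoin R q' (y [^] n))" for n :: nat
  define E where "E n = ideal_saturation R p (ideal_adjoin R (Q n) x)" for n
  have adj: "ideal (ideal_adjoin R q' (y [^] n)) R" "q' \<subseteq> ideal_adjoin R q' (y [^] n)"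
    "y [^] n \<in> ideal_adjoin R q' (y [^] n)" for n :: nat
    using ideal_adjoin[OF q'.is_ideal, of "y [^] n"] yc by auto
  have Qsat: "saturated_ideal R q (Q n)" and QI: "ideal_adjoin R q' (y [^] n) \<subseteq> Q n" for n
    using q.saturation[OF adj(1)] by (auto simp: Q_def)
  then have Qid: "ideal (Q n) R" for n by (simp add: saturated_ideal_def)
  have q'Q: "q' \<subseteq> Q n" for n using QI adj by blast
  have Qp: "saturated_ideal R p (Q n)" for n
    using Qsat assms(4) by (auto simp: saturated_ideal_def)
  have Qanti: "Q (Suc n) \<subseteq> Q n" for n
    unfolding Q_def
  proof (rule q.saturation_mono, rule ideal_adjoin_minimal[OF adj(1,2)])
    interpret I: ideal "ideal_adjoin R q' (y [^] n)" R by (rule adj)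
    show "y [^] Suc n \<in> ideal_adjoin R q' (y [^] n)"
      using I.I_r_closed[OF adj(3) yc] by simp
  qed
  have Eadj: "ideal (ideal_adjoin R (Q n) x) R" "Q n \<subseteq> ideal_adjoin R (Q n) x"
    "x \<in> ideal_adjoin R (Q n) x" for n using ideal_adjoin[OF Qid x] by auto
  have E: "saturated_ideal R p (E n)" "ideal_adjoin R (Q n) x \<subseteq> E n" for n
    using p.saturation[OF Eadj(1)] by (auto simp: E_def)
  have Eanti: "E (Suc n) \<subseteq> E n" for n
    unfolding E_def by (intro p.saturation_mono ideal_adjoin_mono Qanti)
  define J where "J = ideal_saturation R p (ideal_adjoin R q' x)"
  have J: "saturated_ideal R p J" "insert x q' \<subseteq> J"
    using p.saturation[OF ideal_adjoin_ideal[OF q'.is_ideal x]] ideal_adjoin[OF q'.is_ideal x]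
    by (auto simp: J_def)
  have JE: "J \<subseteq> E n" for n
    unfolding J_def E_def by (intro p.saturation_mono ideal_adjoin_mono q'Q)
  \<comment> \<open>All \<open>E n\<close> contain \<open>J\<close>, which contains \<open>x\<close>
    and \<open>q'\<close>. The chain thus lives in an artinian localization and becomes
    stationary.\<close>
  obtain n where EE: "E n \<subseteq> E (Suc n)"
  proof -
    have "E 0 \<in> range E" by blast
    then obtain z where z: "z \<in> range E" and zmin: "\<And>D. (D, z) \<in> {(D, E).
        saturated_ideal R p D \<and> saturated_ideal R p E \<and> J \<subseteq> D \<and> D \<subset> E} \<Longrightarrow> D \<notin> range E"
      using wfE_min[OF wf_saturated_ideals[OF min J(2,1)], of "E 0" "range E"] by blast
    then obtain n where n: "z = E n" by blast
    have "(E (Suc n), z) \<notin> {(D, E).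
        saturated_ideal R p D \<and> saturated_ideal R p E \<and> J \<subseteq> D \<and> D \<subset> E}"
      using zmin by blast
    then have "\<not> E (Suc n) \<subset> E n" using E(1) JE by (simp add: n)
    then show ?thesis using that Eanti by blast
  qed
  \<comment> \<open>Nakayama's lemma for \<open>Q n = Q (Suc n) + x Q n\<close> localized at \<open>p\<close>\<close>
  have "Q n \<subseteq> Q (Suc n)"
  proof (rule ccontr)
    assume neg: "\<not> Q n \<subseteq> Q (Suc n)"
    \<comment> \<open>A maximal saturated \<open>V\<close> strictly below \<open>Q n\<close> makes
      \<open>Q n\<close> cyclic over \<open>V\<close> up to saturation, which reduces Nakayama's
      lemma to a single coefficient.\<close>
    let ?F = "{V. saturated_ideal R p V \<and> Q (Suc n) \<subseteq> V \<and> V \<subset> Q n}"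
    have "Q (Suc n) \<in> ?F" using Qp Qanti neg by blast
    then have "\<exists>V\<in>?F. \<forall>W\<in>?F. V \<subseteq> W \<longrightarrow> W = V"
      by (intro ideal_max) (auto simp: saturated_ideal_def)
    then obtain V where "V \<in> ?F" and Vmax: "\<forall>W\<in>?F. V \<subseteq> W \<longrightarrow> W = V" by (rule bexE)
    then have V: "saturated_ideal R p V" "Q (Suc n) \<subseteq> V" "V \<subset> Q n" by auto
    interpret V: ideal V R using V(1) by (simp add: saturated_ideal_def)
    obtain g where g: "g \<in> Q n" "g \<notin> V" using V(3) by blast
    interpret Qn: ideal "Q n" R by (rule Qid)
    have gc: "g \<in> carrier R" using g Qn.Icarr by blast
    let ?W = "ideal_saturation R p (ideal_adjoin R V g)"
    have W: "saturated_ideal R p ?W" "ideal_adjoin R V g \<subseteq> ?W"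
      using p.saturation[OF ideal_adjoin_ideal[OF V.is_ideal gc]] by auto
    moreover have "V \<subseteq> ?W" "g \<in> ?W" using W ideal_adjoin[OF V.is_ideal gc] by auto
    moreover have "?W \<subseteq> Q n"
      using V(3) g(1) by (intro p.saturation_minimal[OF Qp] ideal_adjoin_minimal[OF Qid]) auto
    ultimately have W_eq: "?W = Q n" using Vmax g(2) V(2) by blast
    have "g \<in> E (Suc n)" using EE E(2) Eadj(2) g(1) by blast
    then obtain s where s: "s \<in> carrier R" "s \<notin> p" "s \<otimes> g \<in> ideal_adjoin R (Q (Suc n)) x"
      by (auto simp: E_def ideal_saturation_def)
    obtain a b where ab: "a \<in> Q (Suc n)" "b \<in> carrier R" "s \<otimes> g = a \<oplus> b \<otimes> x"
      using s(3) by (rule ideal_adjoinE)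
    have ac: "a \<in> carrier R" "a \<in> Q n" "a \<in> V" using ab(1) Qanti Qn.Icarr V(2) by blast+
    \<comment> \<open>This is where saturation at the smaller prime \<open>q\<close> enters:
      \<open>x\<close> lies outside \<open>q\<close>, so the coefficient \<open>b\<close> of
      \<open>x\<close> can be pulled back into \<open>Q n\<close>.\<close>
    have "x \<otimes> b = s \<otimes> g \<ominus> a"
      using ab s(1) gc x ac by (simp add: minus_eq a_ac r_neg1 r_neg2 r_neg m_comm)
    also have "\<dots> \<in> Q n" using g s ac by (simp add: minus_eq Qn.I_l_closed)
    finally have "b \<in> Q n" using saturated_idealD[OF Qsat x xq ab(2)] by blast
    then have "b \<in> ?W" using W_eq by blast
    then obtain t where t: "t \<in> carrier R" "t \<notin> p" "t \<otimes> b \<in> ideal_adjoin R V g"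
      by (auto simp: ideal_saturation_def)
    obtain v r where vr: "v \<in> V" "r \<in> carrier R" "t \<otimes> b = v \<oplus> r \<otimes> g"
      using t(3) by (rule ideal_adjoinE)
    have vc: "v \<in> carrier R" using vr by auto
    have "(t \<otimes> s) \<otimes> g = t \<otimes> a \<oplus> (t \<otimes> b) \<otimes> x"
      using s t gc ab x ac by (simp add: m_assoc r_distr)
    also have "(t \<otimes> b) \<otimes> x = v \<otimes> x \<oplus> (r \<otimes> x) \<otimes> g"
      unfolding vr(3) using vr(2) vc gc x by (simp add: l_distr m_assoc m_comm[of g x])
    finally have "(t \<otimes> s \<ominus> r \<otimes> x) \<otimes> g = t \<otimes> a \<oplus> v \<otimes> x"
      using s t gc vr vc x ac
      by (simp add: minus_eq l_distr l_minus a_ac r_neg1 r_neg2 r_neg)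
    also have "\<dots> \<in> V" using ac(3) vr t x V.I_l_closed V.I_r_closed V.a_closed by blast
    finally have mem: "(t \<otimes> s \<ominus> r \<otimes> x) \<otimes> g \<in> V" .
    \<comment> \<open>The product \<open>t \<otimes> s\<close> lies outside the prime
      \<open>p\<close> and \<open>r \<otimes> x\<close> inside, so this coefficient is invertible at
      \<open>p\<close> and forces \<open>g\<close> into \<open>V\<close>.\<close>
    have "t \<otimes> s \<ominus> r \<otimes> x \<notin> p"
    proof
      assume "t \<otimes> s \<ominus> r \<otimes> x \<in> p"
      then have "(t \<otimes> s \<ominus> r \<otimes> x) \<oplus> r \<otimes> x \<in> p" using p.I_l_closed[OF xp(1) vr(2)] by blast
      moreover have "(t \<otimes> s \<ominus> r \<otimes> x) \<oplus> r \<otimes> x = t \<otimes> s"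
        using s t vr x by (simp add: minus_eq a_assoc l_neg)
      ultimately show False using p.not_mem_mult[OF t(1) s(1) t(2) s(2)] by simp
    qed
    then show False using saturated_idealD[OF V(1) _ _ gc mem] g(2) s t vr x by simp
  qed
  \<comment> \<open>Modulo \<open>q'\<close>, which misses \<open>y\<close>, the factor
    \<open>y [^] n\<close> can be cancelled. What remains is that \<open>s\<close> agrees with a
    multiple of \<open>y\<close> modulo \<open>q'\<close>, hence lies in \<open>q\<close>, although
    it was chosen outside.\<close>
  then have "y [^] n \<in> Q (Suc n)" using QI adj(3) by blast
  then obtain s where s: "s \<in> carrier R" "s \<notin> q"
    "s \<otimes> y [^] n \<in> ideal_adjoin R q' (y [^] Suc n)"
    by (auto simp: Q_def ideal_saturation_def)
  obtain a r where ar: "a \<in> q'" "r \<in> carrier R" "s \<otimes> y [^] n = a \<oplus> r \<otimes> y [^] Suc n"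
    using s(3) by (rule ideal_adjoinE)
  have "(s \<ominus> r \<otimes> y) \<otimes> y [^] n = a"
    using s(1) ar yc q'.Icarr
    by (simp add: minus_eq l_distr r_distr l_minus r_minus a_assoc r_neg m_ac)
  then have "s \<ominus> r \<otimes> y \<in> q'"
    using ar s yc y(2) q'.I_prime[of "s \<ominus> r \<otimes> y" "y [^] n"] q'.pow_mem[OF yc] by auto
  then have "(s \<ominus> r \<otimes> y) \<oplus> r \<otimes> y \<in> q" using assms(3) y q.I_l_closed ar by blast
  moreover have "(s \<ominus> r \<otimes> y) \<oplus> r \<otimes> y = s"
    using s yc ar by (simp add: minus_eq a_assoc l_neg)
  ultimately show False using s by simp
qed

text \<open>Induction on the number of generators. With \<open>q\<close> maximal below
  \<open>p\<close> and \<open>x\<close> a generator outside \<open>q\<close>, the prime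
  \<open>p\<close> is minimal over \<open>q\<close> and \<open>x\<close>. So, up to a factor outside
  \<open>p\<close>, a power of each other generator \<open>g\<close> equals some \<open>y g\<close>
  in \<open>q\<close> plus a multiple of \<open>x\<close>. The principal ideal theorem then shows
  \<open>q\<close> to be minimal over these \<open>y g\<close>, whose number is smaller by
  one.\<close>

lemma krull_height:
  assumes "finite G" "minimal_prime_over R G p" "card G \<le> n"
    "prime_chain R (Suc n) P" "P (Suc n) = p"
  shows False
  using assms
proof (induction n arbitrary: G p P)
  case 0
  then have "G = {}" "primeideal (P 0) R" "P 0 \<subset> p" by (auto simp: prime_chain_def)
  then show ?case using minimal_prime_overD(3)[OF 0(2), of "P 0"] by blast
next
  case (Suc n)
  note min = Suc.prems(2)
  interpret p: primeideal p R using minimal_prime_overD[OF min] by blast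
  let ?F = "{q. primeideal q R \<and> P (Suc n) \<subseteq> q \<and> q \<subset> p}"
  have "P (Suc n) \<in> ?F" using Suc.prems(4,5) by (auto simp: prime_chain_def)
  then have "\<exists>q\<in>?F. \<forall>K\<in>?F. q \<subseteq> K \<longrightarrow> K = q"
    by (intro ideal_max) (auto simp: primeideal_def)
  then obtain q where "q \<in> ?F" and qmax: "\<forall>K\<in>?F. q \<subseteq> K \<longrightarrow> K = q" by (rule bexE)
  then have q: "primeideal q R" "P (Suc n) \<subseteq> q" "q \<subset> p" by auto
  interpret q: primeideal q R by fact
  obtain x where x: "x \<in> G" "x \<notin> q" using minimal_prime_overD(3)[OF min q(1)] q(3) by blast
  have Gp: "G \<subseteq> p" using minimal_prime_overD(2)[OF min] .
  then have Gc: "G \<subseteq> carrier R" using p.Icarr by blast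
  then have xc: "x \<in> carrier R" using x by blast
  let ?J = "ideal_adjoin R q x"
  have J: "ideal ?J R" "q \<subseteq> ?J" "x \<in> ?J" using ideal_adjoin[OF q.is_ideal xc] by auto
  have "minimal_prime_over R ?J p"
    unfolding minimal_prime_over_def
  proof (intro conjI allI impI)
    show "?J \<subseteq> p" using q(3) x(1) Gp by (intro ideal_adjoin_minimal[OF p.is_ideal]) auto
    fix q1 assume "primeideal q1 R \<and> ?J \<subseteq> q1 \<and> q1 \<subseteq> p"
    then show "q1 = p" using qmax J x(2) q(2) by blast
  qed (rule p.primeideal)
  then have pow: "\<exists>s\<in>carrier R - p. \<exists>N::nat. s \<otimes> g [^] N \<in> ?J" if "g \<in> G" for g
    using minimal_prime_power[OF _ J(1)] that Gp by blast
  have "\<exists>s y. s \<in> carrier R - p \<and> y \<in> q \<and>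
      (\<exists>N::nat. \<exists>r\<in>carrier R. s \<otimes> g [^] N = y \<oplus> r \<otimes> x)" if g: "g \<in> G" for g
  proof -
    obtain s and N :: nat where s: "s \<in> carrier R - p" "s \<otimes> g [^] N \<in> ?J" using pow[OF g] by blast
    obtain y r where "y \<in> q" "r \<in> carrier R" "s \<otimes> g [^] N = y \<oplus> r \<otimes> x"
      using s(2) by (rule ideal_adjoinE)
    then show ?thesis using s(1) by blast
  qed
  then obtain s y where sy: "\<And>g. g \<in> G \<Longrightarrow> s g \<in> carrier R - p \<and> y g \<in> q \<and>
      (\<exists>N::nat. \<exists>r\<in>carrier R. s g \<otimes> g [^] N = y g \<oplus> r \<otimes> x)"
    by metis
  let ?Y = "y ` (G - {x})"
  have Yq: "?Y \<subseteq> q" using sy by blast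
  \<comment> \<open>Since \<open>s g\<close> lies outside \<open>p\<close>, a prime below
    \<open>p\<close> that contains \<open>x\<close> and all \<open>y g\<close> also contains a power
    of each \<open>g\<close>, hence all of \<open>G\<close>.\<close>
  have minY: "q1 = p" if q1: "primeideal q1 R" "insert x ?Y \<subseteq> q1" "q1 \<subseteq> p" for q1
  proof -
    interpret q1: primeideal q1 R by fact
    have "g \<in> q1" if g: "g \<in> G" for g
    proof (cases "g = x")
      case False
      then obtain N :: nat and r where "r \<in> carrier R" "s g \<otimes> g [^] N = y g \<oplus> r \<otimes> x"
        using sy[OF g] by blast
      moreover have "y g \<in> q1" using q1(2) g False by blast
      moreover have "x \<in> q1" using q1(2) by blast
      ultimately have "s g \<otimes> g [^] N \<in> q1" by (simp add: q1.I_l_closed)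
      moreover have "g \<in> carrier R" "s g \<in> carrier R" "s g \<notin> q1" using sy[OF g] g Gc q1(3) by auto
      ultimately have "g [^] N \<in> q1" using q1.I_prime by blast
      then show ?thesis using q1.pow_mem \<open>g \<in> carrier R\<close> by blast
    qed (use q1 in auto)
    then show ?thesis using minimal_prime_overD(3)[OF min q1(1)] q1(3) by blast
  qed
  have "minimal_prime_over R ?Y q"
    unfolding minimal_prime_over_def
  proof (intro conjI allI impI q.primeideal Yq)
    fix q' assume q': "primeideal q' R \<and> ?Y \<subseteq> q' \<and> q' \<subseteq> q"
    show "q' = q"
    proof (rule ccontr)
      assume "q' \<noteq> q"
      \<comment> \<open>Otherwise \<open>q'\<close>, \<open>q\<close> and \<open>p\<close> would
        form a chain whose top is minimal over \<open>q'\<close> and the single element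
        \<open>x\<close>.\<close>
      then have "q' \<subset> q" using q' by blast
      moreover have "minimal_prime_over R (insert x q') p"
        unfolding minimal_prime_over_def
      proof (intro conjI allI impI p.primeideal)
        show "insert x q' \<subseteq> p" using x(1) Gp q' q(3) by blast
        fix q1 assume "primeideal q1 R \<and> insert x q' \<subseteq> q1 \<and> q1 \<subseteq> p"
        then show "q1 = p" using q' by (intro minY) auto
      qed
      ultimately show False using krull_principal_ideal[OF _ q(1) _ q(3), of q' x] q' by blast
    qed
  qed
  moreover have "card ?Y \<le> n"
    using Suc.prems(1,3) x(1) card_image_le[of "G - {x}" y] by simp
  \<comment> \<open>The top member \<open>p\<close> is dropped and its predecessor raised to
    \<open>q\<close>, so that the chain still exceeds the number of generators by one.\<close>
  moreover have "prime_chain R (Suc n) (P(Suc n := q))"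
    using Suc.prems(4) q(1,2) by (fastforce simp: prime_chain_def less_Suc_eq)
  ultimately show ?case
    by (intro Suc.IH[of ?Y q "P(Suc n := q)"]) (use Suc.prems(1) in \<open>simp_all add: fun_upd_def\<close>)
qed

section \<open>Local rings and the bound on the dimension\<close>

lemma proper_ideal_subset_local:
  assumes "local_ring R m" "ideal I R" "I \<noteq> carrier R"
  shows "I \<subseteq> m"
proof -
  let ?F = "{K. ideal K R \<and> I \<subseteq> K \<and> K \<noteq> carrier R}"
  have "I \<in> ?F" using assms by blast
  then have "\<exists>K\<in>?F. \<forall>L\<in>?F. K \<subseteq> L \<longrightarrow> L = K" by (intro ideal_max) auto
  then obtain K where "K \<in> ?F" and Kmax: "\<forall>L\<in>?F. K \<subseteq> L \<longrightarrow> L = K" by (rule bexE)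
  then have K: "ideal K R" "I \<subseteq> K" "K \<noteq> carrier R" by auto
  have "maximalideal K R"
  proof (rule maximalidealI[OF K(1)])
    fix L assume "ideal L R" "K \<subseteq> L" "L \<subseteq> carrier R"
    then show "L = K \<or> L = carrier R" using Kmax K(2) by blast
  qed (use K in auto)
  then show ?thesis using assms(1) K(2) by (auto simp: local_ring_def)
qed

lemma local_ring_prime: "local_ring R m \<Longrightarrow> primeideal m R"
  using maximalideal_prime by (auto simp: local_ring_def)

lemma prime_subset_local:
  assumes "local_ring R m" "primeideal q R" shows "q \<subseteq> m"
proof -
  interpret q: primeideal q R by fact
  show ?thesis using proper_ideal_subset_local[OF assms(1) q.is_ideal] q.I_notcarr by blast
qed

lemma local_ring_unit:
  assumes "local_ring R m" "x \<in> carrier R" "x \<notin> m"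
  shows "\<exists>u\<in>carrier R. u \<otimes> x = \<one>"
proof -
  have "PIdl x = carrier R"
    using proper_ideal_subset_local[OF assms(1) cgenideal_ideal[OF assms(2)]]
      cgenideal_self[OF assms(2)] assms(3) by blast
  then have "\<one> \<in> PIdl x" by simp
  then show ?thesis by (auto simp: cgenideal_def)
qed

theorem krull_dim_le_card:
  assumes "local_ring R m" "finite G" "G \<subseteq> carrier R" "m = Idl G"
  shows "krull_dim R \<le> enat (card G)"
  unfolding krull_dim_def
proof (rule Sup_least, clarsimp)
  fix k P assume P: "prime_chain R k P"
  show "k \<le> card G"
  proof (rule ccontr)
    assume k: "\<not> k \<le> card G"
    have m: "primeideal m R" using local_ring_prime[OF assms(1)] .
    have "minimal_prime_over R G m"
      unfolding minimal_prime_over_def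
    proof (intro conjI allI impI m)
      show "G \<subseteq> m" using genideal_self assms by blast
      fix q assume "primeideal q R \<and> G \<subseteq> q \<and> q \<subseteq> m"
      then show "q = m" using genideal_minimal assms(4) by (auto simp: primeideal_def)
    qed
    \<comment> \<open>The height theorem speaks of chains ending in the minimal prime, so the long
      chain is truncated and \<open>m\<close> put on top.\<close>
    moreover have "prime_chain R (Suc (card G)) (P(Suc (card G) := m))"
    proof -
      have "primeideal (P (Suc (card G))) R" "P (card G) \<subset> P (Suc (card G))"
        using P k by (auto simp: prime_chain_def)
      then have "P (card G) \<subset> m" using prime_subset_local[OF assms(1)] by blast
      then show ?thesis using P k m by (auto simp: prime_chain_def less_Suc_eq)
    qed
    ultimately show False using krull_height[OF assms(2)] by fastforce
  qed
qed

text \<open>Noetherian induction: if \<open>a \<otimes> b\<close> lies in \<open>J\<close> while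
  \<open>a\<close> and \<open>b\<close> do not, every prime above \<open>J\<close> also lies above
  \<open>J\<close> with \<open>a\<close> or with \<open>b\<close> adjoined. The family contains all
  minimal primes of \<open>J\<close>, possibly among others, which is enough for prime
  avoidance.\<close>

lemma finite_primes_below:
  assumes "ideal J R"
  shows "\<exists>F. finite F \<and> (\<forall>q\<in>F. primeideal q R \<and> J \<subseteq> q) \<and>
    (\<forall>q. primeideal q R \<longrightarrow> J \<subseteq> q \<longrightarrow> (\<exists>q0\<in>F. q0 \<subseteq> q))"
  using assms
proof (induction J rule: wf_induct_rule[OF wf_ideal])
  case (1 J)
  interpret J: ideal J R by fact
  consider "J = carrier R" | "primeideal J R" | "J \<noteq> carrier R" "\<not> primeideal J R" by blast
  then show ?case
  proof cases
    case 1
    then have "\<not> J \<subseteq> q" if "primeideal q R" for q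
    proof -
      interpret q: primeideal q R by fact
      show ?thesis using 1 q.one_not_mem by blast
    qed
    then show ?thesis by (intro exI[of _ "{}"]) auto
  next
    case 2
    then show ?thesis by (intro exI[of _ "{J}"]) auto
  next
    case 3
    then obtain a b where ab: "a \<in> carrier R" "b \<in> carrier R" "a \<otimes> b \<in> J" "a \<notin> J" "b \<notin> J"
      using primeidealI[OF J.is_ideal is_cring] by blast
    have IH: "\<exists>F. finite F \<and> (\<forall>q\<in>F. primeideal q R \<and> ideal_adjoin R J c \<subseteq> q) \<and>
       (\<forall>q. primeideal q R \<longrightarrow> ideal_adjoin R J c \<subseteq> q \<longrightarrow> (\<exists>q0\<in>F. q0 \<subseteq> q))"
      if "c \<in> carrier R" "c \<notin> J" for c
      using 1(1)[of "ideal_adjoin R J c"] 1(2) ideal_adjoin[OF J.is_ideal that(1)] that(2) by blast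
    obtain F1 where F1: "finite F1" "\<forall>q\<in>F1. primeideal q R \<and> ideal_adjoin R J a \<subseteq> q"
      "\<forall>q. primeideal q R \<longrightarrow> ideal_adjoin R J a \<subseteq> q \<longrightarrow> (\<exists>q0\<in>F1. q0 \<subseteq> q)"
      using IH[OF ab(1,4)] by (elim exE conjE)
    obtain F2 where F2: "finite F2" "\<forall>q\<in>F2. primeideal q R \<and> ideal_adjoin R J b \<subseteq> q"
      "\<forall>q. primeideal q R \<longrightarrow> ideal_adjoin R J b \<subseteq> q \<longrightarrow> (\<exists>q0\<in>F2. q0 \<subseteq> q)"
      using IH[OF ab(2,5)] by (elim exE conjE)
    have "\<exists>q0\<in>F1 \<union> F2. q0 \<subseteq> q" if q: "primeideal q R" "J \<subseteq> q" for q
    proof -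
      interpret q: primeideal q R by fact
      have "a \<in> q \<or> b \<in> q" using q.I_prime ab q(2) by blast
      then show ?thesis
        using F1(3) F2(3) q(1) ideal_adjoin_minimal[OF q.is_ideal q(2)] by (meson UnI1 UnI2)
    qed
    moreover have "\<forall>q\<in>F1 \<union> F2. primeideal q R \<and> J \<subseteq> q"
      using F1(2) F2(2) ideal_adjoin_incl[OF J.is_ideal] ab(1,2) by blast
    ultimately show ?thesis using F1(1) F2(1) by (intro exI[of _ "F1 \<union> F2"]) auto
  qed
qed

end

section \<open>Prime avoidance and systems of parameters\<close>

context cring begin

text \<open>Elements outside \<open>q\<close> are picked from \<open>m\<close> and from each ideal
  of \<open>F\<close>; their product lies in all of these ideals and stays outside \<open>q\<close>
  by primality.\<close>

lemma ex_mem_ideals_not_mem_prime: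
  assumes "primeideal q R" "ideal m R" "\<not> m \<subseteq> q" "finite F"
    "\<And>Q. Q \<in> F \<Longrightarrow> ideal Q R \<and> \<not> Q \<subseteq> q"
  shows "\<exists>y\<in>m. y \<notin> q \<and> (\<forall>Q\<in>F. y \<in> Q)"
  using assms(4,5)
proof (induction F rule: finite_induct)
  case empty
  then show ?case using assms(3) by blast
next
  case (insert Q F)
  interpret q: primeideal q R by fact
  interpret m: ideal m R by fact
  interpret Q: ideal Q R using insert by blast
  obtain y where y: "y \<in> m" "y \<notin> q" "\<forall>Q\<in>F. y \<in> Q" using insert by auto
  obtain z where z: "z \<in> Q" "z \<notin> q" using insert by blast
  have c: "y \<in> carrier R" "z \<in> carrier R" using y z m.Icarr Q.Icarr by auto
  have "z \<otimes> y \<in> T" if "T \<in> F" for T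
    using insert that y c by (meson ideal.I_l_closed insertCI)
  moreover have "z \<otimes> y \<in> m" "z \<otimes> y \<in> Q" "z \<otimes> y \<notin> q"
    using y z c q.not_mem_mult m.I_l_closed Q.I_r_closed by auto
  ultimately show ?case by blast
qed

text \<open>The primes may be comparable. When \<open>x\<close> falls into the new prime
  \<open>q\<close>, it is corrected by some \<open>y\<close> outside \<open>q\<close> that lies in
  every old prime not contained in \<open>q\<close>; the old primes inside \<open>q\<close> are
  avoided together with \<open>q\<close>.\<close>

lemma prime_avoidance:
  assumes "finite F" "ideal m R" "\<And>Q. Q \<in> F \<Longrightarrow> primeideal Q R \<and> \<not> m \<subseteq> Q"
  shows "\<exists>x\<in>m. \<forall>Q\<in>F. x \<notin> Q"
  using assms(1,3)
proof (induction F rule: finite_induct)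
  case empty
  then show ?case using additive_subgroup.zero_closed[OF ideal.axioms(1)[OF assms(2)]] by blast
next
  case (insert q F)
  interpret q: primeideal q R using insert by blast
  interpret m: ideal m R by fact
  obtain x where x: "x \<in> m" "\<forall>Q\<in>F. x \<notin> Q" using insert by auto
  show ?case
  proof (cases "x \<in> q")
    case True
    let ?F = "{Q\<in>F. \<not> Q \<subseteq> q}"
    have "\<exists>y\<in>m. y \<notin> q \<and> (\<forall>Q\<in>?F. y \<in> Q)"
      using insert by (intro ex_mem_ideals_not_mem_prime[OF q.primeideal assms(2)])
        (auto simp: primeideal_def)
    then obtain y where y: "y \<in> m" "y \<notin> q" "\<forall>Q\<in>?F. y \<in> Q" by blast
    have c: "x \<in> carrier R" "y \<in> carrier R" using x y m.Icarr by auto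
    have *: "(y \<oplus> x) \<oplus> \<ominus> x = y" "(x \<oplus> y) \<oplus> \<ominus> y = x"
      using c by (simp_all add: a_assoc r_neg)
    have nq: "x \<oplus> y \<notin> q"
      using *(1) a_comm[OF c] q.a_closed[OF _ q.a_inv_closed[OF True], of "y \<oplus> x"] y(2) by auto
    have "x \<oplus> y \<notin> Q" if Q: "Q \<in> F" for Q
    proof (cases "Q \<subseteq> q")
      case True then show ?thesis using nq by blast
    next
      case False
      interpret Q: primeideal Q R using insert Q by blast
      have "y \<in> Q" using False Q y(3) by blast
      then show ?thesis using *(2) x(2) Q Q.a_closed[OF _ Q.a_inv_closed, of "x \<oplus> y" y] by auto
    qed
    then show ?thesis using nq x y by (intro bexI[of _ "x \<oplus> y"]) auto
  qed (use x in blast)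
qed

end

context noetherian_cring begin

text \<open>Each parameter avoids a finite family of primes lying below all primes above
  \<open>J\<close>. A chain above \<open>J\<close> and the parameter can therefore be prolonged
  downwards by a member of the family, so the bound on chains drops by one with each choice.\<close>

lemma parameters_over_ideal:
  assumes "local_ring R m" "ideal J R" "\<not> (\<exists>P. prime_chain R (Suc d) P \<and> J \<subseteq> P 0)"
  shows "\<exists>xs. length xs = d \<and> set xs \<subseteq> m \<and>
    (\<forall>q. primeideal q R \<longrightarrow> J \<union> set xs \<subseteq> q \<longrightarrow> q = m)"
  using assms(2,3)
proof (induction d arbitrary: J)
  case 0
  have "q = m" if "primeideal q R" "J \<subseteq> q" for q
  proof (rule ccontr)
    assume "q \<noteq> m"
    then have "prime_chain R (Suc 0) (\<lambda>i. if i = 0 then q else m)"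
      using that prime_subset_local[OF assms(1)] local_ring_prime[OF assms(1)]
      by (auto simp: prime_chain_def)
    then show False using 0(2) that(2) by (metis (mono_tags, lifting))
  qed
  then show ?case by auto
next
  case (Suc d)
  interpret J: ideal J R by fact
  interpret m: primeideal m R using local_ring_prime[OF assms(1)] .
  obtain F where F: "finite F" "\<forall>q\<in>F. primeideal q R \<and> J \<subseteq> q"
    "\<forall>q. primeideal q R \<longrightarrow> J \<subseteq> q \<longrightarrow> (\<exists>q0\<in>F. q0 \<subseteq> q)"
    using finite_primes_below[OF Suc.prems(1)] by blast
  \<comment> \<open>The maximal ideal has to be exempted, as \<open>x\<close> is to lie in it. This
    is harmless, because a chain with a strict inclusion starts strictly below
    \<open>m\<close>.\<close>
  have "\<exists>x\<in>m. \<forall>Q\<in>F - {m}. x \<notin> Q"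
    using F(1,2) prime_subset_local[OF assms(1)]
    by (intro prime_avoidance[OF _ m.is_ideal]) blast+
  then obtain x where x: "x \<in> m" "\<forall>Q\<in>F - {m}. x \<notin> Q" by blast
  have xc: "x \<in> carrier R" using x by auto
  note adj = ideal_adjoin[OF J.is_ideal xc]
  have "\<not> (\<exists>P. prime_chain R (Suc d) P \<and> ideal_adjoin R J x \<subseteq> P 0)"
  proof
    assume "\<exists>P. prime_chain R (Suc d) P \<and> ideal_adjoin R J x \<subseteq> P 0"
    then obtain P where P: "prime_chain R (Suc d) P" "ideal_adjoin R J x \<subseteq> P 0" by blast
    have P0: "primeideal (P 0) R" "P 0 \<subset> P (Suc 0)" "primeideal (P (Suc 0)) R"
      using P(1) by (auto simp: prime_chain_def)
    obtain Q where Q: "Q \<in> F" "Q \<subseteq> P 0" using F(3) P0(1) P(2) adj(2) by blast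
    have "Q \<noteq> m" using Q(2) P0(2) prime_subset_local[OF assms(1) P0(3)] by blast
    then have "Q \<subset> P 0" using Q x(2) P(2) adj(3) by blast
    then have "prime_chain R (Suc (Suc d)) (\<lambda>i. case i of 0 \<Rightarrow> Q | Suc j \<Rightarrow> P j)"
      using P(1) F(2) Q(1) by (auto simp: prime_chain_def split: nat.split)
    then show False using Suc.prems(2) F(2) Q(1) by fastforce
  qed
  then obtain xs where "length xs = d" "set xs \<subseteq> m"
    "\<forall>q. primeideal q R \<longrightarrow> ideal_adjoin R J x \<union> set xs \<subseteq> q \<longrightarrow> q = m"
    using Suc.IH[OF adj(1)] by blast
  moreover have "ideal_adjoin R J x \<subseteq> q" if "primeideal q R" "J \<union> set (x # xs) \<subseteq> q" for q
    using that by (intro ideal_adjoin_minimal) (auto simp: primeideal_def)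
  ultimately show ?case using x(1) by (intro exI[of _ "x # xs"]) auto
qed

text \<open>As \<open>m\<close> is the only prime above the parameters, a power of each of its
  elements lies in their ideal up to a factor outside \<open>m\<close>, and such a factor is a unit.
  The statement about powers is the form in which parameters later produce local nilpotence.\<close>

theorem system_of_parameters:
  assumes "local_ring R m" "krull_dim R = enat d"
  shows "\<exists>xs. length xs = d \<and> set xs \<subseteq> m \<and> (\<forall>y\<in>m. \<exists>k::nat. y [^] k \<in> Idl (set xs))"
proof -
  interpret m: primeideal m R using local_ring_prime[OF assms(1)] .
  have "\<not> prime_chain R (Suc d) P" for P
  proof
    assume "prime_chain R (Suc d) P"
    then have "enat (Suc d) \<le> krull_dim R" unfolding krull_dim_def by (intro Sup_upper) blast
    then show False using assms(2) by simp
  qed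
  then obtain xs where xs: "length xs = d" "set xs \<subseteq> m"
    "\<forall>q. primeideal q R \<longrightarrow> {\<zero>} \<union> set xs \<subseteq> q \<longrightarrow> q = m"
    using parameters_over_ideal[OF assms(1) zeroideal, of d] by blast
  have xsc: "set xs \<subseteq> carrier R" using xs(2) m.Icarr by blast
  interpret I: ideal "Idl (set xs)" R by (rule genideal_ideal[OF xsc])
  have sub: "set xs \<subseteq> Idl (set xs)" using genideal_self[OF xsc] .
  have "minimal_prime_over R (Idl (set xs)) m"
    unfolding minimal_prime_over_def
  proof (intro conjI allI impI m.primeideal genideal_minimal m.is_ideal xs(2))
    fix q assume q: "primeideal q R \<and> Idl (set xs) \<subseteq> q \<and> q \<subseteq> m"
    moreover have "{\<zero>} \<union> set xs \<subseteq> q" using q sub I.zero_closed by blast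
    ultimately show "q = m" using xs(3) by blast
  qed
  then have "\<exists>k::nat. y [^] k \<in> Idl (set xs)" if y: "y \<in> m" for y
  proof -
    obtain s and k :: nat where s: "s \<in> carrier R - m" "s \<otimes> y [^] k \<in> Idl (set xs)"
      using minimal_prime_power[OF \<open>minimal_prime_over R (Idl (set xs)) m\<close> I.is_ideal y] by blast
    then obtain u where u: "u \<in> carrier R" "u \<otimes> s = \<one>"
      using local_ring_unit[OF assms(1)] by blast
    have yc: "y \<in> carrier R" using y by auto
    have "u \<otimes> (s \<otimes> y [^] k) = (u \<otimes> s) \<otimes> y [^] k" using u(1) s(1) yc by (simp add: m_assoc)
    also have "\<dots> = y [^] k" by (simp only: u(2) l_one[OF nat_pow_closed[OF yc]])
    finally have "u \<otimes> (s \<otimes> y [^] k) = y [^] k" .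
    then show ?thesis using I.I_l_closed[OF s(2) u(1)] by auto
  qed
  then show ?thesis using xs by blast
qed

end

section \<open>Koszul complexes\<close>

lemma dg_zero_part_simps [simp]:
  "carrier (dg_zero_part A) = dg_grade A 0" "mult (dg_zero_part A) = mult A"
  "one (dg_zero_part A) = one A" "zero (dg_zero_part A) = zero A" "add (dg_zero_part A) = add A"
  by (simp_all add: dg_zero_part_def)

lemma dg_self_simps [simp]:
  "carrier (dg_self A) = carrier A" "zero (dg_self A) = zero A" "add (dg_self A) = add A"
  "smult (dg_self A) = mult A" "mod_grade (dg_self A) = dg_grade A" "mod_diff (dg_self A) = dg_diff A"
  by (simp_all add: dg_self_def)

lemma koszul_simps [simp]:
  "Kos x y \<in> carrier (koszul A N a) \<longleftrightarrow> x \<in> carrier N \<and> y \<in> carrier N"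
  "zero (koszul A N a) = Kos (zero N) (zero N)"
  "add (koszul A N a) (Kos x y) (Kos x' y') = Kos (add N x x') (add N y y')"
  "smult (koszul A N a) b (Kos x y) = Kos (smult N b x) (smult N (sign_twist A b) y)"
  "Kos x y \<in> mod_grade (koszul A N a) n \<longleftrightarrow> x \<in> mod_grade N n \<and> y \<in> mod_grade N (n + 1)"
  "mod_diff (koszul A N a) (Kos x y) =
     Kos (add N (mod_diff N x) (smult N a y)) (a_inv N (mod_diff N y))"
  by (simp_all add: koszul_def)

lemma koszul_carrierE:
  assumes "u \<in> carrier (koszul A N a)"
  obtains x y where "u = Kos x y" "x \<in> carrier N" "y \<in> carrier N"
  using assms by (auto simp: koszul_def)

lemma koszul_gradeE:
  assumes "u \<in> mod_grade (koszul A N a) n"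
  obtains x y where "u = Kos x y" "x \<in> mod_grade N n" "y \<in> mod_grade N (n + 1)"
  using assms by (auto simp: koszul_def)

text \<open>A homotopy between multiplication by \<open>c\<close> and zero. Additivity and linearity
  over \<open>A\<^sup>0\<close> are what lets it pass to Koszul complexes.\<close>

definition null_homotopy :: "'a dg_ring \<Rightarrow> ('a, 'm) dg_module \<Rightarrow> 'a \<Rightarrow> ('m \<Rightarrow> 'm) \<Rightarrow> bool" where
  "null_homotopy A N c h \<longleftrightarrow> (\<forall>n. \<forall>x\<in>mod_grade N n. h x \<in> mod_grade N (n - 1) \<and>
     mod_diff N (h x) \<oplus>\<^bsub>N\<^esub> h (mod_diff N x) = c \<odot>\<^bsub>N\<^esub> x \<and>
     (\<forall>y\<in>mod_grade N n. h (x \<oplus>\<^bsub>N\<^esub> y) = h x \<oplus>\<^bsub>N\<^esub> h y) \<and>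
     (\<forall>a\<in>dg_grade A 0. h (a \<odot>\<^bsub>N\<^esub> x) = a \<odot>\<^bsub>N\<^esub> h x))"

text \<open>Only the action of \<open>A\<^sup>0\<close> is retained; elements of negative degree are remembered
  through the null-homotopies of the coboundaries they induce.\<close>

locale dg_complex = module "dg_zero_part A" N
  for N :: "('a, 'm) dg_module" (structure) and A :: "'a dg_ring" +
  assumes comm_dg_ring: "comm_dg_ring A"
    and mod_grade_subgroup: "additive_subgroup (mod_grade N n) N"
    and smult_grade: "\<lbrakk>a \<in> dg_grade A 0; x \<in> mod_grade N n\<rbrakk> \<Longrightarrow> a \<odot> x \<in> mod_grade N n"
    and mod_diff_grade: "x \<in> mod_grade N n \<Longrightarrow> mod_diff N x \<in> mod_grade N (n + 1)"
    and mod_diff_add: "\<lbrakk>x \<in> mod_grade N n; y \<in> mod_grade N n\<rbrakk> \<Longrightarrow>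
      mod_diff N (x \<oplus> y) = mod_diff N x \<oplus> mod_diff N y"
    and mod_diff_smult: "\<lbrakk>a \<in> dg_grade A 0; x \<in> mod_grade N n\<rbrakk> \<Longrightarrow>
      mod_diff N (a \<odot> x) = a \<odot> mod_diff N x"
    and mod_diff_diff: "x \<in> mod_grade N n \<Longrightarrow> mod_diff N (mod_diff N x) = \<zero>"
    and coboundary_null: "c \<in> coboundaries (dg_self A) 0 \<Longrightarrow> \<exists>h. null_homotopy A N c h"

definition linear_subset :: "'a dg_ring \<Rightarrow> ('a, 'm) dg_module \<Rightarrow> 'm set \<Rightarrow> bool" where
  "linear_subset A N W \<longleftrightarrow> W \<subseteq> carrier N \<and> \<zero>\<^bsub>N\<^esub> \<in> W \<and> (\<forall>x\<in>W. \<forall>y\<in>W. x \<oplus>\<^bsub>N\<^esub> y \<in> W) \<and>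
     (\<forall>a\<in>dg_grade A 0. \<forall>x\<in>W. a \<odot>\<^bsub>N\<^esub> x \<in> W)"

text \<open>The ascending chain condition for submodules of \<open>W / V\<close>. For coboundaries
  inside cocycles it says that the cohomology is a noetherian module, without quotients and without
  a change of rings to \<open>H0 A\<close>.\<close>

definition noetherian_between ::
    "'a dg_ring \<Rightarrow> ('a, 'm) dg_module \<Rightarrow> 'm set \<Rightarrow> 'm set \<Rightarrow> bool" where
  "noetherian_between A N V W \<longleftrightarrow> wf {(Y, X). linear_subset A N X \<and> linear_subset A N Y \<and>
     V \<subseteq> X \<and> X \<subset> Y \<and> Y \<subseteq> W}"

definition linear_adjoin ::
    "'a dg_ring \<Rightarrow> ('a, 'm) dg_module \<Rightarrow> 'm set \<Rightarrow> 'm \<Rightarrow> 'm set" where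
  "linear_adjoin A N W g = {w \<oplus>\<^bsub>N\<^esub> r \<odot>\<^bsub>N\<^esub> g | w r. w \<in> W \<and> r \<in> dg_grade A 0}"

definition exact_at :: "('a, 'm) dg_module \<Rightarrow> int \<Rightarrow> bool" where
  "exact_at N n \<longleftrightarrow> cocycles N n \<subseteq> coboundaries N n"

definition locally_nilpotent :: "'a dg_ring \<Rightarrow> ('a, 'm) dg_module \<Rightarrow> 'a set" where
  "locally_nilpotent A N = {c \<in> dg_grade A 0. \<forall>n. \<forall>z\<in>cocycles N n.
     \<exists>k::nat. (c [^]\<^bsub>dg_zero_part A\<^esub> k) \<odot>\<^bsub>N\<^esub> z \<in> coboundaries N n}"

text \<open>If \<open>H0 A\<close> is local, this holds for all lifts of elements of its maximal ideal.\<close>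

definition radical_element :: "'a dg_ring \<Rightarrow> 'a \<Rightarrow> bool" where
  "radical_element A a \<longleftrightarrow> a \<in> dg_grade A 0 \<and> (\<forall>r\<in>dg_grade A 0. \<exists>u\<in>dg_grade A 0.
     \<exists>e\<in>coboundaries (dg_self A) 0.
       u \<otimes>\<^bsub>A\<^esub> (\<one>\<^bsub>A\<^esub> \<ominus>\<^bsub>dg_zero_part A\<^esub> (r \<otimes>\<^bsub>A\<^esub> a)) = \<one>\<^bsub>A\<^esub> \<oplus>\<^bsub>A\<^esub> e)"

lemma wf_max_elt:
  assumes "wf r" "x \<in> Q"
  shows "\<exists>z\<in>Q. \<forall>y\<in>Q. (y, z) \<notin> r"
  using wfE_min[OF assms] by metis

context dg_complex begin

lemma grade_closed:
  shows grade_carrier: "x \<in> mod_grade N n \<Longrightarrow> x \<in> carrier N"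
    and grade_zero: "\<zero> \<in> mod_grade N n"
    and grade_add: "\<lbrakk>x \<in> mod_grade N n; y \<in> mod_grade N n\<rbrakk> \<Longrightarrow> x \<oplus> y \<in> mod_grade N n"
    and grade_uminus: "x \<in> mod_grade N n \<Longrightarrow> \<ominus> x \<in> mod_grade N n"
proof -
  interpret S: additive_subgroup "mod_grade N n" N by (rule mod_grade_subgroup)
  show "x \<in> mod_grade N n \<Longrightarrow> x \<in> carrier N" "\<zero> \<in> mod_grade N n"
    "\<lbrakk>x \<in> mod_grade N n; y \<in> mod_grade N n\<rbrakk> \<Longrightarrow> x \<oplus> y \<in> mod_grade N n"
    "x \<in> mod_grade N n \<Longrightarrow> \<ominus> x \<in> mod_grade N n"
    using S.a_subset by auto
qed

lemma mod_diff_grade': "x \<in> mod_grade N (n - 1) \<Longrightarrow> mod_diff N x \<in> mod_grade N n"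
  using mod_diff_grade[of x "n - 1"] by simp

lemma smult_closed': "\<lbrakk>a \<in> dg_grade A 0; x \<in> carrier N\<rbrakk> \<Longrightarrow> a \<odot> x \<in> carrier N"
  using smult_closed by simp

lemma smult_grade_carrier: "\<lbrakk>a \<in> dg_grade A 0; x \<in> mod_grade N n\<rbrakk> \<Longrightarrow> a \<odot> x \<in> carrier N"
  using smult_grade grade_carrier by blast

lemma mod_diff_carrier: "x \<in> mod_grade N n \<Longrightarrow> mod_diff N x \<in> carrier N"
  using mod_diff_grade grade_carrier by blast

lemma uminus_zero: "\<ominus> \<zero> = \<zero>"
  by (rule minus_equality) simp_all

lemma uminus_eq_zero: "x \<in> carrier N \<Longrightarrow> \<ominus> x = \<zero> \<Longrightarrow> x = \<zero>"
  using minus_minus[of x] uminus_zero by simp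

lemma mod_diff_zero: "mod_diff N \<zero> = \<zero>"
proof -
  have "mod_diff N \<zero> \<oplus> mod_diff N \<zero> = mod_diff N \<zero>"
    using mod_diff_add[OF grade_zero grade_zero] by simp
  then show ?thesis using mod_diff_carrier[OF grade_zero] by (metis a_comm add.r_cancel_one)
qed

lemma mod_diff_uminus:
  assumes "x \<in> mod_grade N n" shows "mod_diff N (\<ominus> x) = \<ominus> mod_diff N x"
proof (rule minus_equality[symmetric])
  show "mod_diff N (\<ominus> x) \<oplus> mod_diff N x = \<zero>"
    using mod_diff_add[OF grade_uminus[OF assms] assms] grade_carrier[OF assms]
    by (simp add: l_neg mod_diff_zero)
qed (use assms grade_uminus mod_diff_carrier in blast)+

lemma smult_uminus: "\<lbrakk>a \<in> dg_grade A 0; x \<in> carrier N\<rbrakk> \<Longrightarrow> a \<odot> (\<ominus> x) = \<ominus> (a \<odot> x)"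
  using smult_r_minus by simp

lemma smult_zero: "a \<in> dg_grade A 0 \<Longrightarrow> a \<odot> \<zero> = \<zero>"
  using smult_r_null by simp

lemma smult_smult:
  "\<lbrakk>a \<in> dg_grade A 0; b \<in> dg_grade A 0; x \<in> carrier N\<rbrakk> \<Longrightarrow> a \<odot> (b \<odot> x) = (a \<otimes>\<^bsub>A\<^esub> b) \<odot> x"
  using smult_assoc1[of a b x] by simp

lemma smult_commute:
  "\<lbrakk>a \<in> dg_grade A 0; b \<in> dg_grade A 0; x \<in> carrier N\<rbrakk> \<Longrightarrow> a \<odot> (b \<odot> x) = b \<odot> (a \<odot> x)"
  using R.m_comm[of a b] by (simp add: smult_smult)

lemma cocycleD: "z \<in> cocycles N n \<Longrightarrow> z \<in> mod_grade N n" "z \<in> cocycles N n \<Longrightarrow> mod_diff N z = \<zero>"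
  by (auto simp: cocycles_def)

lemma cocycleI: "\<lbrakk>z \<in> mod_grade N n; mod_diff N z = \<zero>\<rbrakk> \<Longrightarrow> z \<in> cocycles N n"
  by (auto simp: cocycles_def)

lemma coboundaryI: "x \<in> mod_grade N (n - 1) \<Longrightarrow> mod_diff N x \<in> coboundaries N n"
  by (auto simp: coboundaries_def)

lemma coboundaryE:
  assumes "z \<in> coboundaries N n"
  obtains x where "x \<in> mod_grade N (n - 1)" "z = mod_diff N x"
  using assms by (auto simp: coboundaries_def)

lemma coboundary_cocycle: "coboundaries N n \<subseteq> cocycles N n"
proof
  fix z assume "z \<in> coboundaries N n"
  then obtain x where "x \<in> mod_grade N (n - 1)" "z = mod_diff N x" by (rule coboundaryE)
  then show "z \<in> cocycles N n" using mod_diff_grade' mod_diff_diff by (auto simp: cocycles_def)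
qed

lemma linear_cocycles: "linear_subset A N (cocycles N n)"
  unfolding linear_subset_def
  by (auto simp: cocycles_def grade_carrier grade_zero grade_add smult_grade mod_diff_zero
      mod_diff_add mod_diff_smult smult_zero)

lemma linear_coboundaries: "linear_subset A N (coboundaries N n)"
  unfolding linear_subset_def
proof (intro conjI ballI)
  show "coboundaries N n \<subseteq> carrier N"
    using coboundary_cocycle cocycleD grade_carrier by blast
  show "\<zero> \<in> coboundaries N n" using coboundaryI[OF grade_zero, of n] by (simp add: mod_diff_zero)
next
  fix x y assume "x \<in> coboundaries N n" "y \<in> coboundaries N n"
  then obtain u v where "u \<in> mod_grade N (n - 1)" "v \<in> mod_grade N (n - 1)"
    "x = mod_diff N u" "y = mod_diff N v" by (auto elim!: coboundaryE)
  then show "x \<oplus> y \<in> coboundaries N n"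
    using coboundaryI[OF grade_add, of u n v] mod_diff_add by simp
next
  fix a x assume a: "a \<in> dg_grade A 0" and "x \<in> coboundaries N n"
  then obtain u where "u \<in> mod_grade N (n - 1)" "x = mod_diff N u" by (auto elim!: coboundaryE)
  then show "a \<odot> x \<in> coboundaries N n"
    using coboundaryI[OF smult_grade[OF a], of u n] mod_diff_smult[OF a] by simp
qed

lemma linear_subsetD:
  assumes "linear_subset A N W"
  shows "x \<in> W \<Longrightarrow> x \<in> carrier N" "\<zero> \<in> W" "\<lbrakk>x \<in> W; y \<in> W\<rbrakk> \<Longrightarrow> x \<oplus> y \<in> W"
    "\<lbrakk>a \<in> dg_grade A 0; x \<in> W\<rbrakk> \<Longrightarrow> a \<odot> x \<in> W"
  using assms by (auto simp: linear_subset_def)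

lemma linear_subset_uminus:
  assumes "linear_subset A N W" "x \<in> W" shows "\<ominus> x \<in> W"
proof -
  have "\<ominus>\<^bsub>dg_zero_part A\<^esub> \<one>\<^bsub>A\<^esub> \<in> dg_grade A 0" using R.a_inv_closed[OF R.one_closed] by simp
  moreover have "(\<ominus>\<^bsub>dg_zero_part A\<^esub> \<one>\<^bsub>A\<^esub>) \<odot> x = \<ominus> x"
    using smult_l_minus[OF R.one_closed, of x] smult_one[of x] linear_subsetD(1)[OF assms] by simp
  ultimately show ?thesis using linear_subsetD(4)[OF assms(1) _ assms(2)] by metis
qed

lemma linear_subset_cancel:
  assumes "linear_subset A N W" "x \<in> W" "y \<in> carrier N" "x \<oplus> y \<in> W" shows "y \<in> W"
proof -
  have "\<ominus> x \<oplus> (x \<oplus> y) \<in> W" using linear_subsetD(3)[OF assms(1)] linear_subset_uminus assms by blast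
  then show ?thesis using linear_subsetD(1)[OF assms(1,2)] assms(3) by (simp add: r_neg1)
qed

lemma linear_adjoin:
  assumes "linear_subset A N W" "g \<in> carrier N"
  shows "linear_subset A N (linear_adjoin A N W g)"
    and "W \<subseteq> linear_adjoin A N W g" and "g \<in> linear_adjoin A N W g"
proof -
  let ?X = "{w \<oplus> r \<odot> g | w r. w \<in> W \<and> r \<in> dg_grade A 0}"
  note W = linear_subsetD[OF assms(1)]
  have z: "\<zero>\<^bsub>A\<^esub> \<in> dg_grade A 0" "\<one>\<^bsub>A\<^esub> \<in> dg_grade A 0"
    using R.zero_closed R.one_closed by simp_all
  have zg: "\<zero>\<^bsub>A\<^esub> \<odot> g = \<zero>" "\<one>\<^bsub>A\<^esub> \<odot> g = g"
    using smult_l_null[OF assms(2)] smult_one[OF assms(2)] by simp_all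
  have sub: "W \<subseteq> ?X"
  proof
    fix w assume "w \<in> W"
    then have "w = w \<oplus> \<zero>\<^bsub>A\<^esub> \<odot> g" using W zg by simp
    then show "w \<in> ?X" using z \<open>w \<in> W\<close> by blast
  qed
  have "g = \<zero> \<oplus> \<one>\<^bsub>A\<^esub> \<odot> g" using zg assms by simp
  then have g: "g \<in> ?X" using z W by blast
  have "linear_subset A N ?X"
    unfolding linear_subset_def
  proof (intro conjI ballI)
    show "?X \<subseteq> carrier N" using W assms smult_closed' by auto
    show "\<zero> \<in> ?X" using sub W by blast
  next
    fix x y assume "x \<in> ?X" "y \<in> ?X"
    then obtain w r v s where *: "w \<in> W" "v \<in> W" "r \<in> dg_grade A 0" "s \<in> dg_grade A 0"
      "x = w \<oplus> r \<odot> g" "y = v \<oplus> s \<odot> g" by blast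
    then have "x \<oplus> y = (w \<oplus> v) \<oplus> (r \<oplus>\<^bsub>A\<^esub> s) \<odot> g"
      using smult_l_distr[of r s g] assms W smult_closed' by (simp add: a_ac)
    moreover have "r \<oplus>\<^bsub>A\<^esub> s \<in> dg_grade A 0" using R.a_closed[of r s] * by simp
    ultimately show "x \<oplus> y \<in> ?X" using W *(1,2) by blast
  next
    fix a x assume a: "a \<in> dg_grade A 0" and "x \<in> ?X"
    then obtain w r where *: "w \<in> W" "r \<in> dg_grade A 0" "x = w \<oplus> r \<odot> g" by blast
    then have "a \<odot> x = (a \<odot> w) \<oplus> (a \<otimes>\<^bsub>A\<^esub> r) \<odot> g"
      using smult_r_distr[of a w "r \<odot> g"] a assms W smult_closed' by (simp add: smult_smult)
    moreover have "a \<otimes>\<^bsub>A\<^esub> r \<in> dg_grade A 0" using R.m_closed[of a r] * a by simp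
    ultimately show "a \<odot> x \<in> ?X" using W(4)[OF a *(1)] by blast
  qed
  then show "linear_subset A N (linear_adjoin A N W g)"
    "W \<subseteq> linear_adjoin A N W g" "g \<in> linear_adjoin A N W g"
    using sub g by (simp_all add: linear_adjoin_def)
qed

lemma null_homotopy_zero:
  assumes "null_homotopy A N c h" shows "h \<zero> = \<zero>"
proof -
  have "h \<zero> \<in> mod_grade N (0 - 1)" "h (\<zero> \<oplus> \<zero>) = h \<zero> \<oplus> h \<zero>"
    using assms grade_zero[of 0] unfolding null_homotopy_def by blast+
  then show ?thesis using grade_carrier by (metis add.r_cancel_one l_zero zero_closed)
qed

text \<open>On cocycles the homotopy formula reads \<open>c \<odot> z = mod_diff N (h z)\<close>.
  Hence the action of \<open>A\<^sup>0\<close> on cohomology factors through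
  \<open>H0 A\<close>.\<close>

lemma coboundary_smult:
  assumes "c \<in> coboundaries (dg_self A) 0" "z \<in> cocycles N n"
  shows "c \<odot> z \<in> coboundaries N n"
proof -
  obtain h where h: "null_homotopy A N c h" using coboundary_null[OF assms(1)] by blast
  then have "h z \<in> mod_grade N (n - 1)" "mod_diff N (h z) \<oplus> h (mod_diff N z) = c \<odot> z"
    using cocycleD(1)[OF assms(2)] unfolding null_homotopy_def by blast+
  then show ?thesis
    using coboundaryI[of "h z" n] null_homotopy_zero[OF h] cocycleD(2)[OF assms(2)]
      mod_diff_carrier by auto
qed

end

text \<open>The decomposition of \<open>b\<close> has at most one nonzero component, in degree zero,
  where the sign is trivial. Consequently \<open>A\<^sup>0\<close> acts on Koszul complexes
  componentwise.\<close>

lemma (in comm_dg_ring) sign_twist_zero_part: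
  assumes "b \<in> dg_grade A 0" shows "sign_twist A b = b"
proof -
  interpret S: additive_subgroup "dg_grade A n" A for n by (rule grade_subgroup)
  have bc: "b \<in> carrier A" using assms S.a_subset by blast
  let ?c = "\<lambda>n::int. if n = 0 then b else \<zero>"
  have "{n. ?c n \<noteq> \<zero>} = (if b = \<zero> then {} else {0})" by auto
  then have "homogeneous_parts A (dg_grade A) b ?c"
    using assms bc unfolding homogeneous_parts_def by auto
  then have "(THE c. homogeneous_parts A (dg_grade A) b c) = ?c"
    using direct_sum[OF bc] by (metis the_equality)
  then show ?thesis
    unfolding sign_twist_def Let_def using bc \<open>{n. ?c n \<noteq> \<zero>} = _\<close>
    by (auto simp: koszul_sign_def)
qed

section \<open>The Koszul complex on one element\<close>

lemma koszul_abelian_group: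
  assumes "abelian_group N"
  shows "abelian_group (koszul A N a)"
    and koszul_uminus: "\<lbrakk>x \<in> carrier N; y \<in> carrier N\<rbrakk> \<Longrightarrow>
      \<ominus>\<^bsub>koszul A N a\<^esub> Kos x y = Kos (\<ominus>\<^bsub>N\<^esub> x) (\<ominus>\<^bsub>N\<^esub> y)"
proof -
  interpret abelian_group N by fact
  show K: "abelian_group (koszul A N a)"
    by (rule abelian_groupI)
      (auto elim!: koszul_carrierE simp: a_ac intro!: bexI[of _ "Kos (\<ominus>\<^bsub>N\<^esub> _) (\<ominus>\<^bsub>N\<^esub> _)"] l_neg)
  interpret K: abelian_group "koszul A N a" by (rule K)
  show "\<ominus>\<^bsub>koszul A N a\<^esub> Kos x y = Kos (\<ominus>\<^bsub>N\<^esub> x) (\<ominus>\<^bsub>N\<^esub> y)" if "x \<in> carrier N" "y \<in> carrier N"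
    using that by (intro K.minus_equality) (auto simp: l_neg)
qed

context
  fixes N :: "('a, 'm kos) dg_module" (structure) and A a
  assumes N: "dg_complex N A" and a: "a \<in> dg_grade A 0"
begin

interpretation dg_complex N A by (rule N)

lemma koszul_smult:
  "b \<in> dg_grade A 0 \<Longrightarrow> b \<odot>\<^bsub>koszul A N a\<^esub> Kos x y = Kos (b \<odot> x) (b \<odot> y)"
  using comm_dg_ring.sign_twist_zero_part[OF comm_dg_ring] by simp

text \<open>Both the homotopy and the Koszul generator have degree -1, whence the sign on the second
  component. With it the mixed terms \<open>a \<odot> h y\<close> of the two composites cancel, by
  linearity of \<open>h\<close>.\<close>

lemma koszul_null_homotopy:
  assumes "null_homotopy A N c h" "c \<in> dg_grade A 0"
  shows "null_homotopy A (koszul A N a) c (\<lambda>u. Kos (h (kos_fst u)) (\<ominus> h (kos_snd u)))"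
proof -
  have h: "h x \<in> mod_grade N (n - 1)" "mod_diff N (h x) \<oplus> h (mod_diff N x) = c \<odot> x"
    "y \<in> mod_grade N n \<Longrightarrow> h (x \<oplus> y) = h x \<oplus> h y"
    "b \<in> dg_grade A 0 \<Longrightarrow> h (b \<odot> x) = b \<odot> h x" if "x \<in> mod_grade N n" for x y b n
    using assms that unfolding null_homotopy_def by blast+
  have h': "h x \<in> mod_grade N n" if "x \<in> mod_grade N (n + 1)" for x n using h(1)[OF that] by simp
  have hc: "h x \<in> carrier N" if "x \<in> mod_grade N n" for x n using h(1)[OF that] grade_carrier by blast
  have hm: "h (\<ominus> x) = \<ominus> h x" if x: "x \<in> mod_grade N n" for x n
  proof -
    have "h (\<ominus> x) \<oplus> h x = \<zero>"
      using h(3)[OF grade_uminus[OF x] x] null_homotopy_zero[OF assms(1)] grade_carrier[OF x]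
      by (simp add: l_neg)
    then show ?thesis
      using minus_equality hc[OF x] hc[OF grade_uminus[OF x]] by metis
  qed
  show ?thesis
    unfolding null_homotopy_def
  proof (intro allI ballI conjI)
    fix n u assume "u \<in> mod_grade (koszul A N a) n"
    then obtain x y where u: "u = Kos x y" and x: "x \<in> mod_grade N n" and y: "y \<in> mod_grade N (n + 1)"
      by (rule koszul_gradeE)
    have dx: "mod_diff N x \<in> mod_grade N (n + 1)" and dy: "mod_diff N y \<in> mod_grade N (n + 1 + 1)"
      and ay: "a \<odot> y \<in> mod_grade N (n + 1)"
      using mod_diff_grade[OF x] mod_diff_grade[OF y] smult_grade[OF a y] by this
    note c = grade_carrier[OF x] grade_carrier[OF y] hc[OF x] hc[OF y] hc[OF dx] hc[OF dy] hc[OF ay]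
      mod_diff_carrier[OF h(1)[OF x]] mod_diff_carrier[OF h(1)[OF y]] smult_grade_carrier[OF a h(1)[OF y]]
    show "Kos (h (kos_fst u)) (\<ominus> h (kos_snd u)) \<in> mod_grade (koszul A N a) (n - 1)"
      using u h(1)[OF x] h'[OF y] grade_uminus by simp
    have "mod_diff N (h x) \<oplus> a \<odot> (\<ominus> h y) \<oplus> (h (mod_diff N x) \<oplus> a \<odot> h y)
        = mod_diff N (h x) \<oplus> h (mod_diff N x)"
      using c by (simp add: smult_uminus[OF a] a_ac r_neg1 r_neg2 r_neg)
    then show "mod_diff (koszul A N a) (Kos (h (kos_fst u)) (\<ominus> h (kos_snd u))) \<oplus>\<^bsub>koszul A N a\<^esub>
       Kos (h (kos_fst (mod_diff (koszul A N a) u))) (\<ominus> h (kos_snd (mod_diff (koszul A N a) u)))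
        = c \<odot>\<^bsub>koszul A N a\<^esub> u"
      using u x y dx dy ay c h(2)[OF x] h(2)[OF y] h(3)[OF dx ay] h(4)[OF y a] hm[OF dy]
      by (simp add: koszul_smult[OF assms(2)] mod_diff_uminus[OF h(1)[OF y]] minus_minus del: koszul_simps(4))
    fix v assume "v \<in> mod_grade (koszul A N a) n"
    then obtain x' y' where v: "v = Kos x' y'" and x': "x' \<in> mod_grade N n"
      and y': "y' \<in> mod_grade N (n + 1)" by (rule koszul_gradeE)
    show "Kos (h (kos_fst (u \<oplus>\<^bsub>koszul A N a\<^esub> v))) (\<ominus> h (kos_snd (u \<oplus>\<^bsub>koszul A N a\<^esub> v))) =
      Kos (h (kos_fst u)) (\<ominus> h (kos_snd u)) \<oplus>\<^bsub>koszul A N a\<^esub>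
      Kos (h (kos_fst v)) (\<ominus> h (kos_snd v))"
      using u v h(3)[OF x x'] h(3)[OF y y'] hc[OF y] hc[OF y'] by (simp add: minus_add)
  next
    fix n u b assume "u \<in> mod_grade (koszul A N a) n" and b: "b \<in> dg_grade A 0"
    then obtain x y where u: "u = Kos x y" and x: "x \<in> mod_grade N n" and y: "y \<in> mod_grade N (n + 1)"
      by (auto elim: koszul_gradeE)
    show "Kos (h (kos_fst (b \<odot>\<^bsub>koszul A N a\<^esub> u))) (\<ominus> h (kos_snd (b \<odot>\<^bsub>koszul A N a\<^esub> u))) =
      b \<odot>\<^bsub>koszul A N a\<^esub> Kos (h (kos_fst u)) (\<ominus> h (kos_snd u))"
      using u h(4)[OF x b] h(4)[OF y b] hc[OF y]
      by (simp add: koszul_smult[OF b] smult_uminus[OF b] del: koszul_simps(4))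
  qed
qed

lemma dg_complex_koszul: "dg_complex (koszul A N a) A"
proof -
  have ab: "abelian_group N" by (rule abelian_group_axioms)
  interpret K: abelian_group "koszul A N a" by (rule koszul_abelian_group[OF ab])
  have mod: "module (dg_zero_part A) (koszul A N a)"
    by (rule moduleI[OF R.is_cring K.abelian_group_axioms]) (auto elim!: koszul_carrierE simp: koszul_smult smult_closed' R.a_closed[simplified]
      R.m_closed[simplified] R.one_closed[simplified]
      smult_l_distr[simplified] smult_r_distr[simplified] smult_assoc1[simplified]
      smult_one[simplified] simp del: koszul_simps(4))
  show ?thesis
  proof (rule dg_complex.intro[OF mod], rule dg_complex_axioms.intro)
    show "comm_dg_ring A" by (rule comm_dg_ring)
  next
    fix n
    show "additive_subgroup (mod_grade (koszul A N a) n) (koszul A N a)"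
    proof (rule additive_subgroupI, rule K.add.subgroupI)
      show "mod_grade (koszul A N a) n \<noteq> {}"
        using koszul_simps(5)[of "\<zero>" "\<zero>" A N a n] grade_zero by blast
    qed (auto elim!: koszul_gradeE simp: grade_carrier grade_add grade_uminus koszul_uminus[OF ab])
  next
    fix b x n assume "b \<in> dg_grade A 0" "x \<in> mod_grade (koszul A N a) n"
    then show "b \<odot>\<^bsub>koszul A N a\<^esub> x \<in> mod_grade (koszul A N a) n"
      by (auto elim!: koszul_gradeE simp: koszul_smult smult_grade simp del: koszul_simps(4))
  next
    fix x n assume "x \<in> mod_grade (koszul A N a) n"
    then obtain u v where x: "x = Kos u v" "u \<in> mod_grade N n" "v \<in> mod_grade N (n + 1)"
      by (rule koszul_gradeE)
    note uv = mod_diff_grade[OF x(2)] mod_diff_grade[OF x(3)] smult_grade[OF a x(3)]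
    show "mod_diff (koszul A N a) x \<in> mod_grade (koszul A N a) (n + 1)"
      using x uv by (simp add: grade_add grade_uminus)
    note c = mod_diff_carrier[OF x(2)] mod_diff_carrier[OF x(3)] smult_grade_carrier[OF a x(3)]
      smult_grade_carrier[OF a uv(2)]
    show "mod_diff (koszul A N a) (mod_diff (koszul A N a) x) = \<zero>\<^bsub>koszul A N a\<^esub>"
      using x uv c by (simp add: mod_diff_add[OF uv(1,3)] mod_diff_diff[OF x(2)] mod_diff_diff[OF x(3)]
          mod_diff_smult[OF a x(3)] mod_diff_uminus[OF uv(2)] smult_uminus[OF a] r_neg)
  next
    fix x y n assume "x \<in> mod_grade (koszul A N a) n" "y \<in> mod_grade (koszul A N a) n"
    then obtain u v u' v' where x: "x = Kos u v" "u \<in> mod_grade N n" "v \<in> mod_grade N (n + 1)"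
      and y: "y = Kos u' v'" "u' \<in> mod_grade N n" "v' \<in> mod_grade N (n + 1)"
      by (auto elim!: koszul_gradeE)
    note c = grade_carrier[OF x(2)] grade_carrier[OF x(3)] grade_carrier[OF y(2)] grade_carrier[OF y(3)]
      mod_diff_carrier[OF x(2)] mod_diff_carrier[OF x(3)] mod_diff_carrier[OF y(2)] mod_diff_carrier[OF y(3)]
      smult_grade_carrier[OF a x(3)] smult_grade_carrier[OF a y(3)]
    show "mod_diff (koszul A N a) (x \<oplus>\<^bsub>koszul A N a\<^esub> y) =
      mod_diff (koszul A N a) x \<oplus>\<^bsub>koszul A N a\<^esub> mod_diff (koszul A N a) y"
      using c smult_r_distr[of a v v'] a
      by (simp only: x(1) y(1) koszul_simps mod_diff_add[OF x(2) y(2)] mod_diff_add[OF x(3) y(3)])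
        (simp add: minus_add a_ac)
  next
    fix b x n assume b: "b \<in> dg_grade A 0" and "x \<in> mod_grade (koszul A N a) n"
    then obtain u v where x: "x = Kos u v" "u \<in> mod_grade N n" "v \<in> mod_grade N (n + 1)"
      by (auto elim!: koszul_gradeE)
    note c = grade_carrier[OF x(2)] grade_carrier[OF x(3)]
      mod_diff_carrier[OF x(2)] mod_diff_carrier[OF x(3)] smult_grade_carrier[OF a x(3)]
    show "mod_diff (koszul A N a) (b \<odot>\<^bsub>koszul A N a\<^esub> x) = b \<odot>\<^bsub>koszul A N a\<^esub> mod_diff (koszul A N a) x"
      using x c b smult_r_distr[of b "mod_diff N u" "a \<odot> v"]
      by (simp add: koszul_smult[OF b] mod_diff_smult[OF b x(2)] mod_diff_smult[OF b x(3)]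
          smult_uminus[OF b] smult_commute[OF a b c(2)] del: koszul_simps(4))
  next
    fix c assume c: "c \<in> coboundaries (dg_self A) 0"
    interpret A: comm_dg_ring A by (rule comm_dg_ring)
    have "c \<in> dg_grade A 0" using c A.diff_grade[of _ "-1"] by (auto simp: coboundaries_def)
    then show "\<exists>h. null_homotopy A (koszul A N a) c h"
      using coboundary_null[OF c] koszul_null_homotopy by blast
  qed
qed


section \<open>Koszul cohomology and its long exact sequence\<close>

lemma koszul_cocycleE:
  assumes "u \<in> cocycles (koszul A N a) n"
  obtains x y where "u = Kos x y" "x \<in> mod_grade N n" "y \<in> cocycles N (n + 1)"
    "mod_diff N x \<oplus> a \<odot> y = \<zero>"
proof -
  obtain x y where u: "u = Kos x y" "x \<in> mod_grade N n" "y \<in> mod_grade N (n + 1)"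
    using assms by (auto simp: cocycles_def elim: koszul_gradeE)
  have "\<ominus> mod_diff N y = \<zero>" and eq: "mod_diff N x \<oplus> a \<odot> y = \<zero>"
    using assms u(1) by (auto simp: cocycles_def)
  then have "mod_diff N y = \<zero>" using uminus_eq_zero[OF mod_diff_carrier[OF u(3)]] by blast
  then show ?thesis using that u eq cocycleI by blast
qed

lemma koszul_cocycleI:
  assumes "x \<in> mod_grade N n" "y \<in> cocycles N (n + 1)"
    "mod_diff N x \<oplus> a \<odot> y = \<zero>"
  shows "Kos x y \<in> cocycles (koszul A N a) n"
  using assms cocycleD[OF assms(2)] by (simp add: cocycles_def)

lemma koszul_coboundaryI:
  assumes "p \<in> mod_grade N (n - 1)" "q \<in> mod_grade N n"
  shows "Kos (mod_diff N p \<oplus> a \<odot> q) (\<ominus> mod_diff N q) \<in> coboundaries (koszul A N a) n"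
proof -
  have "Kos p q \<in> mod_grade (koszul A N a) (n - 1)" using assms by simp
  then have "mod_diff (koszul A N a) (Kos p q) \<in> coboundaries (koszul A N a) n"
    unfolding coboundaries_def by (rule imageI)
  then show ?thesis by simp
qed

lemma koszul_coboundaryE:
  assumes "u \<in> coboundaries (koszul A N a) n"
  obtains p q where "p \<in> mod_grade N (n - 1)" "q \<in> mod_grade N n"
    "u = Kos (mod_diff N p \<oplus> a \<odot> q) (\<ominus> mod_diff N q)"
proof -
  obtain v where v: "v \<in> mod_grade (koszul A N a) (n - 1)" "u = mod_diff (koszul A N a) v"
    using assms by (auto simp: coboundaries_def)
  obtain p q where "v = Kos p q" "p \<in> mod_grade N (n - 1)" "q \<in> mod_grade N (n - 1 + 1)"
    using v(1) by (rule koszul_gradeE)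
  then show ?thesis using that v(2) by simp
qed

lemma koszul_coboundary_fst:
  assumes "w \<in> coboundaries N n" shows "Kos w \<zero> \<in> coboundaries (koszul A N a) n"
proof -
  obtain p where p: "p \<in> mod_grade N (n - 1)" "w = mod_diff N p" using assms by (rule coboundaryE)
  then show ?thesis
    using koszul_coboundaryI[OF p(1) grade_zero] mod_diff_carrier[OF p(1)]
    by (simp add: mod_diff_zero smult_zero[OF a] uminus_zero)
qed

text \<open>Exactness of H^n(N) -> H^n(K) -> H^(n+1)(N) in the middle: if \<open>y\<close> is the
  differential of \<open>v\<close>, subtracting the coboundary of
  \<open>Kos \<zero> (\<ominus> v)\<close> moves everything into the first component.\<close>

lemma koszul_cocycle_reduce:
  assumes "Kos x y \<in> cocycles (koszul A N a) n" "y \<in> coboundaries N (n + 1)"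
  shows "\<exists>x'\<in>cocycles N n. \<exists>b\<in>coboundaries (koszul A N a) n.
    Kos x y = Kos x' \<zero> \<oplus>\<^bsub>koszul A N a\<^esub> b"
proof -
  have x: "x \<in> mod_grade N n" and eq: "mod_diff N x \<oplus> a \<odot> y = \<zero>"
    using assms(1) by (auto elim: koszul_cocycleE)
  obtain v where v: "v \<in> mod_grade N n" "y = mod_diff N v"
    using assms(2) by (auto elim: coboundaryE)
  have av: "a \<odot> v \<in> mod_grade N n" using smult_grade[OF a v(1)] .
  have "mod_diff N (x \<oplus> a \<odot> v) = \<zero>"
    using eq v(2) by (simp add: mod_diff_add[OF x av] mod_diff_smult[OF a v(1)])
  then have "x \<oplus> a \<odot> v \<in> cocycles N n" using grade_add[OF x av] cocycleI by blast
  moreover have "Kos (\<ominus> (a \<odot> v)) y \<in> coboundaries (koszul A N a) n"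
    using koszul_coboundaryI[OF grade_zero grade_uminus[OF v(1)]] grade_carrier[OF v(1)]
      mod_diff_carrier[OF v(1)] grade_carrier[OF av] v(2)
    by (simp add: mod_diff_zero mod_diff_uminus[OF v(1)] smult_uminus[OF a] minus_minus)
  moreover have "Kos x y = Kos (x \<oplus> a \<odot> v) \<zero> \<oplus>\<^bsub>koszul A N a\<^esub> Kos (\<ominus> (a \<odot> v)) y"
    using grade_carrier[OF x] grade_carrier[OF av] mod_diff_carrier[OF v(1)] v(2)
    by (simp add: a_assoc r_neg)
  ultimately show ?thesis by blast
qed

text \<open>H^n(K) is an extension of the kernel of \<open>a\<close> on H^(n+1)(N) by the cokernel
  of \<open>a\<close> on H^n(N), and both vanish here. The shift in degree comes from the generator
  of degree -1.\<close>

lemma koszul_exact: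
  assumes "exact_at N n"
    and "\<And>y. \<lbrakk>y \<in> cocycles N (n + 1); a \<odot> y \<in> coboundaries N (n + 1)\<rbrakk> \<Longrightarrow>
      y \<in> coboundaries N (n + 1)"
  shows "exact_at (koszul A N a) n"
  unfolding exact_at_def
proof
  fix u assume u: "u \<in> cocycles (koszul A N a) n"
  interpret K: dg_complex "koszul A N a" A by (rule dg_complex_koszul)
  obtain x y where xy: "u = Kos x y" "x \<in> mod_grade N n" "y \<in> cocycles N (n + 1)"
    "mod_diff N x \<oplus> a \<odot> y = \<zero>" using u by (rule koszul_cocycleE)
  have c: "mod_diff N x \<in> carrier N" "y \<in> carrier N" "a \<odot> y \<in> carrier N"
    using mod_diff_carrier[OF xy(2)] cocycleD(1)[OF xy(3)] grade_carrier smult_closed' a by blast+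
  have "a \<odot> y = mod_diff N (\<ominus> x)"
    using xy(4) c minus_equality[of "a \<odot> y" "mod_diff N x"]
    by (simp add: mod_diff_uminus[OF xy(2)] a_comm)
  then have "a \<odot> y \<in> coboundaries N (n + 1)"
    using coboundaryI[of "\<ominus> x" "n + 1"] grade_uminus[OF xy(2)] by simp
  then have "y \<in> coboundaries N (n + 1)" using assms(2) xy(3) by blast
  then obtain x' b where x': "x' \<in> cocycles N n" "b \<in> coboundaries (koszul A N a) n"
    "u = Kos x' \<zero> \<oplus>\<^bsub>koszul A N a\<^esub> b"
    using koszul_cocycle_reduce u xy(1) by blast
  then have "x' \<in> coboundaries N n" using assms(1) by (auto simp: exact_at_def)
  then show "u \<in> coboundaries (koszul A N a) n"
    using x' koszul_coboundary_fst K.linear_subsetD(3)[OF K.linear_coboundaries] by blast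
qed

text \<open>If \<open>a \<odot> z\<close> is the differential of \<open>w\<close>, then
  \<open>z\<close> is the second component of the Koszul cocycle \<open>Kos (\<ominus> w) z\<close>,
  and exactness exhibits it as a coboundary.\<close>

lemma koszul_exact_imp_regular:
  assumes "exact_at (koszul A N a) n" "z \<in> cocycles N (n + 1)"
    "a \<odot> z \<in> coboundaries N (n + 1)"
  shows "z \<in> coboundaries N (n + 1)"
proof -
  obtain w where w: "w \<in> mod_grade N n" "a \<odot> z = mod_diff N w"
    using assms(3) by (auto elim: coboundaryE)
  have "Kos (\<ominus> w) z \<in> cocycles (koszul A N a) n"
    using koszul_cocycleI[OF grade_uminus[OF w(1)] assms(2)] w(2) mod_diff_carrier[OF w(1)]
    by (simp add: mod_diff_uminus[OF w(1)] l_neg)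
  then have "Kos (\<ominus> w) z \<in> coboundaries (koszul A N a) n"
    using assms(1) by (auto simp: exact_at_def)
  then obtain q where "q \<in> mod_grade N n" "z = \<ominus> mod_diff N q"
    by (auto elim: koszul_coboundaryE)
  then show ?thesis
    using coboundaryI[of "\<ominus> q" "n + 1"] grade_uminus mod_diff_uminus by simp
qed

text \<open>Exactness makes \<open>a\<close> injective on the cohomology of degree
  \<open>n + 1\<close>, and a map that is both injective and locally nilpotent has zero
  source.\<close>

lemma koszul_exact_locally_nilpotent:
  assumes "exact_at (koszul A N a) n" "a \<in> locally_nilpotent A N"
  shows "exact_at N (n + 1)"
  unfolding exact_at_def
proof
  have *: "z \<in> coboundaries N (n + 1)" if "z \<in> cocycles N (n + 1)"
    "(a [^]\<^bsub>dg_zero_part A\<^esub> k) \<odot> z \<in> coboundaries N (n + 1)" for z and k :: nat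
    using that
  proof (induction k arbitrary: z)
    case 0
    then have "z \<in> carrier N" using cocycleD grade_carrier by blast
    then show ?case using 0 smult_one by simp
  next
    case (Suc k)
    have "z \<in> carrier N" using Suc.prems(1) cocycleD grade_carrier by blast
    then have "(a [^]\<^bsub>dg_zero_part A\<^esub> Suc k) \<odot> z = (a [^]\<^bsub>dg_zero_part A\<^esub> k) \<odot> (a \<odot> z)"
      using smult_smult[of "a [^]\<^bsub>dg_zero_part A\<^esub> k" a z] R.nat_pow_closed[of a k] a by simp
    then have "a \<odot> z \<in> coboundaries N (n + 1)"
      using Suc linear_subsetD(4)[OF linear_cocycles a] by simp
    then show ?case using koszul_exact_imp_regular[OF assms(1) Suc.prems(1)] by blast
  qed
  fix z assume "z \<in> cocycles N (n + 1)"
  then show "z \<in> coboundaries N (n + 1)" using * assms(2) unfolding locally_nilpotent_def by blast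
qed

text \<open>A submodule of Koszul cocycles is controlled by its projection to the second component,
  which consists of cocycles of degree \<open>n + 1\<close>, and by its intersection with the first
  summand in degree \<open>n\<close>. A strict inclusion shows in one of the two.\<close>

lemma koszul_noetherian_between:
  assumes "noetherian_between A N (coboundaries N n) (cocycles N n)"
    "noetherian_between A N (coboundaries N (n + 1)) (cocycles N (n + 1))"
  shows "noetherian_between A (koszul A N a)
    (coboundaries (koszul A N a) n) (cocycles (koszul A N a) n)"
proof -
  interpret K: dg_complex "koszul A N a" A by (rule dg_complex_koszul)
  let ?K = "koszul A N a"
  let ?f = "\<lambda>W. {y. \<exists>x. Kos x y \<in> W}" and ?g = "\<lambda>W. {x. Kos x \<zero> \<in> W}"
  have f: "linear_subset A N (?f W)" "coboundaries N (n + 1) \<subseteq> ?f W" "?f W \<subseteq> cocycles N (n + 1)"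
    and g: "linear_subset A N (?g W)" "coboundaries N n \<subseteq> ?g W" "?g W \<subseteq> cocycles N n"
    if W: "linear_subset A ?K W" "coboundaries ?K n \<subseteq> W" "W \<subseteq> cocycles ?K n" for W
  proof -
    note lin = K.linear_subsetD[OF W(1)]
    have "?f W \<subseteq> carrier N" "?g W \<subseteq> carrier N" using lin(1) by fastforce+
    moreover have "Kos (x \<oplus> x') (y \<oplus> y') \<in> W" if "Kos x y \<in> W" "Kos x' y' \<in> W" for x y x' y'
      using lin(3)[OF that] by simp
    moreover have "Kos (b \<odot> x) (b \<odot> y) \<in> W" if "b \<in> dg_grade A 0" "Kos x y \<in> W" for b x y
      using lin(4)[OF that] koszul_smult[OF that(1)] by simp
    moreover have "Kos \<zero> \<zero> \<in> W" using lin(2) by simp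
    moreover have "\<zero> \<oplus> \<zero> = \<zero>" by simp
    ultimately show "linear_subset A N (?f W)" "linear_subset A N (?g W)"
      unfolding linear_subset_def using smult_zero by (blast, metis (mono_tags, lifting) mem_Collect_eq)
    show "coboundaries N (n + 1) \<subseteq> ?f W"
    proof
      fix y assume "y \<in> coboundaries N (n + 1)"
      then obtain v where v: "v \<in> mod_grade N n" "y = mod_diff N v" by (auto elim: coboundaryE)
      then have "Kos (mod_diff N \<zero> \<oplus> a \<odot> (\<ominus> v)) y \<in> W"
        using koszul_coboundaryI[OF grade_zero grade_uminus[OF v(1)]] W(2) mod_diff_carrier[OF v(1)]
        by (auto simp: mod_diff_uminus[OF v(1)])
      then show "y \<in> ?f W" by blast
    qed
    show "?f W \<subseteq> cocycles N (n + 1)" using W(3) by (blast elim: koszul_cocycleE)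
    show "coboundaries N n \<subseteq> ?g W" using koszul_coboundary_fst W(2) by blast
    show "?g W \<subseteq> cocycles N n"
    proof
      fix x assume "x \<in> ?g W"
      then have "Kos x \<zero> \<in> cocycles ?K n" using W(3) by blast
      then have "x \<in> mod_grade N n" "mod_diff N x \<oplus> a \<odot> \<zero> = \<zero>"
        by (auto elim: koszul_cocycleE)
      then show "x \<in> cocycles N n" using mod_diff_carrier by (simp add: smult_zero[OF a] cocycleI)
    qed
  qed
  show ?thesis
    unfolding noetherian_between_def
  proof (rule wf_by_pair[OF assms(2,1)[unfolded noetherian_between_def],
        where f = ?f and g = ?g])
    fix Y X assume "(Y, X) \<in> {(Y, X). linear_subset A ?K X \<and> linear_subset A ?K Y \<and>
      coboundaries ?K n \<subseteq> X \<and> X \<subset> Y \<and> Y \<subseteq> cocycles ?K n}"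
    then have X: "linear_subset A ?K X" "coboundaries ?K n \<subseteq> X" "X \<subseteq> cocycles ?K n"
      and Y: "linear_subset A ?K Y" "coboundaries ?K n \<subseteq> Y" "Y \<subseteq> cocycles ?K n"
      and XY: "X \<subset> Y" by auto
    have sub: "?f X \<subseteq> ?f Y" "?g X \<subseteq> ?g Y" using XY by auto
    have "?g X \<noteq> ?g Y" if eq: "?f X = ?f Y"
    proof -
      obtain u where u: "u \<in> Y" "u \<notin> X" using XY by blast
      then obtain x y where xy: "u = Kos x y" "x \<in> carrier N" "y \<in> carrier N"
        using K.linear_subsetD(1)[OF Y(1) u(1)] by (auto elim: koszul_carrierE)
      then have "y \<in> ?f X" using eq u(1) by blast
      then obtain x1 where x1: "Kos x1 y \<in> X" by blast
      then have x1c: "x1 \<in> carrier N" using K.linear_subsetD(1)[OF X(1)] by fastforce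
      \<comment> \<open>Equal projections provide an element of \<open>X\<close> with the same
        second component, so the new element differs from it by something in the first
        summand.\<close>
      have diff: "u = Kos x1 y \<oplus>\<^bsub>?K\<^esub> Kos (x \<ominus> x1) \<zero>"
        using xy x1c by (simp add: minus_eq a_lcomm[of x1 x] r_neg)
      have "Kos (x \<ominus> x1) \<zero> \<in> Y"
        using K.linear_subset_cancel[OF Y(1), of "Kos x1 y"] x1 XY diff u(1) xy x1c by auto
      moreover have "Kos (x \<ominus> x1) \<zero> \<notin> X"
        using K.linear_subsetD(3)[OF X(1) x1] diff u(2) by metis
      ultimately show ?thesis by blast
    qed
    then show "(?f Y, ?f X) \<in> {(Y, X). linear_subset A N X \<and> linear_subset A N Y \<and>
        coboundaries N (n + 1) \<subseteq> X \<and> X \<subset> Y \<and> Y \<subseteq> cocycles N (n + 1)} \<or>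
      ?f Y = ?f X \<and> (?g Y, ?g X) \<in> {(Y, X). linear_subset A N X \<and> linear_subset A N Y \<and>
        coboundaries N n \<subseteq> X \<and> X \<subset> Y \<and> Y \<subseteq> cocycles N n}"
      using f[OF X] f[OF Y] g[OF X] g[OF Y] sub by blast
  qed
qed

text \<open>Nakayama's lemma for the cohomology of \<open>N\<close>, whose cokernel under \<open>a\<close> embeds into that of
  the Koszul complex.\<close>

lemma koszul_exact_imp_exact:
  assumes noeth: "noetherian_between A N (coboundaries N n) (cocycles N n)"
    and rad: "radical_element A a" and ex: "exact_at (koszul A N a) n"
  shows "exact_at N n"
proof (rule ccontr)
  assume "\<not> exact_at N n"
  then have neg: "coboundaries N n \<subset> cocycles N n"
    using coboundary_cocycle by (auto simp: exact_at_def)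
  let ?F = "{V. linear_subset A N V \<and> coboundaries N n \<subseteq> V \<and> V \<subset> cocycles N n}"
  have "coboundaries N n \<in> ?F" using neg linear_coboundaries by blast
  then obtain V where "V \<in> ?F" and max: "\<forall>Y\<in>?F. (Y, V) \<notin> {(Y, X). linear_subset A N X \<and>
      linear_subset A N Y \<and> coboundaries N n \<subseteq> X \<and> X \<subset> Y \<and> Y \<subseteq> cocycles N n}"
    using wf_max_elt[OF noeth[unfolded noetherian_between_def]] by meson
  then have V: "linear_subset A N V" "coboundaries N n \<subseteq> V" "V \<subset> cocycles N n" by auto
  obtain g where g: "g \<in> cocycles N n" "g \<notin> V" using V(3) by blast
  have gg: "g \<in> mod_grade N n" and gc: "g \<in> carrier N" using g(1) cocycleD grade_carrier by blast+
  let ?W = "linear_adjoin A N V g"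
  note W = linear_adjoin[OF V(1) gc]
  have WZ: "?W \<subseteq> cocycles N n"
    using V(3) g(1) linear_subsetD(3,4)[OF linear_cocycles] by (auto simp: linear_adjoin_def)
  \<comment> \<open>By maximality of \<open>V\<close> the single cocycle \<open>g\<close> generates
    the rest.\<close>
  have W_eq: "?W = cocycles N n"
  proof (rule ccontr)
    assume "?W \<noteq> cocycles N n"
    then have "?W \<in> ?F" using W WZ V(2) by blast
    then show False using max V W WZ g(2) by blast
  qed
  \<comment> \<open>Placed in the first component, \<open>g\<close> is a Koszul cocycle, so
    exactness writes it as \<open>a \<odot> q\<close> up to a coboundary, with \<open>q\<close>
    again a cocycle. Expressing \<open>q\<close> through \<open>g\<close> and \<open>V\<close> then
    puts \<open>1 - r a\<close> times \<open>g\<close> into \<open>V\<close>.\<close>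
  have "Kos g \<zero> \<in> cocycles (koszul A N a) n"
    using koszul_cocycleI[OF gg linear_subsetD(2)[OF linear_cocycles]] cocycleD(2)[OF g(1)]
    by (simp add: smult_zero[OF a])
  then have "Kos g \<zero> \<in> coboundaries (koszul A N a) n" using ex by (auto simp: exact_at_def)
  then obtain p q where p: "p \<in> mod_grade N (n - 1)" and q: "q \<in> mod_grade N n"
    and eq: "g = mod_diff N p \<oplus> a \<odot> q" "\<zero> = \<ominus> mod_diff N q"
    by (auto elim: koszul_coboundaryE)
  have "mod_diff N q = \<zero>" using uminus_eq_zero[OF mod_diff_carrier[OF q]] eq(2) by simp
  then have "q \<in> ?W" using q W_eq cocycleI by blast
  then obtain v r where v: "v \<in> V" and r: "r \<in> dg_grade A 0" and qv: "q = v \<oplus> r \<odot> g"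
    by (auto simp: linear_adjoin_def)
  have vc: "v \<in> carrier N" using linear_subsetD(1)[OF V(1) v] .
  have ra: "r \<otimes>\<^bsub>A\<^esub> a \<in> dg_grade A 0" using R.m_closed[of r a] r a by simp
  have dp: "mod_diff N p \<in> V" "mod_diff N p \<in> carrier N"
    using coboundaryI[OF p] V(2) mod_diff_carrier[OF p] by auto
  let ?t = "\<one>\<^bsub>A\<^esub> \<ominus>\<^bsub>dg_zero_part A\<^esub> (r \<otimes>\<^bsub>A\<^esub> a)"
  have one: "\<one>\<^bsub>A\<^esub> \<in> dg_grade A 0" using R.one_closed by simp
  have t: "?t \<in> dg_grade A 0" using R.minus_closed[of "\<one>\<^bsub>A\<^esub>" "r \<otimes>\<^bsub>A\<^esub> a"] one ra by simp
  have "?t \<odot> g = g \<oplus> \<ominus> ((r \<otimes>\<^bsub>A\<^esub> a) \<odot> g)"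
    using smult_l_distr[of "\<one>\<^bsub>A\<^esub>" "\<ominus>\<^bsub>dg_zero_part A\<^esub> (r \<otimes>\<^bsub>A\<^esub> a)" g] one ra gc
      R.a_inv_closed[of "r \<otimes>\<^bsub>A\<^esub> a"] smult_l_minus[of "r \<otimes>\<^bsub>A\<^esub> a" g] smult_one[of g]
    by (simp add: R.minus_eq)
  also have "\<dots> = mod_diff N p \<oplus> a \<odot> v"
  proof -
    let ?X = "(r \<otimes>\<^bsub>A\<^esub> a) \<odot> g"
    have "a \<odot> (r \<odot> g) = ?X"
      using smult_commute[OF a r gc] smult_smult[OF r a gc] by simp
    then have "a \<odot> q = a \<odot> v \<oplus> ?X"
      using qv smult_r_distr[of a v "r \<odot> g"] a vc smult_closed'[OF r gc] by simp
    then have "g = mod_diff N p \<oplus> (a \<odot> v \<oplus> ?X)" using eq(1) by (rule subst)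
    then have "g \<oplus> \<ominus> ?X = (mod_diff N p \<oplus> (a \<odot> v \<oplus> ?X)) \<oplus> \<ominus> ?X"
      by (rule arg_cong)
    also have "\<dots> = mod_diff N p \<oplus> a \<odot> v"
      using dp smult_closed'[OF a vc] smult_closed'[OF ra gc] by (simp add: a_assoc r_neg)
    finally show ?thesis .
  qed
  also have "\<dots> \<in> V" using linear_subsetD(3,4)[OF V(1)] dp a v by blast
  finally have tg: "?t \<odot> g \<in> V" .
  \<comment> \<open>The coefficient is invertible only up to a coboundary \<open>e\<close> of
    \<open>A\<close>; but \<open>e \<odot> g\<close> is a coboundary and hence lies in
    \<open>V\<close>.\<close>
  obtain u e where u: "u \<in> dg_grade A 0" and e: "e \<in> coboundaries (dg_self A) 0"
    and ut: "u \<otimes>\<^bsub>A\<^esub> ?t = \<one>\<^bsub>A\<^esub> \<oplus>\<^bsub>A\<^esub> e" using rad r unfolding radical_element_def by blast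
  have ec: "e \<in> dg_grade A 0"
    using e comm_dg_ring.diff_grade[OF comm_dg_ring, of _ "-1"] by (auto simp: coboundaries_def)
  have eg: "e \<odot> g \<in> V" using coboundary_smult[OF e g(1)] V(2) by blast
  have "u \<odot> (?t \<odot> g) = g \<oplus> e \<odot> g"
    using smult_smult[OF u t gc] ut smult_l_distr[of "\<one>\<^bsub>A\<^esub>" e g] one ec gc smult_one[of g] by simp
  then have "e \<odot> g \<oplus> g \<in> V"
    using linear_subsetD(4)[OF V(1) u tg] gc smult_closed'[OF ec gc] by (simp add: a_comm)
  then show False using linear_subset_cancel[OF V(1) eg gc] g(2) by blast
qed

text \<open>Local nilpotence passes through the long exact sequence: one power kills the second
  component, a further one what is left in the first, and the exponents add up. The element
  \<open>a\<close> itself acts as zero on the cohomology of its own Koszul complex.\<close>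

lemma koszul_locally_nilpotent:
  shows "locally_nilpotent A N \<subseteq> locally_nilpotent A (koszul A N a)"
    and "a \<in> locally_nilpotent A (koszul A N a)"
proof -
  interpret K: dg_complex "koszul A N a" A by (rule dg_complex_koszul)
  let ?K = "koszul A N a" and ?R = "dg_zero_part A"
  show "locally_nilpotent A N \<subseteq> locally_nilpotent A ?K"
  proof
    fix c assume c: "c \<in> locally_nilpotent A N"
    then have c0: "c \<in> dg_grade A 0" by (simp add: locally_nilpotent_def)
    have cp: "c [^]\<^bsub>?R\<^esub> k \<in> dg_grade A 0" for k :: nat using R.nat_pow_closed[of c k] c0 by simp
    have "\<exists>k::nat. (c [^]\<^bsub>?R\<^esub> k) \<odot>\<^bsub>?K\<^esub> u \<in> coboundaries ?K n" if u: "u \<in> cocycles ?K n" for n u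
    proof -
      obtain x y where xy: "u = Kos x y" "y \<in> cocycles N (n + 1)" using u by (rule koszul_cocycleE)
      obtain k :: nat where k: "(c [^]\<^bsub>?R\<^esub> k) \<odot> y \<in> coboundaries N (n + 1)"
        using c xy(2) unfolding locally_nilpotent_def by blast
      have eq: "(c [^]\<^bsub>?R\<^esub> k) \<odot>\<^bsub>?K\<^esub> u = Kos ((c [^]\<^bsub>?R\<^esub> k) \<odot> x) ((c [^]\<^bsub>?R\<^esub> k) \<odot> y)"
        using xy(1) koszul_smult[OF cp] by simp
      have "(c [^]\<^bsub>?R\<^esub> k) \<odot>\<^bsub>?K\<^esub> u \<in> cocycles ?K n"
        using K.linear_subsetD(4)[OF K.linear_cocycles cp u] .
      then obtain x' b where x': "x' \<in> cocycles N n" and b: "b \<in> coboundaries ?K n"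
        and x'b: "(c [^]\<^bsub>?R\<^esub> k) \<odot>\<^bsub>?K\<^esub> u = Kos x' \<zero> \<oplus>\<^bsub>?K\<^esub> b"
        using koszul_cocycle_reduce[of _ _ n] k unfolding eq by blast
      obtain l :: nat where l: "(c [^]\<^bsub>?R\<^esub> l) \<odot> x' \<in> coboundaries N n"
        using c x' unfolding locally_nilpotent_def by blast
      have uc: "u \<in> carrier ?K" using u K.cocycleD K.grade_carrier by blast
      have bc: "b \<in> carrier ?K" using b K.linear_subsetD(1)[OF K.linear_coboundaries] by blast
      have x'c: "Kos x' \<zero> \<in> carrier ?K"
        using grade_carrier[OF cocycleD(1)[OF x']] by simp
      have "(c [^]\<^bsub>?R\<^esub> (l + k)) \<odot>\<^bsub>?K\<^esub> u = (c [^]\<^bsub>?R\<^esub> l) \<odot>\<^bsub>?K\<^esub> ((c [^]\<^bsub>?R\<^esub> k) \<odot>\<^bsub>?K\<^esub> u)"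
        using R.nat_pow_mult[of c l k] c0 K.smult_smult[OF cp cp uc] by simp
      also have "\<dots> = (c [^]\<^bsub>?R\<^esub> l) \<odot>\<^bsub>?K\<^esub> Kos x' \<zero> \<oplus>\<^bsub>?K\<^esub> (c [^]\<^bsub>?R\<^esub> l) \<odot>\<^bsub>?K\<^esub> b"
        unfolding x'b using K.smult_r_distr[OF _ x'c bc, of "c [^]\<^bsub>?R\<^esub> l"] cp by simp
      also have "(c [^]\<^bsub>?R\<^esub> l) \<odot>\<^bsub>?K\<^esub> Kos x' \<zero> = Kos ((c [^]\<^bsub>?R\<^esub> l) \<odot> x') \<zero>"
        using koszul_smult[OF cp] smult_zero[OF cp] by simp
      also have "\<dots> \<oplus>\<^bsub>?K\<^esub> (c [^]\<^bsub>?R\<^esub> l) \<odot>\<^bsub>?K\<^esub> b \<in> coboundaries ?K n"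
        using koszul_coboundary_fst[OF l] K.linear_subsetD(4)[OF K.linear_coboundaries cp b]
          K.linear_subsetD(3)[OF K.linear_coboundaries] by blast
      finally show ?thesis by blast
    qed
    then show "c \<in> locally_nilpotent A ?K" using c0 by (simp add: locally_nilpotent_def)
  qed
  have "(a [^]\<^bsub>?R\<^esub> (1::nat)) \<odot>\<^bsub>?K\<^esub> u \<in> coboundaries ?K n" if "u \<in> cocycles ?K n" for n u
  proof -
    obtain x y where xy: "u = Kos x y" "x \<in> mod_grade N n" "y \<in> cocycles N (n + 1)"
      "mod_diff N x \<oplus> a \<odot> y = \<zero>" using \<open>u \<in> cocycles ?K n\<close> by (rule koszul_cocycleE)
    have c: "mod_diff N x \<in> carrier N" "a \<odot> y \<in> carrier N"
      using mod_diff_carrier[OF xy(2)] cocycleD(1)[OF xy(3)] smult_grade_carrier[OF a] by blast+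
    \<comment> \<open>By this form of the cocycle condition, \<open>a\<close> times \<open>u\<close>
      is the differential of \<open>Kos \<zero> x\<close>.\<close>
    have "\<ominus> mod_diff N x = a \<odot> y"
      using minus_equality[of "a \<odot> y" "mod_diff N x"] xy(4) c by (simp add: a_comm)
    moreover have "a [^]\<^bsub>?R\<^esub> (1::nat) = a" using R.nat_pow_eone[of a] a by simp
    ultimately show ?thesis
      using koszul_coboundaryI[OF grade_zero xy(2)] koszul_smult[OF a] xy(1)
        smult_grade_carrier[OF a xy(2)] by (simp add: mod_diff_zero)
  qed
  then show "a \<in> locally_nilpotent A ?K" using a unfolding locally_nilpotent_def by blast
qed

end

section \<open>Regular sequences and iterated Koszul complexes\<close>

primrec koszul_iter ::
    "'a dg_ring \<Rightarrow> ('a, 'm kos) dg_module \<Rightarrow> 'a list \<Rightarrow> ('a, 'm kos) dg_module" where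
  "koszul_iter A N [] = N"
| "koszul_iter A N (a # as) = koszul_iter A (koszul A N a) as"

definition noetherian_complex :: "'a dg_ring \<Rightarrow> ('a, 'm) dg_module \<Rightarrow> bool" where
  "noetherian_complex A N \<longleftrightarrow> dg_complex N A \<and>
     (\<forall>n. noetherian_between A N (coboundaries N n) (cocycles N n))"

definition exact_below :: "('a, 'm) dg_module \<Rightarrow> int \<Rightarrow> bool" where
  "exact_below N i \<longleftrightarrow> (\<forall>n<i. exact_at N n)"

text \<open>The regularity condition with the degree \<open>i\<close> kept fixed; for noetherian complexes over
  local rings the infimum of the cohomology does not change along a regular sequence.\<close>

primrec regular_in_degree ::
    "'a dg_ring \<Rightarrow> ('a, 'm kos) dg_module \<Rightarrow> int \<Rightarrow> 'a list \<Rightarrow> bool" where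
  "regular_in_degree A N i [] \<longleftrightarrow> True"
| "regular_in_degree A N i (a # as) \<longleftrightarrow>
     (\<forall>z\<in>cocycles N i. a \<odot>\<^bsub>N\<^esub> z \<in> coboundaries N i \<longrightarrow> z \<in> coboundaries N i) \<and>
     regular_in_degree A (koszul A N a) i as"

section \<open>The infimum of the cohomology along a sequence\<close>

lemma dg_complex_koszul_iter:
  "\<lbrakk>dg_complex N A; set as \<subseteq> dg_grade A 0\<rbrakk> \<Longrightarrow> dg_complex (koszul_iter A N as) A"
  by (induction as arbitrary: N) (auto simp: dg_complex_koszul)

lemma noetherian_complex_koszul:
  "\<lbrakk>noetherian_complex A N; a \<in> dg_grade A 0\<rbrakk> \<Longrightarrow> noetherian_complex A (koszul A N a)"
  by (simp add: noetherian_complex_def dg_complex_koszul koszul_noetherian_between)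

text \<open>Nakayama's lemma at each step. Read contrapositively, nonzero cohomology in degree
  \<open>n\<close> survives in all Koszul complexes on radical elements.\<close>

lemma exact_at_koszul_iter:
  assumes "noetherian_complex A N" "\<forall>a\<in>set as. radical_element A a"
    "exact_at (koszul_iter A N as) n"
  shows "exact_at N n"
  using assms
proof (induction as arbitrary: N)
  case (Cons a as)
  then have a: "a \<in> dg_grade A 0" "radical_element A a" by (auto simp: radical_element_def)
  then have "exact_at (koszul A N a) n"
    using Cons noetherian_complex_koszul[OF Cons.prems(1)] by simp
  then show ?case
    using koszul_exact_imp_exact[OF _ a(1) _ a(2)] Cons.prems(1) by (auto simp: noetherian_complex_def)
qed simp

text \<open>Degree \<open>n\<close> of the Koszul complex involves only the degrees \<open>n\<close>
  and \<open>n + 1\<close> of the cohomology of \<open>N\<close>, so a single degree is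
  lost.\<close>

lemma exact_below_koszul:
  assumes "dg_complex N A" "a \<in> dg_grade A 0" "exact_below N i"
  shows "exact_below (koszul A N a) (i - 1)"
  unfolding exact_below_def
proof (intro allI impI)
  fix n assume "n < i - 1"
  then have "exact_at N n" "exact_at N (n + 1)" using assms(3) by (auto simp: exact_below_def)
  then show "exact_at (koszul A N a) n"
    by (intro koszul_exact[OF assms(1,2)]) (auto simp: exact_at_def)
qed

lemma exact_below_koszul_iter:
  assumes "dg_complex N A" "set as \<subseteq> dg_grade A 0" "exact_below N i"
  shows "exact_below (koszul_iter A N as) (i - int (length as))"
  using assms
proof (induction as arbitrary: N i)
  case (Cons a as)
  then have "exact_below (koszul_iter A (koszul A N a) as) (i - 1 - int (length as))"
    by (intro Cons.IH) (auto intro: dg_complex_koszul exact_below_koszul)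
  moreover have "i - 1 - int (length as) = i - int (length (a # as))" by simp
  ultimately show ?case by (metis koszul_iter.simps(2))
qed simp

lemma locally_nilpotent_koszul_iter:
  assumes "dg_complex N A" "set as \<subseteq> dg_grade A 0"
  shows "locally_nilpotent A N \<union> set as \<subseteq> locally_nilpotent A (koszul_iter A N as)"
  using assms
proof (induction as arbitrary: N)
  case (Cons a as)
  then have a: "a \<in> dg_grade A 0" by simp
  have "locally_nilpotent A (koszul A N a) \<union> set as \<subseteq>
    locally_nilpotent A (koszul_iter A (koszul A N a) as)"
    using Cons.prems by (intro Cons.IH) (auto intro: dg_complex_koszul)
  then show ?case using koszul_locally_nilpotent[OF Cons.prems(1) a] by auto
qed simp

text \<open>Each locally nilpotent element shifts the bound by a full degree, and the remaining
  elements stay locally nilpotent on the next Koszul complex.\<close>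

lemma exact_below_koszul_iter_locally_nilpotent:
  assumes "dg_complex N A" "set as \<subseteq> locally_nilpotent A N" "exact_below (koszul_iter A N as) i"
  shows "exact_below N (i + int (length as))"
  using assms
proof (induction as arbitrary: N)
  case (Cons a as)
  then have a: "a \<in> dg_grade A 0" "a \<in> locally_nilpotent A N" by (auto simp: locally_nilpotent_def)
  have "exact_below (koszul A N a) (i + int (length as))"
    using Cons.prems koszul_locally_nilpotent(1)[OF Cons.prems(1) a(1)]
    by (intro Cons.IH) (auto intro: dg_complex_koszul[OF _ a(1)])
  then have "exact_at (koszul A N a) (n - 1)" if "n < i + int (length (a # as))" for n
    using that by (simp add: exact_below_def)
  then have "exact_at N (n - 1 + 1)" if "n < i + int (length (a # as))" for n
    using that koszul_exact_locally_nilpotent[OF Cons.prems(1) a(1) _ a(2)] by blast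
  then show ?case unfolding exact_below_def by simp
qed simp

text \<open>Exactness in degree \<open>n\<close> requires injectivity in degree
  \<open>n + 1\<close>. For \<open>n + 1 < i\<close> this is trivial, and for
  \<open>n + 1 = i\<close> it is the regularity condition.\<close>

lemma exact_below_regular_sequence:
  assumes "dg_complex N A" "set as \<subseteq> dg_grade A 0" "exact_below N i" "regular_in_degree A N i as"
  shows "exact_below (koszul_iter A N as) i"
  using assms
proof (induction as arbitrary: N)
  case (Cons a as)
  then have a: "a \<in> dg_grade A 0" by simp
  have "exact_at (koszul A N a) n" if "n < i" for n
  proof (rule koszul_exact[OF Cons.prems(1) a])
    show "exact_at N n" using that Cons.prems(3) by (auto simp: exact_below_def)
    show "y \<in> coboundaries N (n + 1)"
      if y: "y \<in> cocycles N (n + 1)" "a \<odot>\<^bsub>N\<^esub> y \<in> coboundaries N (n + 1)" for y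
    proof (cases "n + 1 = i")
      case True
      then show ?thesis using y Cons.prems(4) by simp
    next
      case False
      then have "exact_at N (n + 1)" using \<open>n < i\<close> Cons.prems(3) by (auto simp: exact_below_def)
      then show ?thesis using y by (auto simp: exact_at_def)
    qed
  qed
  then have "exact_below (koszul A N a) i" by (simp add: exact_below_def)
  then show ?case using Cons dg_complex_koszul[OF Cons.prems(1) a] by simp
qed simp

text \<open>Nakayama's lemma carries exactness in degree \<open>i - 1\<close> from the whole iterate
  back to the Koszul complex on the first element, where it means that this element is injective in
  degree \<open>i\<close>.\<close>

lemma regular_sequence_if_exact_below:
  assumes "noetherian_complex A N" "\<forall>a\<in>set as. radical_element A a"
    "exact_below (koszul_iter A N as) i"
  shows "regular_in_degree A N i as"
  using assms
proof (induction as arbitrary: N)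
  case (Cons a as)
  then have a: "a \<in> dg_grade A 0" by (simp add: radical_element_def)
  have K: "noetherian_complex A (koszul A N a)" using noetherian_complex_koszul[OF Cons.prems(1) a] .
  have "exact_at (koszul_iter A (koszul A N a) as) (i - 1)"
    using Cons.prems(3) by (simp add: exact_below_def)
  then have "exact_at (koszul A N a) (i - 1)"
    using exact_at_koszul_iter[OF K _ \<open>exact_at (koszul_iter A (koszul A N a) as) (i - 1)\<close>] Cons.prems(2)
    by simp
  moreover have "dg_complex N A" using Cons.prems(1) by (simp add: noetherian_complex_def)
  ultimately have "\<forall>z\<in>cocycles N i. a \<odot>\<^bsub>N\<^esub> z \<in> coboundaries N i \<longrightarrow> z \<in> coboundaries N i"
    using koszul_exact_imp_regular[of N A a "i - 1"] a by simp
  then show ?case using Cons K by simp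
qed simp

section \<open>Independence of the order of the elements\<close>

definition complex_iso ::
    "'a dg_ring \<Rightarrow> ('a, 'm) dg_module \<Rightarrow> ('a, 'm) dg_module \<Rightarrow> ('m \<Rightarrow> 'm) \<Rightarrow> ('m \<Rightarrow> 'm) \<Rightarrow> bool" where
  "complex_iso A N N' f g \<longleftrightarrow> (\<forall>n.
     (\<forall>x\<in>mod_grade N n. f x \<in> mod_grade N' n \<and> g (f x) = x \<and>
        f (mod_diff N x) = mod_diff N' (f x) \<and>
        (\<forall>y\<in>mod_grade N n. f (x \<oplus>\<^bsub>N\<^esub> y) = f x \<oplus>\<^bsub>N'\<^esub> f y) \<and>
        (\<forall>a\<in>dg_grade A 0. f (a \<odot>\<^bsub>N\<^esub> x) = a \<odot>\<^bsub>N'\<^esub> f x)) \<and>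
     (\<forall>y\<in>mod_grade N' n. g y \<in> mod_grade N n \<and> f (g y) = y))"

definition isomorphic_complexes ::
    "'a dg_ring \<Rightarrow> ('a, 'm) dg_module \<Rightarrow> ('a, 'm) dg_module \<Rightarrow> bool" where
  "isomorphic_complexes A N N' \<longleftrightarrow> (\<exists>f g. complex_iso A N N' f g)"

lemma complex_isoD:
  assumes "complex_iso A N N' f g"
  shows "x \<in> mod_grade N n \<Longrightarrow> f x \<in> mod_grade N' n"
    "x \<in> mod_grade N n \<Longrightarrow> g (f x) = x"
    "x \<in> mod_grade N n \<Longrightarrow> f (mod_diff N x) = mod_diff N' (f x)"
    "\<lbrakk>x \<in> mod_grade N n; y \<in> mod_grade N n\<rbrakk> \<Longrightarrow> f (x \<oplus>\<^bsub>N\<^esub> y) = f x \<oplus>\<^bsub>N'\<^esub> f y"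
    "\<lbrakk>x \<in> mod_grade N n; a \<in> dg_grade A 0\<rbrakk> \<Longrightarrow> f (a \<odot>\<^bsub>N\<^esub> x) = a \<odot>\<^bsub>N'\<^esub> f x"
    "y \<in> mod_grade N' n \<Longrightarrow> g y \<in> mod_grade N n"
    "y \<in> mod_grade N' n \<Longrightarrow> f (g y) = y"
  using assms unfolding complex_iso_def by blast+

lemma complex_iso_zero:
  assumes "complex_iso A N N' f g" "dg_complex N A" "dg_complex N' A"
  shows "f \<zero>\<^bsub>N\<^esub> = \<zero>\<^bsub>N'\<^esub>"
proof -
  interpret N: dg_complex N A by fact
  interpret N': dg_complex N' A by fact
  have "f \<zero>\<^bsub>N\<^esub> \<oplus>\<^bsub>N'\<^esub> f \<zero>\<^bsub>N\<^esub> = f \<zero>\<^bsub>N\<^esub>"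
    using complex_isoD(4)[OF assms(1) N.grade_zero N.grade_zero] by simp
  moreover have "f \<zero>\<^bsub>N\<^esub> \<in> carrier N'"
    using N'.grade_carrier complex_isoD(1)[OF assms(1) N.grade_zero] by blast
  ultimately show ?thesis by (metis N'.add.r_cancel_one N'.zero_closed)
qed

lemma complex_iso_uminus:
  assumes "complex_iso A N N' f g" "dg_complex N A" "dg_complex N' A" "x \<in> mod_grade N n"
  shows "f (\<ominus>\<^bsub>N\<^esub> x) = \<ominus>\<^bsub>N'\<^esub> f x"
proof -
  interpret N: dg_complex N A by fact
  interpret N': dg_complex N' A by fact
  have "f (\<ominus>\<^bsub>N\<^esub> x) \<oplus>\<^bsub>N'\<^esub> f x = \<zero>\<^bsub>N'\<^esub>"
    using complex_isoD(4)[OF assms(1) N.grade_uminus[OF assms(4)] assms(4)]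
      N.grade_carrier[OF assms(4)] complex_iso_zero[OF assms(1-3)] by (simp add: N.l_neg)
  then show ?thesis
    using N'.minus_equality N'.grade_carrier complex_isoD(1)[OF assms(1)] assms(4)
      N.grade_uminus[OF assms(4)] by metis
qed

lemma exact_at_iso:
  assumes "isomorphic_complexes A N N'" "dg_complex N A" "dg_complex N' A" "exact_at N n"
  shows "exact_at N' n"
  unfolding exact_at_def
proof
  interpret N: dg_complex N A by fact
  interpret N': dg_complex N' A by fact
  obtain f g where fg: "complex_iso A N N' f g" using assms by (auto simp: isomorphic_complexes_def)
  note iso = complex_isoD[OF fg]
  fix z assume "z \<in> cocycles N' n"
  then have z: "z \<in> mod_grade N' n" "mod_diff N' z = \<zero>\<^bsub>N'\<^esub>" using N'.cocycleD by auto
  have "f (mod_diff N (g z)) = f \<zero>\<^bsub>N\<^esub>"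
    using iso(3)[OF iso(6)[OF z(1)]] iso(7)[OF z(1)] z(2) complex_iso_zero[OF fg assms(2,3)] by simp
  then have "mod_diff N (g z) = \<zero>\<^bsub>N\<^esub>"
    using iso(2)[OF N.mod_diff_grade[OF iso(6)[OF z(1)]]] iso(2)[OF N.grade_zero] by metis
  then have "g z \<in> cocycles N n" using iso(6)[OF z(1)] N.cocycleI by blast
  then obtain w where w: "w \<in> mod_grade N (n - 1)" "g z = mod_diff N w"
    using assms(4) by (auto simp: exact_at_def elim: N.coboundaryE)
  then have "z = mod_diff N' (f w)" using iso(3)[OF w(1)] iso(7)[OF z(1)] by simp
  then show "z \<in> coboundaries N' n" using N'.coboundaryI[OF iso(1)[OF w(1)]] by simp
qed

lemma isomorphic_complexes_refl: "isomorphic_complexes A N N"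
  unfolding isomorphic_complexes_def complex_iso_def
  by (intro exI[of _ "\<lambda>x. x"]) simp

lemma isomorphic_complexes_trans:
  assumes "isomorphic_complexes A N1 N2" "isomorphic_complexes A N2 N3" "dg_complex N1 A"
  shows "isomorphic_complexes A N1 N3"
proof -
  interpret N1: dg_complex N1 A by fact
  obtain f g f' g' where iso: "complex_iso A N1 N2 f g" "complex_iso A N2 N3 f' g'"
    using assms by (auto simp: isomorphic_complexes_def)
  note D = complex_isoD[OF iso(1)] and D' = complex_isoD[OF iso(2)]
  have "complex_iso A N1 N3 (\<lambda>x. f' (f x)) (\<lambda>y. g (g' y))"
    unfolding complex_iso_def
  proof (intro allI conjI ballI)
    fix n x assume x: "x \<in> mod_grade N1 n"
    note fx = D(1)[OF x]
    show "f' (f x) \<in> mod_grade N3 n" "g (g' (f' (f x))) = x"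
      "f' (f (mod_diff N1 x)) = mod_diff N3 (f' (f x))"
      using D'(1-3)[OF fx] D(2,3)[OF x] by simp_all
    show "f' (f (x \<oplus>\<^bsub>N1\<^esub> y)) = f' (f x) \<oplus>\<^bsub>N3\<^esub> f' (f y)" if "y \<in> mod_grade N1 n" for y
      using D(4)[OF x that] D'(4)[OF fx D(1)[OF that]] by simp
    show "f' (f (a \<odot>\<^bsub>N1\<^esub> x)) = a \<odot>\<^bsub>N3\<^esub> f' (f x)" if "a \<in> dg_grade A 0" for a
      using D(5)[OF x that] D'(5)[OF fx that] by simp
  next
    fix n y assume y: "y \<in> mod_grade N3 n"
    show "g (g' y) \<in> mod_grade N1 n" "f' (f (g (g' y))) = y"
      using D'(6,7)[OF y] D(6,7)[OF D'(6)[OF y]] by simp_all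
  qed
  then show ?thesis by (auto simp: isomorphic_complexes_def)
qed

lemma isomorphic_complexes_koszul:
  assumes "isomorphic_complexes A N N'" "dg_complex N A" "dg_complex N' A" "a \<in> dg_grade A 0"
  shows "isomorphic_complexes A (koszul A N a) (koszul A N' a)"
proof -
  interpret N: dg_complex N A by fact
  obtain f g where fg: "complex_iso A N N' f g" using assms by (auto simp: isomorphic_complexes_def)
  note iso = complex_isoD[OF fg]
  have "complex_iso A (koszul A N a) (koszul A N' a)
    (\<lambda>u. Kos (f (kos_fst u)) (f (kos_snd u))) (\<lambda>u. Kos (g (kos_fst u)) (g (kos_snd u)))"
    unfolding complex_iso_def
  proof (intro allI conjI ballI)
    fix n u assume "u \<in> mod_grade (koszul A N a) n"
    then obtain x y where u: "u = Kos x y" and x: "x \<in> mod_grade N n" and y: "y \<in> mod_grade N (n + 1)"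
      by (rule koszul_gradeE)
    show "Kos (f (kos_fst u)) (f (kos_snd u)) \<in> mod_grade (koszul A N' a) n"
      using u iso(1)[OF x] iso(1)[OF y] by simp
    show "Kos (g (kos_fst (Kos (f (kos_fst u)) (f (kos_snd u)))))
        (g (kos_snd (Kos (f (kos_fst u)) (f (kos_snd u))))) = u"
      using u iso(2)[OF x] iso(2)[OF y] by simp
    show "Kos (f (kos_fst (mod_diff (koszul A N a) u))) (f (kos_snd (mod_diff (koszul A N a) u))) =
      mod_diff (koszul A N' a) (Kos (f (kos_fst u)) (f (kos_snd u)))"
      using u iso(3)[OF x] iso(3)[OF y] iso(5)[OF y assms(4)]
        iso(4)[OF N.mod_diff_grade[OF x] N.smult_grade[OF assms(4) y]]
        complex_iso_uminus[OF fg assms(2,3) N.mod_diff_grade[OF y]] by simp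
    show "Kos (f (kos_fst (u \<oplus>\<^bsub>koszul A N a\<^esub> v))) (f (kos_snd (u \<oplus>\<^bsub>koszul A N a\<^esub> v))) =
      Kos (f (kos_fst u)) (f (kos_snd u)) \<oplus>\<^bsub>koszul A N' a\<^esub> Kos (f (kos_fst v)) (f (kos_snd v))"
      if v: "v \<in> mod_grade (koszul A N a) n" for v
    proof -
      obtain x' y' where "v = Kos x' y'" "x' \<in> mod_grade N n" "y' \<in> mod_grade N (n + 1)"
        using v by (rule koszul_gradeE)
      then show ?thesis using u iso(4)[OF x] iso(4)[OF y] by simp
    qed
    show "Kos (f (kos_fst (b \<odot>\<^bsub>koszul A N a\<^esub> u))) (f (kos_snd (b \<odot>\<^bsub>koszul A N a\<^esub> u))) =
      b \<odot>\<^bsub>koszul A N' a\<^esub> Kos (f (kos_fst u)) (f (kos_snd u))" if b: "b \<in> dg_grade A 0" for b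
      using u iso(5)[OF x b] iso(5)[OF y b] koszul_smult[OF assms(2,4) b] koszul_smult[OF assms(3,4) b]
      by (simp del: koszul_simps(4))
  next
    fix n u assume "u \<in> mod_grade (koszul A N' a) n"
    then obtain x y where "u = Kos x y" "x \<in> mod_grade N' n" "y \<in> mod_grade N' (n + 1)"
      by (rule koszul_gradeE)
    then show "Kos (g (kos_fst u)) (g (kos_snd u)) \<in> mod_grade (koszul A N a) n"
      "Kos (f (kos_fst (Kos (g (kos_fst u)) (g (kos_snd u)))))
        (f (kos_snd (Kos (g (kos_fst u)) (g (kos_snd u))))) = u"
      using iso(6,7) by simp_all
  qed
  then show ?thesis by (auto simp: isomorphic_complexes_def)
qed

lemma koszul_commute:
  assumes "dg_complex N A" "a \<in> dg_grade A 0" "b \<in> dg_grade A 0"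
  shows "isomorphic_complexes A (koszul A (koszul A N b) a) (koszul A (koszul A N a) b)"
proof -
  interpret N: dg_complex N A by fact
  let ?N1 = "koszul A (koszul A N b) a" and ?N2 = "koszul A (koszul A N a) b"
  \<comment> \<open>The two generators anticommute in the exterior algebra, so exchanging them swaps
    the two middle components and negates the last. The map is its own inverse.\<close>
  let ?f = "\<lambda>u. Kos (Kos (kos_fst (kos_fst u)) (kos_fst (kos_snd u)))
    (Kos (kos_snd (kos_fst u)) (\<ominus>\<^bsub>N\<^esub> kos_snd (kos_snd u)))"
  have ab: "abelian_group N" by (rule N.abelian_group_axioms)
  note ab' = koszul_uminus[OF ab]
  have gE: "\<exists>x y z w. u = Kos (Kos x y) (Kos z w) \<and> x \<in> mod_grade N n \<and> y \<in> mod_grade N (n + 1) \<and>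
      z \<in> mod_grade N (n + 1) \<and> w \<in> mod_grade N (n + 1 + 1)"
    if "u \<in> mod_grade (koszul A (koszul A N b') a') n" for u n a' b'
    using that by (elim koszul_gradeE) simp
  have inv: "?f (?f (Kos (Kos x y) (Kos z w))) = Kos (Kos x y) (Kos z w)"
    if "w \<in> mod_grade N m" for x y z w m
    using N.minus_minus[OF N.grade_carrier[OF that]] by simp
  have "complex_iso A ?N1 ?N2 ?f ?f"
    unfolding complex_iso_def
  proof (intro allI conjI ballI)
    fix n u assume u_grade: "u \<in> mod_grade ?N1 n"
    then obtain x y z w where u: "u = Kos (Kos x y) (Kos z w)" and x: "x \<in> mod_grade N n"
      and y: "y \<in> mod_grade N (n + 1)" and z: "z \<in> mod_grade N (n + 1)"
      and w: "w \<in> mod_grade N (n + 1 + 1)" using gE by blast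
    show "?f u \<in> mod_grade ?N2 n" using u x y z N.grade_uminus[OF w] by simp
    show "?f (?f u) = u" using inv[OF w] u by blast
    note c = N.mod_diff_carrier[OF x] N.mod_diff_carrier[OF y] N.mod_diff_carrier[OF z]
      N.mod_diff_carrier[OF w] N.smult_grade_carrier[OF assms(3) y]
      N.smult_grade_carrier[OF assms(2) z] N.smult_grade_carrier[OF assms(3) w]
      N.smult_grade_carrier[OF assms(2) w] N.grade_carrier[OF w]
    note sm = koszul_smult[OF assms(1,3,2)] koszul_smult[OF assms(1,2,3)]
    show "?f (mod_diff ?N1 u) = mod_diff ?N2 (?f u)"
      using u c by (simp add: sm ab' N.mod_diff_uminus[OF w] N.smult_uminus[OF assms(2)]
          N.smult_uminus[OF assms(3)] N.minus_add N.a_ac N.minus_minus del: koszul_simps(4))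
    show "?f (u \<oplus>\<^bsub>?N1\<^esub> v) = ?f u \<oplus>\<^bsub>?N2\<^esub> ?f v" if v: "v \<in> mod_grade ?N1 n" for v
    proof -
      obtain x' y' z' w' where "v = Kos (Kos x' y') (Kos z' w')" "w' \<in> mod_grade N (n + 1 + 1)"
        using gE[OF v] by blast
      then show ?thesis using u c(9) N.grade_carrier by (simp add: N.minus_add)
    qed
    show "?f (d \<odot>\<^bsub>?N1\<^esub> u) = d \<odot>\<^bsub>?N2\<^esub> ?f u" if d: "d \<in> dg_grade A 0" for d
      using u c(9) koszul_smult[OF assms(1,2) d] koszul_smult[OF assms(1,3) d]
        koszul_smult[OF dg_complex_koszul[OF assms(1,2)] assms(3) d]
        koszul_smult[OF dg_complex_koszul[OF assms(1,3)] assms(2) d]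
      by (simp add: N.smult_uminus[OF d] del: koszul_simps(4))
  next
    fix n u assume u_grade: "u \<in> mod_grade ?N2 n"
    then obtain x y z w where u: "u = Kos (Kos x y) (Kos z w)" and x: "x \<in> mod_grade N n"
      and y: "y \<in> mod_grade N (n + 1)" and z: "z \<in> mod_grade N (n + 1)"
      and w: "w \<in> mod_grade N (n + 1 + 1)" using gE by blast
    show "?f u \<in> mod_grade ?N1 n" using u x y z N.grade_uminus[OF w] by simp
    show "?f (?f u) = u" using inv[OF w] u by blast
  qed
  then show ?thesis by (auto simp: isomorphic_complexes_def)
qed

lemma isomorphic_complexes_koszul_iter:
  assumes "isomorphic_complexes A N N'" "dg_complex N A" "dg_complex N' A" "set as \<subseteq> dg_grade A 0"
  shows "isomorphic_complexes A (koszul_iter A N as) (koszul_iter A N' as)"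
  using assms
  by (induction as arbitrary: N N') (auto simp: isomorphic_complexes_koszul dg_complex_koszul)

lemma koszul_iter_koszul_commute:
  assumes "dg_complex N A" "set as \<subseteq> dg_grade A 0" "b \<in> dg_grade A 0"
  shows "isomorphic_complexes A (koszul_iter A (koszul A N b) as) (koszul A (koszul_iter A N as) b)"
  using assms
proof (induction as arbitrary: N)
  case Nil
  then show ?case by (simp add: isomorphic_complexes_refl)
next
  case (Cons a as)
  then have a: "a \<in> dg_grade A 0" and as: "set as \<subseteq> dg_grade A 0" by auto
  note b = Cons.prems(3)
  note Na = dg_complex_koszul[OF Cons.prems(1) a] and Nb = dg_complex_koszul[OF Cons.prems(1) b]
  have "isomorphic_complexes A (koszul_iter A (koszul A (koszul A N b) a) as)
    (koszul_iter A (koszul A (koszul A N a) b) as)"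
    using koszul_commute[OF Cons.prems(1) a b] dg_complex_koszul[OF Nb a] dg_complex_koszul[OF Na b] as
    by (rule isomorphic_complexes_koszul_iter)
  moreover have "isomorphic_complexes A (koszul_iter A (koszul A (koszul A N a) b) as)
    (koszul A (koszul_iter A (koszul A N a) as) b)"
    using Cons.IH[OF Na as b] .
  ultimately show ?case
    using isomorphic_complexes_trans dg_complex_koszul_iter[OF dg_complex_koszul[OF Nb a] as] by simp
qed

lemma koszul_iter_commute:
  assumes "dg_complex N A" "set as \<subseteq> dg_grade A 0" "set bs \<subseteq> dg_grade A 0"
  shows "isomorphic_complexes A (koszul_iter A (koszul_iter A N bs) as)
    (koszul_iter A (koszul_iter A N as) bs)"
  using assms
proof (induction bs arbitrary: N)
  case Nil
  then show ?case by (simp add: isomorphic_complexes_refl)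
next
  case (Cons b bs)
  then have b: "b \<in> dg_grade A 0" and bs: "set bs \<subseteq> dg_grade A 0" by auto
  note as = Cons.prems(2)
  note Nb = dg_complex_koszul[OF Cons.prems(1) b]
  have "isomorphic_complexes A (koszul_iter A (koszul_iter A (koszul A N b) as) bs)
    (koszul_iter A (koszul A (koszul_iter A N as) b) bs)"
    using koszul_iter_koszul_commute[OF Cons.prems(1) as b] dg_complex_koszul_iter[OF Nb as]
      dg_complex_koszul[OF dg_complex_koszul_iter[OF Cons.prems(1) as] b] bs
    by (rule isomorphic_complexes_koszul_iter)
  moreover have "isomorphic_complexes A (koszul_iter A (koszul_iter A (koszul A N b) bs) as)
    (koszul_iter A (koszul_iter A (koszul A N b) as) bs)"
    using Cons.IH[OF Nb as bs] .
  ultimately show ?case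
    using isomorphic_complexes_trans dg_complex_koszul_iter[OF dg_complex_koszul_iter[OF Nb bs] as]
    by simp
qed

text \<open>Depth sensitivity of the Koszul complex: compare the infimum of the cohomology of the
  Koszul complex on \<open>xs\<close> and \<open>ys\<close> together, computed in the two possible orders.\<close>

lemma exact_below_koszul_parameters:
  assumes N: "dg_complex N A" and below: "exact_below N i" and ys: "regular_in_degree A N i ys"
    and xs: "set xs \<subseteq> dg_grade A 0" and nil: "set ys \<subseteq> locally_nilpotent A (koszul_iter A N xs)"
  shows "exact_below (koszul_iter A N xs) (i + int (length ys) - int (length xs))"
proof -
  have ys0: "set ys \<subseteq> dg_grade A 0" using nil by (auto simp: locally_nilpotent_def)
  have "exact_below (koszul_iter A N ys) i" using exact_below_regular_sequence[OF N ys0 below ys] .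
  then have "exact_below (koszul_iter A (koszul_iter A N ys) xs) (i - int (length xs))"
    by (intro exact_below_koszul_iter[OF dg_complex_koszul_iter[OF N ys0] xs])
  then have "exact_below (koszul_iter A (koszul_iter A N xs) ys) (i - int (length xs))"
    using exact_at_iso[OF koszul_iter_commute[OF N xs ys0]
        dg_complex_koszul_iter[OF dg_complex_koszul_iter[OF N ys0] xs]
        dg_complex_koszul_iter[OF dg_complex_koszul_iter[OF N xs] ys0]]
    by (auto simp: exact_below_def)
  then have "exact_below (koszul_iter A N xs) (i - int (length xs) + int (length ys))"
    by (intro exact_below_koszul_iter_locally_nilpotent[OF dg_complex_koszul_iter[OF N xs] nil])
  then show ?thesis by (simp add: algebra_simps)
qed

text \<open>Cohomology in degree \<open>i\<close> survives in the Koszul complex on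
  \<open>xs\<close>, which caps the bound below which that complex is exact. For equal lengths the
  bound is \<open>i\<close> itself, and exactness below \<open>i\<close> gives regularity.\<close>

theorem regular_sequence_parameters:
  assumes N: "noetherian_complex A N" and below: "exact_below N i" and inf: "\<not> exact_at N i"
    and ys: "regular_in_degree A N i ys" and xs: "\<forall>x\<in>set xs. radical_element A x"
    and nil: "set ys \<subseteq> locally_nilpotent A (koszul_iter A N xs)"
  shows "length ys \<le> length xs"
    and "length xs \<le> length ys \<Longrightarrow> regular_in_degree A N i xs"
proof -
  have N': "dg_complex N A" using N by (simp add: noetherian_complex_def)
  have xs0: "set xs \<subseteq> dg_grade A 0" using xs by (auto simp: radical_element_def)
  have *: "exact_below (koszul_iter A N xs) (i + int (length ys) - int (length xs))"
    using exact_below_koszul_parameters[OF N' below ys xs0 nil] .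
  have "\<not> exact_at (koszul_iter A N xs) i" using exact_at_koszul_iter[OF N xs] inf by blast
  then have "\<not> i < i + int (length ys) - int (length xs)" using * by (auto simp: exact_below_def)
  then show "length ys \<le> length xs" by simp
  then show "regular_in_degree A N i xs" if "length xs \<le> length ys"
    using that * by (intro regular_sequence_if_exact_below[OF N xs]) simp
qed

text \<open>Nilpotence is known at first for the chosen lifts of \<open>xs\<close> only. Since the
  locally nilpotent elements form a radical ideal containing the coboundaries, it extends to every
  lift of an element with a power in the ideal generated by \<open>xs\<close>.\<close>

lemma locally_nilpotent_ideal:
  assumes "dg_complex N A"
  shows "ideal (locally_nilpotent A N) (dg_zero_part A)"
    and "coboundaries (dg_self A) 0 \<subseteq> locally_nilpotent A N"
    and "\<lbrakk>c \<in> dg_grade A 0; c [^]\<^bsub>dg_zero_part A\<^esub> (k::nat) \<in> locally_nilpotent A N\<rbrakk> \<Longrightarrow>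
      c \<in> locally_nilpotent A N"
proof -
  interpret dg_complex N A by fact
  let ?R = "dg_zero_part A"
  have pow: "c [^]\<^bsub>?R\<^esub> k \<in> dg_grade A 0" if "c \<in> dg_grade A 0" for c and k :: nat
    using R.nat_pow_closed[of c k] that by simp
  have Zc: "z \<in> carrier N" if "z \<in> cocycles N n" for z n using that cocycleD grade_carrier by blast
  have pow_Suc: "(c [^]\<^bsub>?R\<^esub> Suc k) \<odot>\<^bsub>N\<^esub> z = (c [^]\<^bsub>?R\<^esub> k) \<odot>\<^bsub>N\<^esub> (c \<odot>\<^bsub>N\<^esub> z)"
    if "c \<in> dg_grade A 0" "z \<in> carrier N" for c z and k :: nat
    using smult_smult[OF pow[OF that(1)] that, of k] by simp
  note linB = linear_subsetD[OF linear_coboundaries] and linZ = linear_subsetD[OF linear_cocycles]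
  \<comment> \<open>Induction on \<open>k + l\<close> in place of the binomial theorem: one factor
    \<open>c \<oplus> d\<close> is split off, and applying \<open>c\<close> or \<open>d\<close> to
    \<open>z\<close> lowers one of the two exponents.\<close>
  have add: "((c \<oplus>\<^bsub>A\<^esub> d) [^]\<^bsub>?R\<^esub> (k + l)) \<odot>\<^bsub>N\<^esub> z \<in> coboundaries N n"
    if cd: "c \<in> dg_grade A 0" "d \<in> dg_grade A 0" and z: "z \<in> cocycles N n"
      and "(c [^]\<^bsub>?R\<^esub> k) \<odot>\<^bsub>N\<^esub> z \<in> coboundaries N n" "(d [^]\<^bsub>?R\<^esub> l) \<odot>\<^bsub>N\<^esub> z \<in> coboundaries N n"
    for c d z n and k l :: nat
    using that(3-)
  proof (induction "k + l" arbitrary: k l z)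
    case 0
    then show ?case by simp
  next
    case (Suc s)
    have cd': "c \<oplus>\<^bsub>A\<^esub> d \<in> dg_grade A 0" using R.a_closed[of c d] cd by simp
    show ?case
    proof (cases "k = 0 \<or> l = 0")
      case True
      then have "z \<in> coboundaries N n" using Suc.prems smult_one[OF Zc[OF Suc.prems(1)]] by auto
      then show ?thesis using linB(4) pow[OF cd'] by blast
    next
      case False
      then obtain k' l' where kl: "k = Suc k'" "l = Suc l'" by (metis not0_implies_Suc)
      have zc: "z \<in> carrier N" using Zc Suc.prems by blast
      have s: "s = k' + l" "s = k + l'" using Suc.hyps(2) kl by auto
      have "((c \<oplus>\<^bsub>A\<^esub> d) [^]\<^bsub>?R\<^esub> s) \<odot>\<^bsub>N\<^esub> (c \<odot>\<^bsub>N\<^esub> z) \<in> coboundaries N n"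
      proof (subst s(1), rule Suc.hyps(1)[OF s(1)])
        show "c \<odot>\<^bsub>N\<^esub> z \<in> cocycles N n" using linZ(4) cd Suc.prems by blast
        show "(c [^]\<^bsub>?R\<^esub> k') \<odot>\<^bsub>N\<^esub> (c \<odot>\<^bsub>N\<^esub> z) \<in> coboundaries N n"
          using Suc.prems(2) pow_Suc[OF cd(1) zc] kl by simp
        show "(d [^]\<^bsub>?R\<^esub> l) \<odot>\<^bsub>N\<^esub> (c \<odot>\<^bsub>N\<^esub> z) \<in> coboundaries N n"
          using linB(4)[OF cd(1) Suc.prems(3)] smult_commute[OF cd(1) pow[OF cd(2)] zc] by simp
      qed
      moreover have "((c \<oplus>\<^bsub>A\<^esub> d) [^]\<^bsub>?R\<^esub> s) \<odot>\<^bsub>N\<^esub> (d \<odot>\<^bsub>N\<^esub> z) \<in> coboundaries N n"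
      proof (subst s(2), rule Suc.hyps(1)[OF s(2)])
        show "d \<odot>\<^bsub>N\<^esub> z \<in> cocycles N n" using linZ(4) cd Suc.prems by blast
        show "(d [^]\<^bsub>?R\<^esub> l') \<odot>\<^bsub>N\<^esub> (d \<odot>\<^bsub>N\<^esub> z) \<in> coboundaries N n"
          using Suc.prems(3) pow_Suc[OF cd(2) zc] kl by simp
        show "(c [^]\<^bsub>?R\<^esub> k) \<odot>\<^bsub>N\<^esub> (d \<odot>\<^bsub>N\<^esub> z) \<in> coboundaries N n"
          using linB(4)[OF cd(2) Suc.prems(2)] smult_commute[OF cd(2) pow[OF cd(1)] zc] by simp
      qed
      moreover have "((c \<oplus>\<^bsub>A\<^esub> d) [^]\<^bsub>?R\<^esub> (k + l)) \<odot>\<^bsub>N\<^esub> z =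
        ((c \<oplus>\<^bsub>A\<^esub> d) [^]\<^bsub>?R\<^esub> s) \<odot>\<^bsub>N\<^esub> (c \<odot>\<^bsub>N\<^esub> z) \<oplus>\<^bsub>N\<^esub> ((c \<oplus>\<^bsub>A\<^esub> d) [^]\<^bsub>?R\<^esub> s) \<odot>\<^bsub>N\<^esub> (d \<odot>\<^bsub>N\<^esub> z)"
        using pow_Suc[OF cd' zc, of s] Suc.hyps(2) smult_l_distr[of c d z] cd zc
          smult_r_distr[of "(c \<oplus>\<^bsub>A\<^esub> d) [^]\<^bsub>?R\<^esub> s" "c \<odot>\<^bsub>N\<^esub> z" "d \<odot>\<^bsub>N\<^esub> z"] pow[OF cd'] smult_closed'
        by (simp del: R.nat_pow_Suc)
      ultimately show ?thesis using linB(3) by simp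
    qed
  qed
  show "ideal (locally_nilpotent A N) ?R"
  proof (rule R.cring_idealI)
    show "locally_nilpotent A N \<subseteq> carrier ?R" by (auto simp: locally_nilpotent_def)
    have "(\<zero>\<^bsub>A\<^esub> [^]\<^bsub>?R\<^esub> Suc 0) \<odot>\<^bsub>N\<^esub> z \<in> coboundaries N n" if "z \<in> cocycles N n" for z n
      using smult_l_null[OF Zc[OF that]] linB(2) R.nat_pow_eone[OF R.zero_closed] by simp
    then have "\<exists>k::nat. (\<zero>\<^bsub>A\<^esub> [^]\<^bsub>?R\<^esub> k) \<odot>\<^bsub>N\<^esub> z \<in> coboundaries N n" if "z \<in> cocycles N n" for z n
      using that by blast
    then show "\<zero>\<^bsub>?R\<^esub> \<in> locally_nilpotent A N"
      using R.zero_closed by (simp add: locally_nilpotent_def)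
  next
    fix c d assume "c \<in> locally_nilpotent A N" "d \<in> locally_nilpotent A N"
    then have cd: "c \<in> dg_grade A 0" "d \<in> dg_grade A 0" and
      "\<And>z n. z \<in> cocycles N n \<Longrightarrow> \<exists>k::nat. (c [^]\<^bsub>?R\<^esub> k) \<odot>\<^bsub>N\<^esub> z \<in> coboundaries N n"
      "\<And>z n. z \<in> cocycles N n \<Longrightarrow> \<exists>k::nat. (d [^]\<^bsub>?R\<^esub> k) \<odot>\<^bsub>N\<^esub> z \<in> coboundaries N n"
      by (auto simp: locally_nilpotent_def)
    then have "\<exists>k::nat. ((c \<oplus>\<^bsub>A\<^esub> d) [^]\<^bsub>?R\<^esub> k) \<odot>\<^bsub>N\<^esub> z \<in> coboundaries N n"
      if "z \<in> cocycles N n" for z n using add[OF cd that] that by blast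
    then show "c \<oplus>\<^bsub>?R\<^esub> d \<in> locally_nilpotent A N"
      using R.a_closed[of c d] cd by (simp add: locally_nilpotent_def)
  next
    fix c r assume c: "c \<in> locally_nilpotent A N" and "r \<in> carrier ?R"
    then have c0: "c \<in> dg_grade A 0" and r: "r \<in> dg_grade A 0" by (auto simp: locally_nilpotent_def)
    have "\<exists>k::nat. ((r \<otimes>\<^bsub>A\<^esub> c) [^]\<^bsub>?R\<^esub> k) \<odot>\<^bsub>N\<^esub> z \<in> coboundaries N n" if z: "z \<in> cocycles N n" for z n
    proof -
      obtain k :: nat where "(c [^]\<^bsub>?R\<^esub> k) \<odot>\<^bsub>N\<^esub> z \<in> coboundaries N n"
        using c z unfolding locally_nilpotent_def by blast
      then have "(r [^]\<^bsub>?R\<^esub> k) \<odot>\<^bsub>N\<^esub> ((c [^]\<^bsub>?R\<^esub> k) \<odot>\<^bsub>N\<^esub> z) \<in> coboundaries N n"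
        using linB(4) pow[OF r] by blast
      then show ?thesis
        using R.nat_pow_distrib[of r c k] r c0 smult_smult[OF pow[OF r] pow[OF c0] Zc[OF z], of k k]
        by (intro exI[of _ k]) simp
    qed
    then show "r \<otimes>\<^bsub>?R\<^esub> c \<in> locally_nilpotent A N"
      using R.m_closed[of r c] c0 r by (simp add: locally_nilpotent_def)
  qed
  show "coboundaries (dg_self A) 0 \<subseteq> locally_nilpotent A N"
  proof
    fix c assume c: "c \<in> coboundaries (dg_self A) 0"
    then have c0: "c \<in> dg_grade A 0"
      using comm_dg_ring.diff_grade[OF comm_dg_ring, of _ "-1"] by (auto simp: coboundaries_def)
    have "(c [^]\<^bsub>?R\<^esub> Suc 0) \<odot>\<^bsub>N\<^esub> z \<in> coboundaries N n" if "z \<in> cocycles N n" for z n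
      using coboundary_smult[OF c that] R.nat_pow_eone[of c] c0 by simp
    then show "c \<in> locally_nilpotent A N" using c0 unfolding locally_nilpotent_def by blast
  qed
  assume c: "c \<in> dg_grade A 0" "c [^]\<^bsub>?R\<^esub> (k::nat) \<in> locally_nilpotent A N"
  have "\<exists>l::nat. (c [^]\<^bsub>?R\<^esub> l) \<odot>\<^bsub>N\<^esub> z \<in> coboundaries N n" if z: "z \<in> cocycles N n" for z n
  proof -
    obtain l :: nat where "((c [^]\<^bsub>?R\<^esub> k) [^]\<^bsub>?R\<^esub> l) \<odot>\<^bsub>N\<^esub> z \<in> coboundaries N n"
      using c z unfolding locally_nilpotent_def by blast
    then show ?thesis using R.nat_pow_pow[of c k l] c(1) by auto
  qed
  then show "c \<in> locally_nilpotent A N" using c(1) by (simp add: locally_nilpotent_def)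
qed

section \<open>Cohomology as a module over the zeroth cohomology ring\<close>

lemma (in abelian_group) minus_add_cancel:
  assumes "x \<in> carrier G" "y \<in> carrier G"
  shows "(x \<oplus> \<ominus> y) \<oplus> y = x" "y \<oplus> (x \<oplus> \<ominus> y) = x"
  using assms by (simp_all add: a_assoc l_neg a_lcomm[of y x] r_neg)

context dg_complex begin

lemma linear_abelian_subgroup:
  assumes "linear_subset A N W" shows "abelian_subgroup W N"
proof (rule abelian_subgroupI3)
  show "additive_subgroup W N"
  proof (rule additive_subgroupI, rule add.subgroupI)
    show "W \<noteq> {}" using linear_subsetD(2)[OF assms] by blast
  qed (use linear_subsetD[OF assms] linear_subset_uminus[OF assms] in auto)
qed (rule abelian_group_axioms)

lemma coset_eq_iff:
  assumes "linear_subset A N W" "x \<in> carrier N" "y \<in> carrier N"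
  shows "W +> x = W +> y \<longleftrightarrow> x \<oplus> \<ominus> y \<in> W"
proof -
  interpret W: abelian_subgroup W N by (rule linear_abelian_subgroup[OF assms(1)])
  show ?thesis
    using W.a_rcos_module[OF assms(3,2)] W.a_rcos_self[OF assms(2)]
      W.a_repr_independence'[OF _ assms(3), of x] by metis
qed

lemma coset_zero: "linear_subset A N W \<Longrightarrow> W +> \<zero> = W"
  using linear_subsetD(1) by (intro a_coset_add_zero) blast

lemma carrier_cohomology:
  "carrier (cohomology N n) = (\<lambda>z. coboundaries N n +> z) ` cocycles N n"
  by (auto simp: cohomology_def)

lemma zero_cohomology: "zero (cohomology N n) = coboundaries N n +> \<zero>"
  using coset_zero[OF linear_coboundaries] by (simp add: cohomology_def)

lemma cocycle_carrier: "z \<in> cocycles N n \<Longrightarrow> z \<in> carrier N"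
  using linear_subsetD(1)[OF linear_cocycles] .

lemma cohomology_vanishes_iff: "cohomology_vanishes N n \<longleftrightarrow> exact_at N n"
proof -
  have *: "coboundaries N n +> z = coboundaries N n +> \<zero> \<longleftrightarrow> z \<in> coboundaries N n"
    if "z \<in> cocycles N n" for z
    using coset_eq_iff[OF linear_coboundaries, of z \<zero> n] cocycle_carrier[OF that] uminus_zero by simp
  show ?thesis
    unfolding cohomology_vanishes_def exact_at_def carrier_cohomology zero_cohomology
    using * linear_subsetD(2)[OF linear_cocycles, of n] by auto
qed

text \<open>The action is defined as a union over all representatives. It collapses to one coset:
  changing \<open>a\<close> by a coboundary of \<open>A\<close> alters the product by a coboundary
  thanks to the null-homotopy, and changing \<open>z\<close> does so by linearity of the
  differential.\<close>

lemma smult_cohomology: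
  assumes "a \<in> dg_grade A 0" "z \<in> cocycles N n"
  shows "(coboundaries (dg_self A) 0 +>\<^bsub>A\<^esub> a) \<odot>\<^bsub>cohomology N n\<^esub> (coboundaries N n +> z) =
    coboundaries N n +> (a \<odot> z)"
proof -
  note linB = linear_subsetD[OF linear_coboundaries]
  let ?C = "coboundaries (dg_self A) 0" and ?B = "coboundaries N n"
  have C0: "e \<in> dg_grade A 0" if "e \<in> ?C" for e
    using that comm_dg_ring.diff_grade[OF comm_dg_ring, of _ "-1"] by (auto simp: coboundaries_def)
  have "?B +> (x \<odot> y) = ?B +> (a \<odot> z)"
    if x: "x \<in> ?C +>\<^bsub>A\<^esub> a" and y: "y \<in> ?B +> z" for x y
  proof -
    obtain e b where e: "e \<in> ?C" "x = e \<oplus>\<^bsub>A\<^esub> a" and b: "b \<in> ?B" "y = b \<oplus> z"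
      using x y by (auto simp: a_r_coset_def')
    have yZ: "y \<in> cocycles N n"
      using b coboundary_cocycle assms(2) linear_subsetD(3)[OF linear_cocycles] by blast
    have c: "y \<in> carrier N" "z \<in> carrier N" "b \<in> carrier N"
      using cocycle_carrier yZ assms(2) linB(1)[OF b(1)] by auto
    note sc = smult_closed'[OF C0[OF e(1)] c(1)] smult_closed'[OF assms(1) c(2)]
      smult_closed'[OF assms(1) c(3)]
    have "x \<odot> y = e \<odot> y \<oplus> a \<odot> y" using smult_l_distr[of e a y] C0[OF e(1)] assms(1) c e(2) by simp
    also have "a \<odot> y = a \<odot> b \<oplus> a \<odot> z" using smult_r_distr[of a b z] assms(1) c b(2) by simp
    finally have xy: "x \<odot> y = e \<odot> y \<oplus> (a \<odot> b \<oplus> a \<odot> z)" .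
    then have "x \<odot> y \<oplus> \<ominus> (a \<odot> z) = e \<odot> y \<oplus> a \<odot> b" using sc by (simp add: a_assoc r_neg)
    also have "\<dots> \<in> ?B" using coboundary_smult[OF e(1) yZ] linB(4)[OF assms(1) b(1)] linB(3) by blast
    finally show ?thesis using coset_eq_iff[OF linear_coboundaries] xy sc by simp
  qed
  then have val: "\<forall>x\<in>?C +>\<^bsub>A\<^esub> a. \<forall>y\<in>?B +> z. ?B +> (x \<odot> y) = ?B +> (a \<odot> z)"
    by blast
  \<comment> \<open>Both cosets are inhabited, so the union is the common value and not
    empty.\<close>
  have "\<zero> \<oplus> z \<in> ?B +> z" using linB(2) by (auto simp: a_r_coset_def')
  moreover have "dg_diff A \<zero>\<^bsub>A\<^esub> \<oplus>\<^bsub>A\<^esub> a \<in> ?C +>\<^bsub>A\<^esub> a"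
  proof -
    interpret A: comm_dg_ring A by (rule comm_dg_ring)
    have "\<zero>\<^bsub>A\<^esub> \<in> dg_grade A (0 - 1)"
      using A.grade_subgroup[of "0 - 1"] by (rule additive_subgroup.zero_closed)
    then show ?thesis by (auto simp: a_r_coset_def' coboundaries_def)
  qed
  ultimately have "(\<Union>x\<in>?C +>\<^bsub>A\<^esub> a. \<Union>y\<in>?B +> z. ?B +> (x \<odot> y)) = ?B +> (a \<odot> z)"
    using val by blast
  then show ?thesis by (simp add: cohomology_def)
qed

end

section \<open>The DG-ring as a complex, and the projection to its zeroth cohomology\<close>

context comm_dg_ring begin

lemma grade_carrier: "x \<in> dg_grade A n \<Longrightarrow> x \<in> carrier A"
  using additive_subgroup.a_subset[OF grade_subgroup] by blast

lemma cring_zero_part: "cring (dg_zero_part A)"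
proof (rule cringI)
  interpret S: additive_subgroup "dg_grade A 0" A by (rule grade_subgroup)
  show "abelian_group (dg_zero_part A)"
  proof (rule abelian_groupI)
    fix x assume "x \<in> carrier (dg_zero_part A)"
    then show "\<exists>y\<in>carrier (dg_zero_part A). y \<oplus>\<^bsub>dg_zero_part A\<^esub> x = \<zero>\<^bsub>dg_zero_part A\<^esub>"
      using grade_carrier by (auto simp: l_neg intro!: bexI[of _ "\<ominus> x"])
  qed (auto simp: a_ac grade_carrier)
  show "comm_monoid (dg_zero_part A)"
  proof (rule comm_monoidI)
    show "x \<otimes>\<^bsub>dg_zero_part A\<^esub> y \<in> carrier (dg_zero_part A)"
      if "x \<in> carrier (dg_zero_part A)" "y \<in> carrier (dg_zero_part A)" for x y
      using mult_grade[of x 0 y 0] that by simp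
    show "x \<otimes>\<^bsub>dg_zero_part A\<^esub> y = y \<otimes>\<^bsub>dg_zero_part A\<^esub> x"
      if "x \<in> carrier (dg_zero_part A)" "y \<in> carrier (dg_zero_part A)" for x y
      using graded_comm[of x 0 y 0] that by (simp add: koszul_sign_def)
  qed (simp_all add: m_assoc grade_carrier one_grade)
qed (auto simp: l_distr grade_carrier)

lemma diff_zero: "dg_diff A \<zero> = \<zero>"
proof -
  have z: "\<zero> \<in> dg_grade A n" for n by (rule additive_subgroup.zero_closed[OF grade_subgroup])
  have "dg_diff A \<zero> \<oplus> dg_diff A \<zero> = dg_diff A \<zero>" using diff_add[of \<zero> \<zero>] by simp
  moreover have "dg_diff A \<zero> \<in> carrier A" using grade_carrier[OF diff_grade[OF z]] .
  ultimately show ?thesis by (metis add.r_cancel_one zero_closed)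
qed

lemma diff_degree_zero: "a \<in> dg_grade A 0 \<Longrightarrow> dg_diff A a = \<zero>"
  using diff_grade[of a 0] nonpositive[of 1] by simp

lemma diff_mult_degree_zero:
  assumes "a \<in> dg_grade A 0" "x \<in> dg_grade A n"
  shows "dg_diff A (a \<otimes> x) = a \<otimes> dg_diff A x"
  using leibniz[OF assms(1) grade_carrier[OF assms(2)]] diff_degree_zero[OF assms(1)]
    grade_carrier[OF assms(1)] grade_carrier[OF assms(2)] grade_carrier[OF diff_grade[OF assms(2)]]
  by (simp add: koszul_sign_def)

lemma dg_complex_self: "dg_complex (dg_self A) A"
proof -
  interpret R: cring "dg_zero_part A" by (rule cring_zero_part)
  have ab: "abelian_group (dg_self A)"
  proof (rule abelian_groupI)
    fix x assume "x \<in> carrier (dg_self A)"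
    then show "\<exists>y\<in>carrier (dg_self A). y \<oplus>\<^bsub>dg_self A\<^esub> x = \<zero>\<^bsub>dg_self A\<^esub>"
      by (auto simp: l_neg intro!: bexI[of _ "\<ominus> x"])
  qed (auto simp: a_ac)
  have "module (dg_zero_part A) (dg_self A)"
    by (rule moduleI[OF cring_zero_part ab]) (auto simp: grade_carrier l_distr r_distr m_assoc)
  then show ?thesis
  proof (rule dg_complex.intro, intro dg_complex_axioms.intro)
    show "comm_dg_ring A" by (rule comm_dg_ring_axioms)
    fix n
    interpret S: additive_subgroup "dg_grade A n" A by (rule grade_subgroup)
    show "additive_subgroup (mod_grade (dg_self A) n) (dg_self A)"
      using S.a_subgroup by (simp add: additive_subgroup_def dg_self_def subgroup_def m_inv_def)
    show "a \<odot>\<^bsub>dg_self A\<^esub> x \<in> mod_grade (dg_self A) n"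
      if "a \<in> dg_grade A 0" "x \<in> mod_grade (dg_self A) n" for a x
      using mult_grade[of a 0 x n] that by simp
    show "mod_diff (dg_self A) x \<in> mod_grade (dg_self A) (n + 1)"
      "mod_diff (dg_self A) (mod_diff (dg_self A) x) = \<zero>\<^bsub>dg_self A\<^esub>"
      if "x \<in> mod_grade (dg_self A) n" for x
      using that diff_grade[of x n] diff_diff[OF grade_carrier] by simp_all
    show "mod_diff (dg_self A) (x \<oplus>\<^bsub>dg_self A\<^esub> y) =
        mod_diff (dg_self A) x \<oplus>\<^bsub>dg_self A\<^esub> mod_diff (dg_self A) y"
      if "x \<in> mod_grade (dg_self A) n" "y \<in> mod_grade (dg_self A) n" for x y
      using that diff_add[OF grade_carrier grade_carrier] by simp
    show "mod_diff (dg_self A) (a \<odot>\<^bsub>dg_self A\<^esub> x) = a \<odot>\<^bsub>dg_self A\<^esub> mod_diff (dg_self A) x"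
      if "a \<in> dg_grade A 0" "x \<in> mod_grade (dg_self A) n" for a x
      using that diff_mult_degree_zero by simp
    fix c assume "c \<in> coboundaries (dg_self A) 0"
    then obtain b where b: "b \<in> dg_grade A (-1)" "c = dg_diff A b" by (auto simp: coboundaries_def)
    \<comment> \<open>For \<open>b\<close> of degree -1 the Leibniz rule is the homotopy formula for
      left multiplication by \<open>b\<close>. Linearity holds because no sign arises against degree
      zero.\<close>
    have "null_homotopy A (dg_self A) c ((\<otimes>) b)"
      unfolding null_homotopy_def
    proof (intro allI ballI conjI)
      fix n x assume x: "x \<in> mod_grade (dg_self A) n"
      then have x': "x \<in> dg_grade A n" by simp
      have bc: "b \<in> carrier A" and xc: "x \<in> carrier A" and dx: "dg_diff A x \<in> carrier A"
        and db: "dg_diff A b \<in> carrier A"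
        using grade_carrier b(1) x' diff_grade by blast+
      show "b \<otimes> x \<in> mod_grade (dg_self A) (n - 1)"
        using mult_grade[OF b(1) x'] by (simp add: algebra_simps)
      show "mod_diff (dg_self A) (b \<otimes> x) \<oplus>\<^bsub>dg_self A\<^esub> b \<otimes> mod_diff (dg_self A) x = c \<odot>\<^bsub>dg_self A\<^esub> x"
        using leibniz[OF b(1) xc] b(2) bc xc dx db by (simp add: koszul_sign_def a_assoc l_neg)
      show "b \<otimes> (x \<oplus>\<^bsub>dg_self A\<^esub> y) = b \<otimes> x \<oplus>\<^bsub>dg_self A\<^esub> b \<otimes> y" if "y \<in> mod_grade (dg_self A) n" for y
        using r_distr bc xc grade_carrier that by simp
      show "b \<otimes> (a \<odot>\<^bsub>dg_self A\<^esub> x) = a \<odot>\<^bsub>dg_self A\<^esub> (b \<otimes> x)" if a: "a \<in> dg_grade A 0" for a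
      proof -
        have "b \<otimes> a = a \<otimes> b" using graded_comm[OF a b(1)] by (simp add: koszul_sign_def)
        then have "(b \<otimes> a) \<otimes> x = (a \<otimes> b) \<otimes> x" by simp
        then show ?thesis using grade_carrier[OF a] bc xc by (simp add: m_assoc)
      qed
    qed
    then show "\<exists>h. null_homotopy A (dg_self A) c h" by blast
  qed
qed

lemma ideal_coboundaries: "ideal (coboundaries (dg_self A) 0) (dg_zero_part A)"
proof -
  interpret S: dg_complex "dg_self A" A by (rule dg_complex_self)
  show ?thesis
  proof (rule S.R.cring_idealI)
    show "coboundaries (dg_self A) 0 \<subseteq> carrier (dg_zero_part A)"
      using S.coboundary_cocycle[of 0] S.cocycleD(1) by auto
  qed (use S.linear_subsetD[OF S.linear_coboundaries[of 0]] in auto)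
qed

lemma H0_proj_eq: "a_r_coset (dg_zero_part A) (coboundaries (dg_self A) 0) = H0_proj A"
  by (auto simp: H0_proj_def a_r_coset_def')

lemma H0_proj_hom: "ring_hom_ring (dg_zero_part A) (H0 A) (H0_proj A)"
  using ideal.rcos_ring_hom_ring[OF ideal_coboundaries] by (simp add: H0_def H0_proj_eq)

lemma cring_H0: "cring (H0 A)"
  using ideal.quotient_is_cring[OF ideal_coboundaries cring_zero_part] by (simp add: H0_def)

lemma carrier_H0: "carrier (H0 A) = H0_proj A ` dg_grade A 0"
  by (auto simp: H0_def FactRing_def A_RCOSETS_def' H0_proj_def a_r_coset_def')

lemma H0_proj_eq_iff:
  assumes "a \<in> dg_grade A 0" "b \<in> dg_grade A 0"
  shows "H0_proj A a = H0_proj A b \<longleftrightarrow> a \<oplus> \<ominus>\<^bsub>dg_zero_part A\<^esub> b \<in> coboundaries (dg_self A) 0"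
proof -
  interpret I: ideal "coboundaries (dg_self A) 0" "dg_zero_part A" by (rule ideal_coboundaries)
  show ?thesis
    using I.a_rcos_module[of b a] I.a_rcos_self[of a] I.a_repr_independence'[of a b] assms
    unfolding H0_proj_eq by auto
qed

lemma H0_lift:
  assumes "X \<in> carrier (H0 A)"
  shows "H0_lift X \<in> dg_grade A 0" "H0_proj A (H0_lift X) = X"
proof -
  interpret I: ideal "coboundaries (dg_self A) 0" "dg_zero_part A" by (rule ideal_coboundaries)
  obtain a where a: "a \<in> dg_grade A 0" "X = H0_proj A a" using assms carrier_H0 by blast
  then have "a \<in> X" using I.a_rcos_self[of a] unfolding H0_proj_eq by simp
  then have "H0_lift X \<in> H0_proj A a" unfolding H0_lift_def a(2)[symmetric] by (rule someI)
  then show "H0_lift X \<in> dg_grade A 0" "H0_proj A (H0_lift X) = X"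
    using I.a_elemrcos_carrier[of a "H0_lift X"] I.a_repr_independence'[of "H0_lift X" a] a
    unfolding H0_proj_eq by auto
qed

text \<open>An ideal containing the kernel of \<open>H0_proj A\<close> is the full preimage of its
  image, so membership can be tested in \<open>H0 A\<close>.\<close>

lemma mem_if_H0_proj_mem_Idl:
  assumes J: "ideal J (dg_zero_part A)" "coboundaries (dg_self A) 0 \<subseteq> J"
    and "S \<subseteq> J" "b \<in> dg_grade A 0" "H0_proj A b \<in> Idl\<^bsub>H0 A\<^esub> (H0_proj A ` S)"
  shows "b \<in> J"
proof -
  interpret R: cring "dg_zero_part A" by (rule cring_zero_part)
  interpret H: cring "H0 A" by (rule cring_H0)
  interpret J: ideal J "dg_zero_part A" by (rule J)
  have "ideal (H0_proj A ` J) (H0 A)"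
    using R.ring_ideal_imp_quot_ideal[OF ideal_coboundaries J(1)] by (simp add: H0_proj_eq H0_def)
  then have "Idl\<^bsub>H0 A\<^esub> (H0_proj A ` S) \<subseteq> H0_proj A ` J"
    using assms(3) by (intro H.genideal_minimal) auto
  then obtain j where j: "j \<in> J" "H0_proj A b = H0_proj A j" using assms(5) by blast
  have jc: "j \<in> carrier (dg_zero_part A)" using j J.Icarr by blast
  then have "b \<oplus> \<ominus>\<^bsub>dg_zero_part A\<^esub> j \<in> J" using H0_proj_eq_iff[OF assms(4), of j] j(2) J(2) by auto
  then have "(b \<oplus>\<^bsub>dg_zero_part A\<^esub> \<ominus>\<^bsub>dg_zero_part A\<^esub> j) \<oplus>\<^bsub>dg_zero_part A\<^esub> j \<in> J"
    using J.a_closed j(1) by simp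
  moreover have "(b \<oplus>\<^bsub>dg_zero_part A\<^esub> \<ominus>\<^bsub>dg_zero_part A\<^esub> j) \<oplus>\<^bsub>dg_zero_part A\<^esub> j = b"
    using R.minus_add_cancel(1)[OF _ jc, of b] assms(4) by simp
  ultimately show ?thesis by simp
qed

text \<open>The element \<open>1 - r a\<close> maps outside \<open>m\<close>, hence to a unit of the
  local ring \<open>H0 A\<close>. Lifting the inverse to \<open>A\<^sup>0\<close> leaves an error
  that is a coboundary.\<close>

lemma radical_elementI:
  assumes "noetherian_ring (H0 A)" "local_ring (H0 A) m" "a \<in> dg_grade A 0" "H0_proj A a \<in> m"
  shows "radical_element A a"
  unfolding radical_element_def
proof (intro conjI ballI assms(3))
  fix r assume r: "r \<in> dg_grade A 0"
  let ?R = "dg_zero_part A"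
  interpret R: cring ?R by (rule cring_zero_part)
  interpret H: noetherian_cring "H0 A"
    by (rule noetherian_cring.intro[OF cring_H0 assms(1)])
  interpret p: ring_hom_ring ?R "H0 A" "H0_proj A" by (rule H0_proj_hom)
  interpret m: primeideal m "H0 A" by (rule H.local_ring_prime[OF assms(2)])
  let ?t = "\<one> \<ominus>\<^bsub>?R\<^esub> (r \<otimes> a)"
  have ra: "r \<otimes> a \<in> carrier ?R" using R.m_closed[of r a] r assms(3) by simp
  have t: "?t \<in> carrier ?R" using R.minus_closed[OF R.one_closed ra] by simp
  have "H0_proj A ?t \<notin> m"
  proof
    assume tm: "H0_proj A ?t \<in> m"
    have "H0_proj A (r \<otimes> a) \<in> m"
      using p.hom_mult[of r a] r assms(3,4) m.I_l_closed[OF assms(4), of "H0_proj A r"]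
        p.hom_closed[of r] by simp
    then have "H0_proj A ?t \<oplus>\<^bsub>H0 A\<^esub> H0_proj A (r \<otimes> a) \<in> m" using tm by simp
    moreover have "H0_proj A ?t \<oplus>\<^bsub>H0 A\<^esub> H0_proj A (r \<otimes> a) = H0_proj A (?t \<oplus>\<^bsub>?R\<^esub> (r \<otimes> a))"
      using p.hom_add[OF t ra] by simp
    moreover have "?t \<oplus>\<^bsub>?R\<^esub> (r \<otimes> a) = \<one>\<^bsub>?R\<^esub>"
      using R.minus_add_cancel(1)[OF R.one_closed ra] by (simp add: R.minus_eq)
    ultimately show False using m.one_not_mem p.hom_one by simp
  qed
  then obtain U where U: "U \<in> carrier (H0 A)" "U \<otimes>\<^bsub>H0 A\<^esub> H0_proj A ?t = \<one>\<^bsub>H0 A\<^esub>"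
    using H.local_ring_unit[OF assms(2) p.hom_closed[OF t]] by blast
  then obtain u where u: "u \<in> dg_grade A 0" "U = H0_proj A u" using carrier_H0 by blast
  have ut: "u \<otimes> ?t \<in> carrier ?R" using R.m_closed[of u ?t] u t by simp
  have "H0_proj A (u \<otimes> ?t) = H0_proj A \<one>"
    using p.hom_mult[of u ?t] u U(2) t p.hom_one by simp
  then have "(u \<otimes> ?t) \<oplus> \<ominus>\<^bsub>?R\<^esub> \<one> \<in> coboundaries (dg_self A) 0"
    using H0_proj_eq_iff[of "u \<otimes> ?t" \<one>] ut one_grade by simp
  moreover have "u \<otimes> ?t = \<one> \<oplus> ((u \<otimes> ?t) \<oplus> \<ominus>\<^bsub>?R\<^esub> \<one>)"
  proof -
    have "\<one>\<^bsub>?R\<^esub> \<oplus>\<^bsub>?R\<^esub> ((u \<otimes> ?t) \<oplus>\<^bsub>?R\<^esub> \<ominus>\<^bsub>?R\<^esub> \<one>\<^bsub>?R\<^esub>) = u \<otimes> ?t"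
      by (rule R.minus_add_cancel(2)[OF ut R.one_closed])
    then show ?thesis by simp
  qed
  ultimately show "\<exists>u\<in>dg_grade A 0. \<exists>e\<in>coboundaries (dg_self A) 0. u \<otimes> ?t = \<one> \<oplus> e"
    using u(1) by blast
qed

end


text \<open>Ideals of \<open>A\<^sup>0\<close> above the kernel of the projection are determined by
  their images in \<open>H0 A\<close>, where ascending chains stop. Without the restriction to such
  ideals there may be infinite chains.\<close>

lemma (in comm_dg_ring) wf_ideals_containing_coboundaries:
  assumes "noetherian_ring (H0 A)"
  shows "wf {(K, J). ideal J (dg_zero_part A) \<and> ideal K (dg_zero_part A) \<and>
    coboundaries (dg_self A) 0 \<subseteq> J \<and> J \<subset> K}"
proof -
  interpret R: cring "dg_zero_part A" by (rule cring_zero_part)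
  interpret H: noetherian_cring "H0 A"
    by (rule noetherian_cring.intro[OF cring_H0 assms(1)])
  have img: "ideal (H0_proj A ` J) (H0 A)" if "ideal J (dg_zero_part A)" for J
    using R.ring_ideal_imp_quot_ideal[OF ideal_coboundaries that] by (simp add: H0_proj_eq H0_def)
  have strict: "H0_proj A ` J \<subset> H0_proj A ` K"
    if J: "ideal J (dg_zero_part A)" "coboundaries (dg_self A) 0 \<subseteq> J" and
      K: "ideal K (dg_zero_part A)" and JK: "J \<subset> K" for J K
  proof -
    interpret J: ideal J "dg_zero_part A" by (rule J)
    interpret K: ideal K "dg_zero_part A" by (rule K)
    obtain k where k: "k \<in> K" "k \<notin> J" using JK by blast
    have kc: "k \<in> dg_grade A 0" using K.Icarr[OF k(1)] by simp
    have "H0_proj A k \<notin> H0_proj A ` J"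
    proof
      assume "H0_proj A k \<in> H0_proj A ` J"
      then obtain j where j: "j \<in> J" "H0_proj A k = H0_proj A j" by blast
      have jc: "j \<in> dg_grade A 0" using J.Icarr[OF j(1)] by simp
      have "k \<oplus> \<ominus>\<^bsub>dg_zero_part A\<^esub> j \<in> J" using H0_proj_eq_iff[OF kc jc] j(2) J(2) by auto
      then show False
        using J.a_closed[OF _ j(1)] R.minus_add_cancel(1)[of k j] kc jc k(2) by fastforce
    qed
    then show ?thesis using JK k(1) by blast
  qed
  show ?thesis
    by (rule wf_by_map[OF H.wf_ideal, where f = "(`) (H0_proj A)"]) (simp only: mem_Collect_eq case_prod_conv, elim conjE, intro conjI img strict)
qed

section \<open>From finite generation to the ascending chain condition\<close>

context dg_complex begin

text \<open>Modulo \<open>U\<close> the adjoined part is cyclic. A submodule is controlled by the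
  ideal of coefficients with which \<open>g\<close> occurs in it and by its intersection with
  \<open>U\<close>. The coefficient ideal contains the coboundaries of \<open>A\<close>, as these
  send the cocycle \<open>g\<close> to coboundaries; so only ideals of \<open>H0 A\<close>
  matter.\<close>

lemma noetherian_between_adjoin:
  assumes "noetherian_ring (H0 A)" and U: "linear_subset A N U" "coboundaries N n \<subseteq> U"
    and g: "g \<in> cocycles N n" and noeth: "noetherian_between A N (coboundaries N n) U"
  shows "noetherian_between A N (coboundaries N n) (linear_adjoin A N U g)"
proof -
  interpret A: comm_dg_ring A by (rule comm_dg_ring)
  note U' = linear_subsetD[OF U(1)]
  have gc: "g \<in> carrier N" using cocycle_carrier[OF g] .
  let ?f = "\<lambda>W. {c \<in> dg_grade A 0. \<exists>u\<in>U. u \<oplus> c \<odot> g \<in> W}" and ?g = "\<lambda>W. W \<inter> U"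
  have f: "ideal (?f W) (dg_zero_part A)" "coboundaries (dg_self A) 0 \<subseteq> ?f W"
    and g': "linear_subset A N (?g W)" "coboundaries N n \<subseteq> ?g W"
    if W: "linear_subset A N W" "coboundaries N n \<subseteq> W" for W
  proof -
    note W' = linear_subsetD[OF W(1)]
    show "linear_subset A N (?g W)" using W(1) U(1) by (auto simp: linear_subset_def)
    show "coboundaries N n \<subseteq> ?g W" using W U by blast
    show "coboundaries (dg_self A) 0 \<subseteq> ?f W"
    proof
      fix c assume c: "c \<in> coboundaries (dg_self A) 0"
      interpret I: ideal "coboundaries (dg_self A) 0" "dg_zero_part A" by (rule A.ideal_coboundaries)
      have "c \<in> dg_grade A 0" using I.Icarr[OF c] by simp
      moreover have "\<zero> \<oplus> c \<odot> g \<in> W"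
        using coboundary_smult[OF c g] W(2) smult_closed'[OF \<open>c \<in> dg_grade A 0\<close> gc] by auto
      ultimately show "c \<in> ?f W" using U'(2) by blast
    qed
    show "ideal (?f W) (dg_zero_part A)"
    proof (rule R.cring_idealI)
      show "?f W \<subseteq> carrier (dg_zero_part A)" by auto
      have "\<zero> \<oplus> \<zero>\<^bsub>A\<^esub> \<odot> g \<in> W" using smult_l_null[OF gc] W'(2) by simp
      then show "\<zero>\<^bsub>dg_zero_part A\<^esub> \<in> ?f W" using U'(2) R.zero_closed by auto
    next
      fix c d assume "c \<in> ?f W" "d \<in> ?f W"
      then obtain u v where uv: "u \<in> U" "v \<in> U" "u \<oplus> c \<odot> g \<in> W" "v \<oplus> d \<odot> g \<in> W"
        and cd: "c \<in> dg_grade A 0" "d \<in> dg_grade A 0" by blast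
      have "(u \<oplus> v) \<oplus> (c \<oplus>\<^bsub>A\<^esub> d) \<odot> g = (u \<oplus> c \<odot> g) \<oplus> (v \<oplus> d \<odot> g)"
        using smult_l_distr[of c d g] cd gc uv U'(1) smult_closed'[OF _ gc] by (simp add: a_ac)
      then show "c \<oplus>\<^bsub>dg_zero_part A\<^esub> d \<in> ?f W"
        using W'(3)[OF uv(3,4)] U'(3)[OF uv(1,2)] R.a_closed[of c d] cd
        by (intro CollectI conjI bexI[of _ "u \<oplus> v"]) simp_all
    next
      fix c r assume "c \<in> ?f W" and "r \<in> carrier (dg_zero_part A)"
      then obtain u where u: "u \<in> U" "u \<oplus> c \<odot> g \<in> W" and c: "c \<in> dg_grade A 0"
        and r: "r \<in> dg_grade A 0" by auto
      have "r \<odot> u \<oplus> (r \<otimes>\<^bsub>A\<^esub> c) \<odot> g = r \<odot> (u \<oplus> c \<odot> g)"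
        using smult_r_distr[of r u "c \<odot> g"] r U'(1)[OF u(1)] smult_closed'[OF c gc]
          smult_smult[OF r c gc] by simp
      then show "r \<otimes>\<^bsub>dg_zero_part A\<^esub> c \<in> ?f W"
        using W'(4)[OF r u(2)] U'(4)[OF r u(1)] R.m_closed[of r c] c r
        by (intro CollectI conjI bexI[of _ "r \<odot> u"]) simp_all
    qed
  qed
  show ?thesis
    unfolding noetherian_between_def
  proof (rule wf_by_pair[OF A.wf_ideals_containing_coboundaries[OF assms(1)]
        noeth[unfolded noetherian_between_def], where f = ?f and g = ?g])
    fix Y X assume "(Y, X) \<in> {(Y, X). linear_subset A N X \<and> linear_subset A N Y \<and>
      coboundaries N n \<subseteq> X \<and> X \<subset> Y \<and> Y \<subseteq> linear_adjoin A N U g}"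
    then have X: "linear_subset A N X" "coboundaries N n \<subseteq> X"
      and Y: "linear_subset A N Y" "coboundaries N n \<subseteq> Y" "Y \<subseteq> linear_adjoin A N U g"
      and XY: "X \<subset> Y" by auto
    have sub: "?f X \<subseteq> ?f Y" "?g X \<subseteq> ?g Y" using XY by auto
    have "?g X \<noteq> ?g Y" if eq: "?f X = ?f Y"
    proof -
      obtain y where y: "y \<in> Y" "y \<notin> X" using XY by blast
      then obtain u c where uc: "u \<in> U" "c \<in> dg_grade A 0" "y = u \<oplus> c \<odot> g"
        using Y(3) by (auto simp: linear_adjoin_def)
      then have "c \<in> ?f X" using eq y(1) by blast
      then obtain v where v: "v \<in> U" "v \<oplus> c \<odot> g \<in> X" by blast
      have c: "u \<in> carrier N" "v \<in> carrier N" "c \<odot> g \<in> carrier N"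
        using U'(1) uc v smult_closed'[OF _ gc] by auto
      have diff: "(v \<oplus> c \<odot> g) \<oplus> (u \<oplus> \<ominus> v) = y"
        using c uc(3) by (simp add: a_ac r_neg r_neg2)
      have "u \<oplus> \<ominus> v \<in> Y"
        using linear_subset_cancel[OF Y(1), of "v \<oplus> c \<odot> g" "u \<oplus> \<ominus> v"] v(2) XY diff y(1) c by auto
      moreover have "u \<oplus> \<ominus> v \<notin> X" using linear_subsetD(3)[OF X(1) v(2)] diff y(2) by metis
      moreover have "u \<oplus> \<ominus> v \<in> U" using U'(3)[OF uc(1)] linear_subset_uminus[OF U(1) v(1)] by blast
      ultimately show ?thesis by blast
    qed
    then show "(?f Y, ?f X) \<in> {(K, J). ideal J (dg_zero_part A) \<and> ideal K (dg_zero_part A) \<and>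
        coboundaries (dg_self A) 0 \<subseteq> J \<and> J \<subset> K} \<or>
      ?f Y = ?f X \<and> (?g Y, ?g X) \<in> {(Y, X). linear_subset A N X \<and> linear_subset A N Y \<and>
        coboundaries N n \<subseteq> X \<and> X \<subset> Y \<and> Y \<subseteq> U}"
      using f[OF X] f[OF Y(1,2)] g'[OF X] g'[OF Y(1,2)] sub by blast
  qed
qed

definition span_over_coboundaries :: "int \<Rightarrow> 'm list \<Rightarrow> 'm set" where
  "span_over_coboundaries n gs = foldr (\<lambda>g U. linear_adjoin A N U g) gs (coboundaries N n)"

lemma span_over_coboundaries:
  assumes "set gs \<subseteq> cocycles N n"
  shows "linear_subset A N (span_over_coboundaries n gs)"
    and "coboundaries N n \<subseteq> span_over_coboundaries n gs"
    and "set gs \<subseteq> span_over_coboundaries n gs"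
    and "noetherian_ring (H0 A) \<Longrightarrow>
      noetherian_between A N (coboundaries N n) (span_over_coboundaries n gs)"
proof -
  have "linear_subset A N (span_over_coboundaries n gs) \<and>
    coboundaries N n \<subseteq> span_over_coboundaries n gs \<and> set gs \<subseteq> span_over_coboundaries n gs \<and>
    (noetherian_ring (H0 A) \<longrightarrow>
      noetherian_between A N (coboundaries N n) (span_over_coboundaries n gs))"
    using assms
  proof (induction gs)
    case Nil
    have "{(Y, X). linear_subset A N X \<and> linear_subset A N Y \<and>
      coboundaries N n \<subseteq> X \<and> X \<subset> Y \<and> Y \<subseteq> coboundaries N n} = {}" by auto
    then have "noetherian_between A N (coboundaries N n) (coboundaries N n)"
      unfolding noetherian_between_def by (metis wf_on_bot)
    then show ?case using linear_coboundaries by (simp add: span_over_coboundaries_def)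
  next
    case (Cons g gs)
    then have IH: "linear_subset A N (span_over_coboundaries n gs)"
      "coboundaries N n \<subseteq> span_over_coboundaries n gs" "set gs \<subseteq> span_over_coboundaries n gs"
      "noetherian_ring (H0 A) \<longrightarrow>
        noetherian_between A N (coboundaries N n) (span_over_coboundaries n gs)" by simp_all
    have g: "g \<in> cocycles N n" using Cons.prems by simp
    have eq: "span_over_coboundaries n (g # gs) = linear_adjoin A N (span_over_coboundaries n gs) g"
      by (simp add: span_over_coboundaries_def)
    show ?case
      unfolding eq using linear_adjoin[OF IH(1) cocycle_carrier[OF g]] IH
        noetherian_between_adjoin[OF _ IH(1,2) g] by auto
  qed
  then show "linear_subset A N (span_over_coboundaries n gs)"
    "coboundaries N n \<subseteq> span_over_coboundaries n gs" "set gs \<subseteq> span_over_coboundaries n gs"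
    "noetherian_ring (H0 A) \<Longrightarrow>
      noetherian_between A N (coboundaries N n) (span_over_coboundaries n gs)" by auto
qed

lemma noetherian_between_cocycles:
  assumes "noetherian_ring (H0 A)" "set gs \<subseteq> cocycles N n" "cocycles N n \<subseteq> span_over_coboundaries n gs"
  shows "noetherian_between A N (coboundaries N n) (cocycles N n)"
  using span_over_coboundaries(4)[OF assms(2,1)] unfolding noetherian_between_def
  by (rule wf_subset) (use assms(3) in auto)

lemma abelian_monoid_cohomology: "abelian_monoid (cohomology N n)"
  and add_cohomology: "\<lbrakk>x \<in> cocycles N n; y \<in> cocycles N n\<rbrakk> \<Longrightarrow>
    (coboundaries N n +> x) \<oplus>\<^bsub>cohomology N n\<^esub> (coboundaries N n +> y) =
      coboundaries N n +> (x \<oplus> y)"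
proof -
  interpret B: abelian_subgroup "coboundaries N n" N
    by (rule linear_abelian_subgroup[OF linear_coboundaries])
  have add: "(coboundaries N n +> x) \<oplus>\<^bsub>cohomology N n\<^esub> (coboundaries N n +> y) =
    coboundaries N n +> (x \<oplus> y)" if "x \<in> cocycles N n" "y \<in> cocycles N n" for x y
    using B.a_rcos_sum[of x y] cocycle_carrier that by (simp add: cohomology_def)
  then show "\<lbrakk>x \<in> cocycles N n; y \<in> cocycles N n\<rbrakk> \<Longrightarrow>
    (coboundaries N n +> x) \<oplus>\<^bsub>cohomology N n\<^esub> (coboundaries N n +> y) =
      coboundaries N n +> (x \<oplus> y)" .
  note linZ = linear_subsetD[OF linear_cocycles]
  show "abelian_monoid (cohomology N n)"
    by (rule abelian_monoidI)
      (use linZ(2,3) in \<open>auto simp: carrier_cohomology zero_cohomology add cocycle_carrier a_ac\<close>)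
qed

text \<open>Generators are replaced by cocycles and coefficients by lifts to
  \<open>A\<^sup>0\<close>. A sum of classes is then the class of an element of the span, and
  cocycles of equal class differ by a coboundary, which the span contains.\<close>

lemma fin_gen_cohomology_span:
  assumes "fin_gen_module (H0 A) (cohomology N n)"
  shows "\<exists>gs. set gs \<subseteq> cocycles N n \<and> cocycles N n \<subseteq> span_over_coboundaries n gs"
proof -
  interpret A: comm_dg_ring A by (rule comm_dg_ring)
  let ?H = "cohomology N n" and ?B = "coboundaries N n"
  interpret H: abelian_monoid ?H by (rule abelian_monoid_cohomology)
  obtain G where G: "finite G" "G \<subseteq> carrier ?H" and gen: "\<And>x. x \<in> carrier ?H \<Longrightarrow>
    \<exists>c. c \<in> G \<rightarrow> carrier (H0 A) \<and> x = finsum ?H (\<lambda>g. c g \<odot>\<^bsub>?H\<^esub> g) G"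
    using assms unfolding fin_gen_module_def by blast
  have "\<forall>g\<in>G. \<exists>z\<in>cocycles N n. g = ?B +> z" using G(2) by (auto simp: carrier_cohomology)
  then obtain z where z: "\<And>g. g \<in> G \<Longrightarrow> z g \<in> cocycles N n" "\<And>g. g \<in> G \<Longrightarrow> g = ?B +> z g"
    by metis
  obtain gs where gs: "set gs = z ` G" using finite_list[of "z ` G"] G(1) by auto
  have gsZ: "set gs \<subseteq> cocycles N n" using gs z by auto
  let ?U = "span_over_coboundaries n gs"
  note U = linear_subsetD[OF span_over_coboundaries(1)[OF gsZ]] span_over_coboundaries(2,3)[OF gsZ]
  note linZ = linear_subsetD[OF linear_cocycles]
  have smult: "\<exists>u\<in>?U \<inter> cocycles N n. c g \<odot>\<^bsub>?H\<^esub> g = ?B +> u"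
    if c: "c \<in> G \<rightarrow> carrier (H0 A)" and g: "g \<in> G" for c g
  proof -
    have "c g \<in> H0_proj A ` dg_grade A 0" using funcset_mem[OF c g] A.carrier_H0 by simp
    then obtain a where a: "a \<in> dg_grade A 0" "c g = coboundaries (dg_self A) 0 +>\<^bsub>A\<^esub> a"
      unfolding H0_proj_def by blast
    have "c g \<odot>\<^bsub>?H\<^esub> g = ?B +> (a \<odot> z g)"
      using smult_cohomology[OF a(1) z(1)[OF g]] a(2) z(2)[OF g] by simp
    moreover have "z g \<in> ?U" using gs g U(6) by blast
    ultimately show ?thesis using U(4)[OF a(1)] linZ(4)[OF a(1) z(1)[OF g]] by blast
  qed
  have sum: "\<exists>u\<in>?U \<inter> cocycles N n. finsum ?H (\<lambda>g. c g \<odot>\<^bsub>?H\<^esub> g) F = ?B +> u"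
    if c: "c \<in> G \<rightarrow> carrier (H0 A)" and "F \<subseteq> G" for c F
    using finite_subset[OF that(2) G(1)] that(2)
  proof (induction F rule: finite_induct)
    case empty
    show ?case using U(2) linZ(2) zero_cohomology by auto
  next
    case (insert g F)
    obtain u v where u: "u \<in> ?U \<inter> cocycles N n" "finsum ?H (\<lambda>g. c g \<odot>\<^bsub>?H\<^esub> g) F = ?B +> u"
      and v: "v \<in> ?U \<inter> cocycles N n" "c g \<odot>\<^bsub>?H\<^esub> g = ?B +> v"
      using insert smult[OF c, of g] by auto
    have cl: "c h \<odot>\<^bsub>?H\<^esub> h \<in> carrier ?H" if "h \<in> G" for h
      using smult[OF c that] by (auto simp: carrier_cohomology)
    have "finsum ?H (\<lambda>g. c g \<odot>\<^bsub>?H\<^esub> g) (insert g F) = c g \<odot>\<^bsub>?H\<^esub> g \<oplus>\<^bsub>?H\<^esub> finsum ?H (\<lambda>g. c g \<odot>\<^bsub>?H\<^esub> g) F"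
      using insert cl by (intro H.finsum_insert) auto
    also have "\<dots> = ?B +> (v \<oplus> u)" using u v add_cohomology by simp
    finally show ?case using u(1) v(1) U(3)[of v u] linZ(3)[of v n u] by blast
  qed
  have "cocycles N n \<subseteq> ?U"
  proof
    fix x assume x: "x \<in> cocycles N n"
    then have "?B +> x \<in> carrier ?H" by (auto simp: carrier_cohomology)
    then obtain c where c: "c \<in> G \<rightarrow> carrier (H0 A)"
      and eq: "?B +> x = finsum ?H (\<lambda>g. c g \<odot>\<^bsub>?H\<^esub> g) G" using gen by meson
    obtain u where u: "u \<in> ?U" "?B +> x = ?B +> u"
      using sum[OF c subset_refl] unfolding eq by blast
    have c: "x \<in> carrier N" "u \<in> carrier N" using cocycle_carrier[OF x] U(1)[OF u(1)] by auto
    then have "x \<oplus> \<ominus> u \<in> ?U" using coset_eq_iff[OF linear_coboundaries c] u(2) U(5) by blast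
    then show "x \<in> ?U" using U(3)[OF _ u(1)] minus_add_cancel(1)[OF c] by metis
  qed
  then show ?thesis using gsZ by blast
qed

end

text \<open>Finite generation is assumed in negative degrees. In degree zero the class of
  \<open>\<one>\<close> generates, and in positive degrees there are no nonzero elements.\<close>

lemma noetherian_complex_self:
  assumes "noetherian_dg_ring A" shows "noetherian_complex A (dg_self A)"
proof -
  interpret A: comm_dg_ring A using assms by (simp add: noetherian_dg_ring_def)
  interpret S: dg_complex "dg_self A" A by (rule A.dg_complex_self)
  have H: "noetherian_ring (H0 A)" using assms by (simp add: noetherian_dg_ring_def)
  have "\<exists>gs. set gs \<subseteq> cocycles (dg_self A) n \<and>
      cocycles (dg_self A) n \<subseteq> S.span_over_coboundaries n gs" for n
  proof -
    consider "n < 0" | "n = 0" | "n > 0" by linarith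
    then show ?thesis
    proof cases
      case 1
      then show ?thesis
        using assms S.fin_gen_cohomology_span by (simp add: noetherian_dg_ring_def)
    next
      case 2
      have one: "\<one>\<^bsub>A\<^esub> \<in> cocycles (dg_self A) 0"
        using A.one_grade A.diff_degree_zero by (simp add: cocycles_def)
      have "z \<in> S.span_over_coboundaries 0 [\<one>\<^bsub>A\<^esub>]" if "z \<in> cocycles (dg_self A) 0" for z
      proof -
        have "z \<in> dg_grade A 0" using S.cocycleD(1)[OF that] by simp
        moreover have "\<one>\<^bsub>A\<^esub> \<in> S.span_over_coboundaries 0 [\<one>\<^bsub>A\<^esub>]"
          using S.span_over_coboundaries(3)[of "[\<one>\<^bsub>A\<^esub>]" 0] one by simp
        ultimately show ?thesis
          using S.linear_subsetD(4)[OF S.span_over_coboundaries(1)[of "[\<one>\<^bsub>A\<^esub>]" 0]] one A.grade_carrier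
          by fastforce
      qed
      then show ?thesis using 2 one by (intro exI[of _ "[\<one>\<^bsub>A\<^esub>]"]) auto
    next
      case 3
      then have "cocycles (dg_self A) n \<subseteq> {\<zero>\<^bsub>A\<^esub>}" using A.nonpositive by (auto simp: cocycles_def)
      then show ?thesis
        using S.linear_subsetD(2)[OF S.linear_coboundaries, of n]
        by (intro exI[of _ "[]"]) (auto simp: S.span_over_coboundaries_def)
    qed
  qed
  then have "noetherian_between A (dg_self A) (coboundaries (dg_self A) n) (cocycles (dg_self A) n)" for n
    using S.noetherian_between_cocycles[OF H] by meson
  then show ?thesis using A.dg_complex_self by (simp add: noetherian_complex_def)
qed

section \<open>Transfer to the datatype of Koszul elements\<close>

lemma base_module_simps [simp]:
  "Base x \<in> carrier (base_module M) \<longleftrightarrow> x \<in> carrier M"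
  "zero (base_module M) = Base (zero M)"
  "add (base_module M) (Base x) (Base y) = Base (add M x y)"
  "smult (base_module M) a (Base x) = Base (smult M a x)"
  "Base x \<in> mod_grade (base_module M) n \<longleftrightarrow> x \<in> mod_grade M n"
  "mod_diff (base_module M) (Base x) = Base (mod_diff M x)"
  by (auto simp: base_module_def)

lemma base_module_carrier: "carrier (base_module M) = Base ` carrier M"
  and base_module_grade: "mod_grade (base_module M) n = Base ` mod_grade M n"
  by (simp_all add: base_module_def)

lemma base_module_coboundaries: "coboundaries (base_module M) n = Base ` coboundaries M n"
  by (auto simp: coboundaries_def base_module_grade image_image)

lemma base_module_cocycles: "cocycles (base_module M) n = Base ` cocycles M n"
  by (auto simp: cocycles_def base_module_grade)

lemma exact_at_base_module: "exact_at (base_module M) n \<longleftrightarrow> exact_at M n"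
  by (auto simp: exact_at_def base_module_cocycles base_module_coboundaries)

lemma dg_complex_base_module:
  assumes "dg_complex M A" shows "dg_complex (base_module M) A"
proof -
  interpret M: dg_complex M A by fact
  have ab: "abelian_group (base_module M)"
  proof (rule abelian_groupI)
    fix x assume "x \<in> carrier (base_module M)"
    then obtain u where "x = Base u" "u \<in> carrier M" by (auto simp: base_module_carrier)
    then show "\<exists>y\<in>carrier (base_module M). y \<oplus>\<^bsub>base_module M\<^esub> x = \<zero>\<^bsub>base_module M\<^esub>"
      by (auto simp: M.l_neg intro!: bexI[of _ "Base (\<ominus>\<^bsub>M\<^esub> u)"])
  qed (auto simp: base_module_carrier M.a_ac)
  interpret B: abelian_group "base_module M" by (rule ab)
  have uminus: "\<ominus>\<^bsub>base_module M\<^esub> Base x = Base (\<ominus>\<^bsub>M\<^esub> x)" if "x \<in> carrier M" for x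
    using that by (intro B.minus_equality) (auto simp: M.l_neg)
  have "module (dg_zero_part A) (base_module M)"
    by (rule moduleI[OF M.R.is_cring ab])
      (auto simp: base_module_carrier M.smult_closed' M.smult_l_distr[simplified]
        M.smult_r_distr[simplified] M.smult_assoc1[simplified] M.smult_one[simplified])
  then show ?thesis
  proof (rule dg_complex.intro, intro dg_complex_axioms.intro)
    show "comm_dg_ring A" by (rule M.comm_dg_ring)
    fix n
    show "additive_subgroup (mod_grade (base_module M) n) (base_module M)"
    proof (rule additive_subgroupI, rule B.add.subgroupI)
      show "mod_grade (base_module M) n \<noteq> {}" using M.grade_zero[of n] by (auto simp: base_module_grade)
    qed (auto simp: base_module_grade M.grade_carrier M.grade_add M.grade_uminus uminus)
    fix c assume "c \<in> coboundaries (dg_self A) 0"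
    then obtain h where h: "null_homotopy A M c h" using M.coboundary_null by blast
    have "null_homotopy A (base_module M) c (\<lambda>u. Base (h (kos_base u)))"
      using h by (simp add: null_homotopy_def base_module_grade)
    then show "\<exists>h. null_homotopy A (base_module M) c h" by blast
  qed (auto simp: base_module_grade M.smult_grade M.mod_diff_grade M.mod_diff_add M.mod_diff_smult
      M.mod_diff_diff)
qed

lemma noetherian_complex_base_module:
  assumes "noetherian_complex A M" shows "noetherian_complex A (base_module M)"
  unfolding noetherian_complex_def
proof (intro conjI allI)
  show "dg_complex (base_module M) A"
    using assms by (simp add: noetherian_complex_def dg_complex_base_module)
  fix n
  have lin: "linear_subset A M (Base -` W)" if W: "linear_subset A (base_module M) W" for W
  proof -
    have "W \<subseteq> Base ` carrier M" "Base \<zero>\<^bsub>M\<^esub> \<in> W"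
      using W by (auto simp: linear_subset_def base_module_carrier)
    moreover have "Base (x \<oplus>\<^bsub>M\<^esub> y) \<in> W" if "Base x \<in> W" "Base y \<in> W" for x y
      using W that base_module_simps(3)[of M x y] unfolding linear_subset_def by metis
    moreover have "Base (a \<odot>\<^bsub>M\<^esub> x) \<in> W" if "a \<in> dg_grade A 0" "Base x \<in> W" for a x
      using W that base_module_simps(4)[of M a x] unfolding linear_subset_def by metis
    ultimately show ?thesis unfolding linear_subset_def by auto
  qed
  have "wf {(Y, X). linear_subset A M X \<and> linear_subset A M Y \<and>
      coboundaries M n \<subseteq> X \<and> X \<subset> Y \<and> Y \<subseteq> cocycles M n}" (is "wf ?r")
    using assms by (simp add: noetherian_complex_def noetherian_between_def)
  then have wf: "wf ?r" .
  have *: "(Base -` Y, Base -` X) \<in> ?r"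
    if XY: "linear_subset A (base_module M) X" "linear_subset A (base_module M) Y"
      "coboundaries (base_module M) n \<subseteq> X" "X \<subset> Y" "Y \<subseteq> cocycles (base_module M) n" for X Y
  proof -
    have "Y \<subseteq> range Base" using XY(5) by (auto simp: base_module_cocycles)
    moreover obtain y where y: "y \<in> Y" "y \<notin> X" using XY(4) by blast
    ultimately obtain x where "y = Base x" by blast
    then have "Base -` X \<subset> Base -` Y" using XY(4) y by auto
    then show ?thesis
      using lin XY by (auto simp: base_module_cocycles base_module_coboundaries)
  qed
  show "noetherian_between A (base_module M) (coboundaries (base_module M) n)
      (cocycles (base_module M) n)"
    unfolding noetherian_between_def
    by (rule wf_by_map[OF wf, where f = "vimage Base"], rule *)
      (simp_all only: mem_Collect_eq case_prod_conv)
qed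

section \<open>Noetherian local DG-rings\<close>

lemma dg_inf_eq:
  assumes "dg_complex N A" "\<not> exact_at N i" "exact_below N i"
  shows "dg_inf N = i"
proof -
  interpret dg_complex N A by fact
  have "Inf {n. \<not> exact_at N n} = i"
    by (rule cInf_eq_minimum) (use assms(2,3) in \<open>auto simp: exact_below_def not_less[symmetric]\<close>)
  then show ?thesis by (simp add: dg_inf_def cohomology_vanishes_iff)
qed

text \<open>Knowing the infimum removes \<open>dg_inf\<close>, and by additivity injectivity on
  classes becomes a condition on the kernel. It is phrased with the same lift that the Koszul
  construction uses.\<close>

lemma regular_element_iff:
  assumes N: "dg_complex N A" "\<not> exact_at N i" "exact_below N i" and m: "m \<subseteq> carrier (H0 A)"
  shows "regular_element A m N x \<longleftrightarrow> x \<in> m \<and>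
    (\<forall>z\<in>cocycles N i. H0_lift x \<odot>\<^bsub>N\<^esub> z \<in> coboundaries N i \<longrightarrow> z \<in> coboundaries N i)"
proof (cases "x \<in> m")
  case True
  interpret dg_complex N A by fact
  interpret A: comm_dg_ring A by (rule comm_dg_ring)
  let ?a = "H0_lift x" and ?B = "coboundaries N i"
  have a: "?a \<in> dg_grade A 0" "x = coboundaries (dg_self A) 0 +>\<^bsub>A\<^esub> ?a"
    using A.H0_lift[of x] True m by (auto simp: H0_proj_def)
  have smult: "x \<odot>\<^bsub>cohomology N i\<^esub> (?B +>\<^bsub>N\<^esub> z) = ?B +>\<^bsub>N\<^esub> (?a \<odot>\<^bsub>N\<^esub> z)" if "z \<in> cocycles N i" for z
    using smult_cohomology[OF a(1) that] a(2) by simp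
  note linZ = linear_subsetD[OF linear_cocycles]
  have "inj_on (\<lambda>y. x \<odot>\<^bsub>cohomology N i\<^esub> y) (carrier (cohomology N i)) \<longleftrightarrow>
    (\<forall>z\<in>cocycles N i. \<forall>w\<in>cocycles N i. ?B +>\<^bsub>N\<^esub> (?a \<odot>\<^bsub>N\<^esub> z) = ?B +>\<^bsub>N\<^esub> (?a \<odot>\<^bsub>N\<^esub> w) \<longrightarrow>
      ?B +>\<^bsub>N\<^esub> z = ?B +>\<^bsub>N\<^esub> w)"
    unfolding inj_on_def carrier_cohomology by (simp add: smult)
  also have "\<dots> \<longleftrightarrow> (\<forall>z\<in>cocycles N i. \<forall>w\<in>cocycles N i.
      ?a \<odot>\<^bsub>N\<^esub> (z \<oplus>\<^bsub>N\<^esub> \<ominus>\<^bsub>N\<^esub> w) \<in> ?B \<longrightarrow> z \<oplus>\<^bsub>N\<^esub> \<ominus>\<^bsub>N\<^esub> w \<in> ?B)"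
  proof -
    have "?a \<odot>\<^bsub>N\<^esub> (z \<oplus>\<^bsub>N\<^esub> \<ominus>\<^bsub>N\<^esub> w) = ?a \<odot>\<^bsub>N\<^esub> z \<oplus>\<^bsub>N\<^esub> \<ominus>\<^bsub>N\<^esub> (?a \<odot>\<^bsub>N\<^esub> w)"
      if "z \<in> carrier N" "w \<in> carrier N" for z w
      using smult_r_distr[of ?a z "\<ominus>\<^bsub>N\<^esub> w"] a(1) that smult_uminus[OF a(1)] by simp
    then show ?thesis
      using coset_eq_iff[OF linear_coboundaries[of i]] cocycle_carrier[of _ i] smult_closed'[OF a(1)]
      by simp
  qed
  also have "\<dots> \<longleftrightarrow> (\<forall>z\<in>cocycles N i. ?a \<odot>\<^bsub>N\<^esub> z \<in> ?B \<longrightarrow> z \<in> ?B)"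
  proof (intro iffI ballI impI)
    fix z assume *: "\<forall>z\<in>cocycles N i. \<forall>w\<in>cocycles N i.
      ?a \<odot>\<^bsub>N\<^esub> (z \<oplus>\<^bsub>N\<^esub> \<ominus>\<^bsub>N\<^esub> w) \<in> ?B \<longrightarrow> z \<oplus>\<^bsub>N\<^esub> \<ominus>\<^bsub>N\<^esub> w \<in> ?B"
      and z: "z \<in> cocycles N i" "?a \<odot>\<^bsub>N\<^esub> z \<in> ?B"
    have "z \<oplus>\<^bsub>N\<^esub> \<ominus>\<^bsub>N\<^esub> \<zero>\<^bsub>N\<^esub> = z" using cocycle_carrier[OF z(1)] uminus_zero by simp
    then show "z \<in> ?B" using * z linZ(2) by metis
  next
    fix z w assume *: "\<forall>z\<in>cocycles N i. ?a \<odot>\<^bsub>N\<^esub> z \<in> ?B \<longrightarrow> z \<in> ?B"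
      and "z \<in> cocycles N i" "w \<in> cocycles N i" "?a \<odot>\<^bsub>N\<^esub> (z \<oplus>\<^bsub>N\<^esub> \<ominus>\<^bsub>N\<^esub> w) \<in> ?B"
    then show "z \<oplus>\<^bsub>N\<^esub> \<ominus>\<^bsub>N\<^esub> w \<in> ?B"
      using linZ(3) linear_subset_uminus[OF linear_cocycles] by blast
  qed
  finally show ?thesis using True by (simp add: regular_element_def dg_inf_eq[OF N])
qed (simp add: regular_element_def)

section \<open>Regular sequences over a noetherian local DG-ring\<close>

locale noetherian_local_dg =
  fixes A :: "'a dg_ring" and m :: "'a set set"
  assumes noetherian_local: "noetherian_local_dg_ring A m" and bounded: "bounded_cohomology A"
begin

lemma noetherian_dg: "noetherian_dg_ring A" and local_H0: "local_ring (H0 A) m"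
  using noetherian_local by (simp_all add: noetherian_local_dg_ring_def)

sublocale comm_dg_ring A
  using noetherian_dg by (simp add: noetherian_dg_ring_def)

sublocale H: noetherian_cring "H0 A"
  using noetherian_dg cring_H0 by (simp add: noetherian_dg_ring_def noetherian_cring_def)

sublocale m: primeideal m "H0 A"
  using H.local_ring_prime[OF local_H0] .

lemma H0_lift_radical:
  assumes "x \<in> m" shows "radical_element A (H0_lift x)"
  using radical_elementI[OF H.noetherian_ring_axioms local_H0] H0_lift[OF m.Icarr[OF assms]] assms
  by simp

text \<open>The local ring \<open>H0 A\<close> is nonzero, so there is cohomology in degree zero,
  and boundedness makes a least such degree exist. This is what gives \<open>dg_inf\<close> a
  meaning.\<close>

lemma ex_inf: "\<exists>i. \<not> exact_at (dg_self A) i \<and> exact_below (dg_self A) i"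
proof -
  interpret S: dg_complex "dg_self A" A by (rule dg_complex_self)
  interpret p: ring_hom_ring "dg_zero_part A" "H0 A" "H0_proj A" by (rule H0_proj_hom)
  obtain k where k: "\<And>n. n < k \<Longrightarrow> exact_at (dg_self A) n"
    using bounded S.cohomology_vanishes_iff by (auto simp: bounded_cohomology_def)
  have ne: "\<not> exact_at (dg_self A) 0"
  proof
    assume "exact_at (dg_self A) 0"
    moreover have "\<one>\<^bsub>A\<^esub> \<in> cocycles (dg_self A) 0"
      using one_grade diff_degree_zero by (simp add: cocycles_def)
    ultimately have "\<one>\<^bsub>A\<^esub> \<in> coboundaries (dg_self A) 0" by (auto simp: exact_at_def)
    moreover have "\<zero>\<^bsub>A\<^esub> \<in> dg_grade A 0"
      using additive_subgroup.zero_closed[OF grade_subgroup] .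
    moreover have "\<one>\<^bsub>A\<^esub> \<oplus>\<^bsub>A\<^esub> \<ominus>\<^bsub>dg_zero_part A\<^esub> \<zero>\<^bsub>A\<^esub> = \<one>\<^bsub>A\<^esub>"
      using S.R.minus_zero one_grade grade_carrier by simp
    ultimately have "H0_proj A \<one>\<^bsub>A\<^esub> = H0_proj A \<zero>\<^bsub>A\<^esub>" using H0_proj_eq_iff[OF one_grade] by simp
    then have "\<one>\<^bsub>H0 A\<^esub> = \<zero>\<^bsub>H0 A\<^esub>" using p.hom_one p.hom_zero by simp
    then show False using m.one_not_mem m.zero_closed by simp
  qed
  \<comment> \<open>Degrees are integers, so the least one is found as a natural offset from the
    bound \<open>k\<close>.\<close>
  define j where "j = (LEAST j::nat. \<not> exact_at (dg_self A) (k + int j))"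
  have "\<not> 0 < k" using k ne by blast
  then have "\<not> exact_at (dg_self A) (k + int (nat (- k)))" using ne by simp
  then have "\<not> exact_at (dg_self A) (k + int j)" unfolding j_def by (rule LeastI)
  moreover have "exact_at (dg_self A) n" if "n < k + int j" for n
  proof (cases "n < k")
    case False
    then have "n = k + int (nat (n - k))" "nat (n - k) < j" using that by auto
    then show ?thesis using not_less_Least unfolding j_def by metis
  qed (use k in blast)
  ultimately show ?thesis by (auto simp: exact_below_def)
qed

text \<open>Regularity keeps the infimum from falling and Nakayama's lemma keeps it from rising.
  Every Koszul complex along the sequence thus has infimum \<open>i\<close>, and the recursive
  condition can be read in this fixed degree.\<close>

lemma kos_regular_seq_iff:
  assumes "noetherian_complex A N" "\<not> exact_at N i" "exact_below N i"
  shows "kos_regular_seq A m N xs \<longleftrightarrow> set xs \<subseteq> m \<and> regular_in_degree A N i (map H0_lift xs)"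
  using assms
proof (induction xs arbitrary: N)
  case (Cons x xs)
  have mc: "m \<subseteq> carrier (H0 A)" using m.Icarr by blast
  have N: "dg_complex N A" using Cons.prems(1) by (simp add: noetherian_complex_def)
  let ?a = "H0_lift x"
  have reg: "regular_element A m N x \<longleftrightarrow> x \<in> m \<and> regular_in_degree A N i [?a]"
    using regular_element_iff[OF N Cons.prems(2,3) mc] by simp
  show ?case
  proof (cases "regular_element A m N x")
    case True
    then have x: "x \<in> m" "regular_in_degree A N i [?a]" using reg by auto
    have a: "?a \<in> dg_grade A 0" "radical_element A ?a"
      using H0_lift_radical[OF x(1)] by (auto simp: radical_element_def)
    have "exact_below (koszul A N ?a) i"
      using exact_below_regular_sequence[OF N _ Cons.prems(3) x(2)] a(1) by simp
    moreover have "\<not> exact_at (koszul A N ?a) i"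
      using koszul_exact_imp_exact[OF N a(1) _ a(2)] Cons.prems(1,2)
      by (auto simp: noetherian_complex_def)
    ultimately show ?thesis
      using Cons.IH[OF noetherian_complex_koszul[OF Cons.prems(1) a(1)]] True x by simp
  next
    case False
    then show ?thesis using reg by auto
  qed
qed simp

lemma regular_seq_parameters:
  assumes ys: "dg_regular_seq A m (dg_self A) ys" and xs: "set xs \<subseteq> m"
    and pow: "\<And>y. y \<in> m \<Longrightarrow> \<exists>k::nat. y [^]\<^bsub>H0 A\<^esub> k \<in> Idl\<^bsub>H0 A\<^esub> (set xs)"
  shows "length ys \<le> length xs"
    and "length xs \<le> length ys \<Longrightarrow> dg_regular_seq A m (dg_self A) xs"
proof -
  interpret p: ring_hom_ring "dg_zero_part A" "H0 A" "H0_proj A" by (rule H0_proj_hom)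
  let ?N = "base_module (dg_self A)" and ?xs = "map H0_lift xs" and ?ys = "map H0_lift ys"
  have N: "noetherian_complex A ?N"
    using noetherian_complex_base_module[OF noetherian_complex_self[OF noetherian_dg]] .
  then have N': "dg_complex ?N A" by (simp add: noetherian_complex_def)
  obtain i where i: "\<not> exact_at ?N i" "exact_below ?N i"
    using ex_inf by (auto simp: exact_below_def exact_at_base_module)
  have reg: "dg_regular_seq A m (dg_self A) zs \<longleftrightarrow>
    set zs \<subseteq> m \<and> regular_in_degree A ?N i (map H0_lift zs)" for zs
    unfolding dg_regular_seq_def by (rule kos_regular_seq_iff[OF N i])
  have rad: "\<forall>x\<in>set ?xs. radical_element A x" using H0_lift_radical xs by auto
  then have xs0: "set ?xs \<subseteq> dg_grade A 0" by (auto simp: radical_element_def)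
  let ?J = "locally_nilpotent A (koszul_iter A ?N ?xs)"
  note K = dg_complex_koszul_iter[OF N' xs0]
  note J = locally_nilpotent_ideal[OF K]
  \<comment> \<open>The lifts of \<open>xs\<close> act locally nilpotently on their own Koszul
    complex. Every element of \<open>m\<close> has a power in the ideal generated by
    \<open>xs\<close>, so the lifts of \<open>ys\<close> lie in the same radical ideal.\<close>
  have nil: "set ?ys \<subseteq> ?J"
  proof
    fix b assume "b \<in> set ?ys"
    then obtain y where y: "y \<in> m" "b = H0_lift y" using ys reg by auto
    have b: "b \<in> dg_grade A 0" "H0_proj A b = y" using H0_lift[OF m.Icarr[OF y(1)]] y(2) by auto
    obtain k :: nat where "y [^]\<^bsub>H0 A\<^esub> k \<in> Idl\<^bsub>H0 A\<^esub> (set xs)" using pow[OF y(1)] by blast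
    moreover have "H0_proj A ` set ?xs = set xs"
    proof -
      have "H0_proj A (H0_lift x) = x" if "x \<in> set xs" for x
        using H0_lift(2)[OF m.Icarr] xs that by blast
      then have "(\<lambda>x. H0_proj A (H0_lift x)) ` set xs = set xs" by simp
      then show ?thesis by (simp add: image_image)
    qed
    ultimately have "H0_proj A (b [^]\<^bsub>dg_zero_part A\<^esub> k) \<in> Idl\<^bsub>H0 A\<^esub> (H0_proj A ` set ?xs)"
      using p.hom_nat_pow[of b k] b by (simp del: set_map)
    moreover have "set ?xs \<subseteq> ?J" using locally_nilpotent_koszul_iter[OF N' xs0] by blast
    moreover have "b [^]\<^bsub>dg_zero_part A\<^esub> k \<in> dg_grade A 0" using p.R.nat_pow_closed[of b k] b by simp
    ultimately have "b [^]\<^bsub>dg_zero_part A\<^esub> k \<in> ?J" using mem_if_H0_proj_mem_Idl[OF J(1,2)] by blast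
    then show "b \<in> ?J" using J(3)[OF b(1)] by blast
  qed
  have ys': "regular_in_degree A ?N i ?ys" using ys reg by blast
  note main = regular_sequence_parameters[OF N i(2,1) ys' rad nil]
  show "length ys \<le> length xs" using main(1) by simp
  show "dg_regular_seq A m (dg_self A) xs" if "length xs \<le> length ys"
    using main(2) that reg xs by simp
qed

theorem sequence_regular_iff:
  "(\<exists>xs. dg_regular_seq A m (dg_self A) xs \<and> m = Idl\<^bsub>H0 A\<^esub> (set xs)) \<longleftrightarrow>
    Sup {enat (length xs) | xs. dg_regular_seq A m (dg_self A) xs} = krull_dim (H0 A) \<and>
    regular_local_ring (H0 A)"
proof (intro iffI)
  assume "\<exists>xs. dg_regular_seq A m (dg_self A) xs \<and> m = Idl\<^bsub>H0 A\<^esub> (set xs)"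
  then obtain xs where xs: "dg_regular_seq A m (dg_self A) xs" "m = Idl\<^bsub>H0 A\<^esub> (set xs)" by blast
  have xsm: "set xs \<subseteq> m"
  proof -
    have "set zs \<subseteq> m" if "kos_regular_seq A m N zs" for zs and N :: "('a, 'a kos) dg_module"
      using that by (induction zs arbitrary: N) (auto simp: regular_element_def)
    then show ?thesis using xs(1) unfolding dg_regular_seq_def by blast
  qed
  then have xsc: "set xs \<subseteq> carrier (H0 A)" using m.Icarr by blast
  \<comment> \<open>The bound uses the set of entries, since the sequence is not yet known to be
    free of repetitions. It also makes the dimension finite, as a system of parameters
    requires.\<close>
  have dim_le: "krull_dim (H0 A) \<le> enat (card (set xs))"
    using H.krull_dim_le_card[OF local_H0 _ xsc xs(2)] by simp
  then obtain d where d: "krull_dim (H0 A) = enat d" by (cases "krull_dim (H0 A)") auto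
  obtain ps where ps: "length ps = d" "set ps \<subseteq> m"
    "\<forall>y\<in>m. \<exists>k::nat. y [^]\<^bsub>H0 A\<^esub> k \<in> Idl\<^bsub>H0 A\<^esub> (set ps)"
    using H.system_of_parameters[OF local_H0 d] by blast
  have len: "length zs \<le> d" if "dg_regular_seq A m (dg_self A) zs" for zs
    using regular_seq_parameters(1)[OF that ps(2)] ps(1,3) by blast
  \<comment> \<open>Dimension \<le> number of distinct entries \<le> length \<le> dimension.\<close>
  have eq: "length xs = d" "card (set xs) = d"
    using len[OF xs(1)] dim_le d card_length[of xs] by auto
  have "Sup {enat (length xs) | xs. dg_regular_seq A m (dg_self A) xs} = enat d"
  proof (rule antisym)
    show "Sup {enat (length xs) | xs. dg_regular_seq A m (dg_self A) xs} \<le> enat d"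
      by (rule Sup_least) (use len in auto)
    show "enat d \<le> Sup {enat (length xs) | xs. dg_regular_seq A m (dg_self A) xs}"
      by (rule Sup_upper) (use xs(1) eq(1) in auto)
  qed
  moreover have "regular_local_ring (H0 A)"
    unfolding regular_local_ring_def using H.noetherian_ring_axioms local_H0 xs(2) xsc d eq(2)
    by (intro conjI exI[of _ m] exI[of _ "set xs"]) auto
  ultimately show "Sup {enat (length xs) | xs. dg_regular_seq A m (dg_self A) xs} = krull_dim (H0 A) \<and>
    regular_local_ring (H0 A)" using d by simp
next
  assume *: "Sup {enat (length xs) | xs. dg_regular_seq A m (dg_self A) xs} = krull_dim (H0 A) \<and>
    regular_local_ring (H0 A)"
  then obtain m' G where "local_ring (H0 A) m'" and G: "finite G" "G \<subseteq> carrier (H0 A)"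
    "m' = Idl\<^bsub>H0 A\<^esub> G" "enat (card G) = krull_dim (H0 A)"
    unfolding regular_local_ring_def by blast
  then have mG: "m = Idl\<^bsub>H0 A\<^esub> G" using local_H0 by (auto simp: local_ring_def)
  obtain xs where xs: "set xs = G" "length xs = card G"
    using finite_distinct_list[OF G(1)] distinct_card by metis
  have Gm: "G \<subseteq> m" using H.genideal_self[OF G(2)] mG by simp
  \<comment> \<open>A supremum of lengths equal to the finite value \<open>card G\<close> is
    attained; the empty sequence settles the case \<open>card G = 0\<close>.\<close>
  have "\<exists>ys. dg_regular_seq A m (dg_self A) ys \<and> card G \<le> length ys"
  proof (rule ccontr)
    assume neg: "\<not> ?thesis"
    have "dg_regular_seq A m (dg_self A) []" by (simp add: dg_regular_seq_def)
    then have "0 < card G" using neg by auto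
    have "enat (length zs) \<le> enat (card G - 1)" if "dg_regular_seq A m (dg_self A) zs" for zs
      using neg that by fastforce
    then have "Sup {enat (length xs) | xs. dg_regular_seq A m (dg_self A) xs} \<le> enat (card G - 1)"
      by (intro Sup_least) auto
    then have "card G \<le> card G - 1" using * G(4) by (metis enat_ord_simps(1))
    then show False using \<open>0 < card G\<close> by simp
  qed
  then obtain ys where ys: "dg_regular_seq A m (dg_self A) ys" "card G \<le> length ys" by blast
  have "\<exists>k::nat. y [^]\<^bsub>H0 A\<^esub> k \<in> Idl\<^bsub>H0 A\<^esub> (set xs)" if "y \<in> m" for y
    using that mG xs(1) m.Icarr[OF that] H.nat_pow_eone[of y] by (intro exI[of _ 1]) simp
  then have "dg_regular_seq A m (dg_self A) xs"
    using regular_seq_parameters(2)[OF ys(1), of xs] xs ys(2) Gm by simp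
  then show "\<exists>xs. dg_regular_seq A m (dg_self A) xs \<and> m = Idl\<^bsub>H0 A\<^esub> (set xs)"
    using mG xs(1) by blast
qed

end

section \<open>Localization\<close>

lemma ring_iso_inverseE:
  assumes "ring R" "ring S" "h \<in> ring_iso R S"
  obtains g where "g \<in> ring_iso S R" "\<And>r. r \<in> carrier R \<Longrightarrow> g (h r) = r"
    "\<And>s. s \<in> carrier S \<Longrightarrow> h (g s) = s"
proof
  have bij: "bij_betw h (carrier R) (carrier S)" using assms(3) by (simp add: ring_iso_def)
  show "inv_into (carrier R) h \<in> ring_iso S R" by (rule ring_iso_set_sym[OF assms(1,3)])
  show "inv_into (carrier R) h (h r) = r" if "r \<in> carrier R" for r
    using bij that by (simp add: bij_betw_def)
  show "h (inv_into (carrier R) h s) = s" if "s \<in> carrier S" for s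
    using bij that by (metis bij_betw_def f_inv_into_f)
qed

lemma ring_iso_maximalideal:
  assumes R: "ring R" and S: "ring S" and h: "h \<in> ring_iso R S" and J: "maximalideal J S"
  shows "maximalideal {r \<in> carrier R. h r \<in> J} R"
proof -
  obtain g where g: "g \<in> ring_iso S R" "\<And>r. r \<in> carrier R \<Longrightarrow> g (h r) = r"
    "\<And>s. s \<in> carrier S \<Longrightarrow> h (g s) = s" using ring_iso_inverseE[OF R S h] by blast
  interpret h: ring_hom_ring R S h
    using R S h by (simp add: ring_iso_def ring_hom_ringI2)
  interpret g: ring_hom_ring S R g
    using R S g(1) by (simp add: ring_iso_def ring_hom_ringI2)
  interpret J: maximalideal J S by fact
  show ?thesis
  proof (rule maximalidealI[OF h.ideal_vimage[OF J.is_ideal]])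
    show "carrier R \<noteq> {r \<in> carrier R. h r \<in> J}"
    proof
      assume *: "carrier R = {r \<in> carrier R. h r \<in> J}"
      have "s \<in> J" if "s \<in> carrier S" for s
      proof -
        have "g s \<in> {r \<in> carrier R. h r \<in> J}" using * g.hom_closed[OF that] by blast
        then show ?thesis using g(3)[OF that] by simp
      qed
      then show False using J.I_notcarr J.a_subset by blast
    qed
    fix I assume I: "ideal I R" "{r \<in> carrier R. h r \<in> J} \<subseteq> I" "I \<subseteq> carrier R"
    let ?K = "{s \<in> carrier S. g s \<in> I}"
    have "J \<subseteq> ?K" using I(2) J.a_subset g(3) g.hom_closed by force
    then have "?K = J \<or> ?K = carrier S" using J.I_maximal[OF g.ideal_vimage[OF I(1)]] by blast
    then show "I = {r \<in> carrier R. h r \<in> J} \<or> I = carrier R"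
    proof
      assume K: "?K = J"
      have "h r \<in> J" if "r \<in> I" for r
      proof -
        have "h r \<in> ?K" using that I(3) g(2) h.hom_closed by auto
        then show ?thesis using K by simp
      qed
      then show ?thesis using I by blast
    next
      assume K: "?K = carrier S"
      have "r \<in> I" if "r \<in> carrier R" for r
      proof -
        have "h r \<in> ?K" unfolding K using h.hom_closed[OF that] .
        then show ?thesis using g(2)[OF that] by simp
      qed
      then show ?thesis using I(3) by blast
    qed
  qed
qed

lemma ring_iso_genideal:
  assumes R: "ring R" and S: "ring S" and h: "h \<in> ring_iso R S" and J: "ideal J S"
    and G: "G \<subseteq> carrier R" "{r \<in> carrier R. h r \<in> J} = Idl\<^bsub>R\<^esub> G"
  shows "J = Idl\<^bsub>S\<^esub> (h ` G)"
proof
  obtain g where g: "g \<in> ring_iso S R" "\<And>r. r \<in> carrier R \<Longrightarrow> g (h r) = r"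
    "\<And>s. s \<in> carrier S \<Longrightarrow> h (g s) = s" using ring_iso_inverseE[OF R S h] by blast
  interpret h: ring_hom_ring R S h
    using R S h by (simp add: ring_iso_def ring_hom_ringI2)
  interpret g: ring_hom_ring S R g
    using R S g(1) by (simp add: ring_iso_def ring_hom_ringI2)
  interpret J: ideal J S by fact
  have hG: "h ` G \<subseteq> carrier S" using G(1) by auto
  have "G \<subseteq> {r \<in> carrier R. h r \<in> J}" unfolding G(2) by (rule h.R.genideal_self[OF G(1)])
  then show "Idl\<^bsub>S\<^esub> (h ` G) \<subseteq> J" by (intro h.S.genideal_minimal[OF J]) auto
  have "Idl\<^bsub>R\<^esub> G \<subseteq> {r \<in> carrier R. h r \<in> Idl\<^bsub>S\<^esub> (h ` G)}"
    using G(1) h.S.genideal_self[OF hG]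
    by (intro h.R.genideal_minimal h.ideal_vimage h.S.genideal_ideal[OF hG]) auto
  moreover have "g s \<in> {r \<in> carrier R. h r \<in> J}" if "s \<in> J" for s
    using that g(3)[OF J.Icarr[OF that]] g.hom_closed[OF J.Icarr[OF that]] by simp
  ultimately have "h (g s) \<in> Idl\<^bsub>S\<^esub> (h ` G)" if "s \<in> J" for s using that unfolding G(2) by blast
  then show "J \<subseteq> Idl\<^bsub>S\<^esub> (h ` G)" using g(3)[OF J.Icarr] by fastforce
qed

text \<open>Chains of primes are pulled back along \<open>h\<close>; surjectivity keeps the
  inclusions strict.\<close>

lemma ring_iso_krull_dim_le:
  assumes R: "cring R" and S: "cring S" and h: "h \<in> ring_iso R S"
  shows "krull_dim S \<le> krull_dim R"
  unfolding krull_dim_def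
proof (rule Sup_subset_mono, clarify)
  interpret R: cring R by fact
  interpret S: cring S by fact
  interpret h: ring_hom_ring R S h
    using R.ring_axioms S.ring_axioms h by (simp add: ring_iso_def ring_hom_ringI2)
  have "carrier S = h ` carrier R" using h by (simp add: ring_iso_def bij_betw_def)
  then have surj: "\<exists>r\<in>carrier R. h r = s" if "s \<in> carrier S" for s
    using that by (metis imageE)
  fix n P assume P: "prime_chain S n P"
  let ?P = "\<lambda>i. {r \<in> carrier R. h r \<in> P i}"
  have "?P i \<subset> ?P (Suc i)" if i: "i < n" for i
  proof -
    have "P i \<subset> P (Suc i)" using P i by (simp add: prime_chain_def)
    then obtain s where "s \<in> P (Suc i)" "s \<notin> P i" by blast
    moreover have "ideal (P (Suc i)) S" using P i by (auto simp: prime_chain_def primeideal_def)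
    ultimately obtain r where "r \<in> ?P (Suc i)" "r \<notin> ?P i" using surj[of s] ideal.Icarr by fastforce
    moreover have "?P i \<subseteq> ?P (Suc i)" using P i by (auto simp: prime_chain_def)
    ultimately show ?thesis by blast
  qed
  then have "prime_chain R n ?P"
    using P h.primeideal_vimage[OF R] by (simp add: prime_chain_def)
  then show "\<exists>n'. enat n = enat n' \<and> (\<exists>P. prime_chain R n' P)" by blast
qed

lemma regular_local_ring_iso:
  assumes R: "cring R" and S: "cring S" and h: "h \<in> ring_iso R S" and reg: "regular_local_ring R"
  shows "regular_local_ring S"
proof -
  interpret R: cring R by fact
  interpret S: cring S by fact
  obtain g where g: "g \<in> ring_iso S R" "\<And>r. r \<in> carrier R \<Longrightarrow> g (h r) = r"
    "\<And>s. s \<in> carrier S \<Longrightarrow> h (g s) = s"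
    using ring_iso_inverseE[OF R.ring_axioms S.ring_axioms h] by blast
  interpret h: ring_hom_ring R S h
    using R.ring_axioms S.ring_axioms h by (simp add: ring_iso_def ring_hom_ringI2)
  interpret g: ring_hom_ring S R g
    using R.ring_axioms S.ring_axioms g(1) by (simp add: ring_iso_def ring_hom_ringI2)
  interpret noeth: noetherian_ring R using reg by (simp add: regular_local_ring_def)
  note gen = ring_iso_genideal[OF R.ring_axioms S.ring_axioms h]
  obtain m G where m: "local_ring R m" and G: "finite G" "G \<subseteq> carrier R" "m = Idl\<^bsub>R\<^esub> G"
    "enat (card G) = krull_dim R" using reg unfolding regular_local_ring_def by blast
  have mc: "m \<subseteq> carrier R"
    using m by (auto simp: local_ring_def dest: maximalideal.axioms(1) ideal.Icarr)
  let ?n = "{s \<in> carrier S. g s \<in> m}"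
  have n: "maximalideal ?n S"
    using ring_iso_maximalideal[OF S.ring_axioms R.ring_axioms g(1)] m by (simp add: local_ring_def)
  have "J = ?n" if J: "maximalideal J S" for J
  proof -
    have "{r \<in> carrier R. h r \<in> J} = m"
      using ring_iso_maximalideal[OF R.ring_axioms S.ring_axioms h J] m by (simp add: local_ring_def)
    moreover have "J \<subseteq> carrier S" using J by (auto dest: maximalideal.axioms(1) ideal.Icarr)
    ultimately show ?thesis using g(3) g.hom_closed by force
  qed
  then have "local_ring S ?n" unfolding local_ring_def using n S by blast
  moreover have "noetherian_ring S"
  proof (rule S.noetherian_ringI)
    fix J assume J: "ideal J S"
    obtain B where "B \<subseteq> carrier R" "finite B" "{r \<in> carrier R. h r \<in> J} = Idl\<^bsub>R\<^esub> B"
      using noeth.finetely_gen[OF h.ideal_vimage[OF J]] by blast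
    then show "\<exists>A\<subseteq>carrier S. finite A \<and> J = Idl\<^bsub>S\<^esub> A"
      using gen[OF J] by (intro exI[of _ "h ` B"]) auto
  qed
  moreover have "?n = Idl\<^bsub>S\<^esub> (h ` G)"
  proof (rule gen[OF _ G(2)])
    show "ideal ?n S" using n by (rule maximalideal.axioms(1))
    show "{r \<in> carrier R. h r \<in> ?n} = Idl\<^bsub>R\<^esub> G" using G(3) mc g(2) h.hom_closed by auto
  qed
  moreover have "card (h ` G) = card G"
    using G(2) g(2) by (intro card_image inj_onI) (metis subsetD)
  moreover have "krull_dim R = krull_dim S"
    using ring_iso_krull_dim_le[OF R S h] ring_iso_krull_dim_le[OF S R g(1)] by simp
  ultimately show ?thesis
    unfolding regular_local_ring_def using G(1,2,4)
    by (intro conjI exI[of _ ?n] exI[of _ "h ` G"]) auto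
qed

section \<open>Fractions with central denominators\<close>

lemma ring_frac_memE:
  assumes "(b, t) \<in> ring_frac R S a s"
  obtains u where "b \<in> carrier R" "t \<in> S" "u \<in> S"
    "u \<otimes>\<^bsub>R\<^esub> (s \<otimes>\<^bsub>R\<^esub> b) = u \<otimes>\<^bsub>R\<^esub> (t \<otimes>\<^bsub>R\<^esub> a)"
  using assms by (force simp: ring_frac_def frac_rel_def)

lemma UN_UN_const:
  "\<lbrakk>p \<in> U; q \<in> V; \<And>x y. \<lbrakk>x \<in> U; y \<in> V\<rbrakk> \<Longrightarrow> f x y = c\<rbrakk> \<Longrightarrow> (\<Union>x\<in>U. \<Union>y\<in>V. f x y) = c"
  by auto

text \<open>Fractions are formed both over \<open>H0 A\<close> and over \<open>A\<close> itself,
  which is only graded-commutative; denominators of degree zero are central in both.\<close>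

definition central_multiplicative_set :: "('a, 'b) ring_scheme \<Rightarrow> 'a set \<Rightarrow> bool" where
  "central_multiplicative_set R S \<longleftrightarrow> S \<subseteq> carrier R \<and> \<one>\<^bsub>R\<^esub> \<in> S \<and>
     (\<forall>s\<in>S. \<forall>t\<in>S. s \<otimes>\<^bsub>R\<^esub> t \<in> S) \<and> (\<forall>s\<in>S. \<forall>x\<in>carrier R. s \<otimes>\<^bsub>R\<^esub> x = x \<otimes>\<^bsub>R\<^esub> s)"

context ring begin

context
  fixes S assumes S: "central_multiplicative_set R S"
begin

lemma mult_set:
  shows mult_set_carrier: "s \<in> S \<Longrightarrow> s \<in> carrier R" and mult_set_one: "\<one> \<in> S"
    and mult_set_mult: "\<lbrakk>s \<in> S; t \<in> S\<rbrakk> \<Longrightarrow> s \<otimes> t \<in> S"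
    and mult_set_comm: "\<lbrakk>s \<in> S; x \<in> carrier R\<rbrakk> \<Longrightarrow> x \<otimes> s = s \<otimes> x"
  using S by (auto simp: central_multiplicative_set_def)

lemma mult_set_lcomm:
  assumes "s \<in> S" "x \<in> carrier R" "y \<in> carrier R"
  shows "x \<otimes> (s \<otimes> y) = s \<otimes> (x \<otimes> y)"
  using m_assoc[of x s y] m_assoc[of s x y] mult_set_comm[OF assms(1,2)] mult_set_carrier assms by simp

lemma ring_frac_eq_iff:
  assumes "a \<in> carrier R" "s \<in> S" "b \<in> carrier R" "t \<in> S"
  shows "ring_frac R S a s = ring_frac R S b t \<longleftrightarrow> (\<exists>u\<in>S. u \<otimes> (t \<otimes> a) = u \<otimes> (s \<otimes> b))"
proof -
  have "equiv (carrier R \<times> S) (frac_rel R S)"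
  proof (rule equivI)
    show "frac_rel R S \<subseteq> (carrier R \<times> S) \<times> (carrier R \<times> S)" by (auto simp: frac_rel_def)
    show "refl_on (carrier R \<times> S) (frac_rel R S)"
      using mult_set_one by (auto simp: refl_on_def frac_rel_def)
    show "sym (frac_rel R S)" by (force simp: sym_def frac_rel_def)
    show "trans (frac_rel R S)"
    proof (rule transI)
      fix x y z assume "(x, y) \<in> frac_rel R S" "(y, z) \<in> frac_rel R S"
      then obtain a s b t c w u v where eq: "x = (a, s)" "y = (b, t)" "z = (c, w)"
        and c: "a \<in> carrier R" "b \<in> carrier R" "c \<in> carrier R" "s \<in> S" "t \<in> S" "w \<in> S" "u \<in> S" "v \<in> S"
        and u: "u \<otimes> (t \<otimes> a) = u \<otimes> (s \<otimes> b)" and v: "v \<otimes> (w \<otimes> b) = v \<otimes> (t \<otimes> c)"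
        by (auto simp: frac_rel_def)
      note cc = c mult_set_carrier[OF c(4)] mult_set_carrier[OF c(5)] mult_set_carrier[OF c(6)]
        mult_set_carrier[OF c(7)] mult_set_carrier[OF c(8)]
      \<comment> \<open>Denominators may be zero divisors, so the middle one, \<open>t\<close>,
        cannot be cancelled and is absorbed into the multiplier.\<close>
      have "(u \<otimes> (v \<otimes> t)) \<otimes> (w \<otimes> a) = v \<otimes> (w \<otimes> (u \<otimes> (t \<otimes> a)))"
        using cc by (simp add: m_assoc mult_set_lcomm)
      also have "\<dots> = u \<otimes> (s \<otimes> (v \<otimes> (w \<otimes> b)))" using cc by (simp add: u mult_set_lcomm)
      also have "\<dots> = (u \<otimes> (v \<otimes> t)) \<otimes> (s \<otimes> c)" using cc by (simp add: v m_assoc mult_set_lcomm)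
      finally show "(x, z) \<in> frac_rel R S"
        using eq c mult_set_mult[OF c(7) mult_set_mult[OF c(8,5)]] by (auto simp: frac_rel_def)
    qed
  qed
  then have "ring_frac R S a s = ring_frac R S b t \<longleftrightarrow> ((a, s), (b, t)) \<in> frac_rel R S"
    unfolding ring_frac_def using assms by (intro eq_equiv_class_iff) auto
  then show ?thesis using assms by (auto simp: frac_rel_def)
qed

lemma ring_frac_mem:
  assumes "a \<in> carrier R" "s \<in> S"
  shows "p \<in> ring_frac R S a s \<longleftrightarrow>
    (\<exists>b t. p = (b, t) \<and> b \<in> carrier R \<and> t \<in> S \<and> ring_frac R S b t = ring_frac R S a s)"
proof -
  have "(b, t) \<in> ring_frac R S a s \<longleftrightarrow> b \<in> carrier R \<and> t \<in> S \<and> ring_frac R S a s = ring_frac R S b t"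
    for b t
  proof -
    have "(b, t) \<in> ring_frac R S a s \<longleftrightarrow>
      b \<in> carrier R \<and> t \<in> S \<and> (\<exists>u\<in>S. u \<otimes> (t \<otimes> a) = u \<otimes> (s \<otimes> b))"
      unfolding ring_frac_def using assms by (simp add: frac_rel_def)
    then show ?thesis using ring_frac_eq_iff[OF assms, of b t] by blast
  qed
  then show ?thesis by (cases p) auto
qed

lemma ring_frac_self: "\<lbrakk>a \<in> carrier R; s \<in> S\<rbrakk> \<Longrightarrow> (a, s) \<in> ring_frac R S a s"
  by (subst ring_frac_mem) auto

lemma ring_frac_mult:
  assumes "a \<in> carrier R" "s \<in> S" "b \<in> carrier R" "t \<in> S"
  shows "ring_frac R S a s \<otimes>\<^bsub>ring_of_fractions R S\<^esub> ring_frac R S b t = ring_frac R S (a \<otimes> b) (s \<otimes> t)"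
proof -
  have val: "ring_frac R S (a' \<otimes> b') (s' \<otimes> t') = ring_frac R S (a \<otimes> b) (s \<otimes> t)"
    if p: "(a', s') \<in> ring_frac R S a s" and q: "(b', t') \<in> ring_frac R S b t" for a' s' b' t'
  proof -
    obtain u v where c: "a' \<in> carrier R" "b' \<in> carrier R" "s' \<in> S" "t' \<in> S" "u \<in> S" "v \<in> S"
      and u: "u \<otimes> (s \<otimes> a') = u \<otimes> (s' \<otimes> a)" and v: "v \<otimes> (t \<otimes> b') = v \<otimes> (t' \<otimes> b)"
      using p q assms by (auto simp: ring_frac_mem ring_frac_eq_iff)
    note cc = assms c mult_set_carrier[OF assms(2)] mult_set_carrier[OF assms(4)]
      mult_set_carrier[OF c(3)] mult_set_carrier[OF c(4)] mult_set_carrier[OF c(5)] mult_set_carrier[OF c(6)]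
    have "(u \<otimes> v) \<otimes> ((s \<otimes> t) \<otimes> (a' \<otimes> b')) = (u \<otimes> (s \<otimes> a')) \<otimes> (v \<otimes> (t \<otimes> b'))"
      using cc by (simp add: m_assoc mult_set_lcomm)
    also have "\<dots> = (u \<otimes> v) \<otimes> ((s' \<otimes> t') \<otimes> (a \<otimes> b))"
      unfolding u v using cc by (simp add: m_assoc mult_set_lcomm)
    finally show ?thesis
      using cc mult_set_mult by (subst ring_frac_eq_iff) (auto intro!: bexI[of _ "u \<otimes> v"])
  qed
  have "?thesis \<longleftrightarrow> (\<Union>p\<in>ring_frac R S a s. \<Union>q\<in>ring_frac R S b t.
      case (p, q) of ((a, s), (b, t)) \<Rightarrow> ring_frac R S (a \<otimes> b) (s \<otimes> t)) = ring_frac R S (a \<otimes> b) (s \<otimes> t)"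
    by (simp add: ring_of_fractions_def)
  moreover have \<dots>
  proof (rule UN_UN_const[OF ring_frac_self[OF assms(1,2)] ring_frac_self[OF assms(3,4)]])
    fix x y assume "x \<in> ring_frac R S a s" "y \<in> ring_frac R S b t"
    then show "(case (x, y) of ((a, s), (b, t)) \<Rightarrow> ring_frac R S (a \<otimes> b) (s \<otimes> t)) = ring_frac R S (a \<otimes> b) (s \<otimes> t)"
      by (cases x; cases y; simp only: prod.case; intro val)
  qed
  ultimately show ?thesis by (rule iffD2)
qed

lemma ring_frac_add:
  assumes "a \<in> carrier R" "s \<in> S" "b \<in> carrier R" "t \<in> S"
  shows "ring_frac R S a s \<oplus>\<^bsub>ring_of_fractions R S\<^esub> ring_frac R S b t =
    ring_frac R S ((t \<otimes> a) \<oplus> (s \<otimes> b)) (s \<otimes> t)"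
proof -
  have val: "ring_frac R S ((t' \<otimes> a') \<oplus> (s' \<otimes> b')) (s' \<otimes> t') =
      ring_frac R S ((t \<otimes> a) \<oplus> (s \<otimes> b)) (s \<otimes> t)"
    if p: "(a', s') \<in> ring_frac R S a s" and q: "(b', t') \<in> ring_frac R S b t" for a' s' b' t'
  proof -
    obtain u v where c: "a' \<in> carrier R" "b' \<in> carrier R" "s' \<in> S" "t' \<in> S" "u \<in> S" "v \<in> S"
      and u: "u \<otimes> (s \<otimes> a') = u \<otimes> (s' \<otimes> a)" and v: "v \<otimes> (t \<otimes> b') = v \<otimes> (t' \<otimes> b)"
      using p q assms by (auto simp: ring_frac_mem ring_frac_eq_iff)
    note cc = assms c mult_set_carrier[OF assms(2)] mult_set_carrier[OF assms(4)]
      mult_set_carrier[OF c(3)] mult_set_carrier[OF c(4)] mult_set_carrier[OF c(5)] mult_set_carrier[OF c(6)]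
    have "(u \<otimes> v) \<otimes> ((s \<otimes> t) \<otimes> (t' \<otimes> a' \<oplus> s' \<otimes> b')) =
        (v \<otimes> (t \<otimes> t')) \<otimes> (u \<otimes> (s \<otimes> a')) \<oplus> (u \<otimes> (s \<otimes> s')) \<otimes> (v \<otimes> (t \<otimes> b'))"
      using cc by (simp add: r_distr m_assoc mult_set_lcomm)
    also have "\<dots> = (u \<otimes> v) \<otimes> ((s' \<otimes> t') \<otimes> (t \<otimes> a \<oplus> s \<otimes> b))"
      unfolding u v using cc by (simp add: r_distr m_assoc mult_set_lcomm)
    finally show ?thesis
      using cc mult_set_mult by (subst ring_frac_eq_iff) (auto intro!: bexI[of _ "u \<otimes> v"])
  qed
  have "?thesis \<longleftrightarrow> (\<Union>p\<in>ring_frac R S a s. \<Union>q\<in>ring_frac R S b t.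
      case (p, q) of ((a, s), (b, t)) \<Rightarrow> ring_frac R S ((t \<otimes> a) \<oplus> (s \<otimes> b)) (s \<otimes> t)) = ring_frac R S ((t \<otimes> a) \<oplus> (s \<otimes> b)) (s \<otimes> t)"
    by (simp add: ring_of_fractions_def)
  moreover have \<dots>
  proof (rule UN_UN_const[OF ring_frac_self[OF assms(1,2)] ring_frac_self[OF assms(3,4)]])
    fix x y assume "x \<in> ring_frac R S a s" "y \<in> ring_frac R S b t"
    then show "(case (x, y) of ((a, s), (b, t)) \<Rightarrow> ring_frac R S ((t \<otimes> a) \<oplus> (s \<otimes> b)) (s \<otimes> t)) = ring_frac R S ((t \<otimes> a) \<oplus> (s \<otimes> b)) (s \<otimes> t)"
      by (cases x; cases y; simp only: prod.case; intro val)
  qed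
  ultimately show ?thesis by (rule iffD2)
qed

end

end


section \<open>Fractions of DG-rings and the zeroth cohomology of a localization\<close>

lemma dg_ring_of_fractions_simps:
  "carrier (dg_ring_of_fractions A S) = {ring_frac A S a s | a s. a \<in> carrier A \<and> s \<in> S}"
  "mult (dg_ring_of_fractions A S) = mult (ring_of_fractions A S)"
  "add (dg_ring_of_fractions A S) = add (ring_of_fractions A S)"
  "one (dg_ring_of_fractions A S) = ring_frac A S (one A) (one A)"
  "zero (dg_ring_of_fractions A S) = ring_frac A S (zero A) (one A)"
  "dg_grade (dg_ring_of_fractions A S) n = {ring_frac A S a s | a s. a \<in> dg_grade A n \<and> s \<in> S}"
  by (simp_all add: dg_ring_of_fractions_def ring_of_fractions_def ring.defs dg_ring.defs)

context comm_dg_ring begin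

text \<open>Against degree zero the Koszul sign is trivial on each homogeneous part of
  \<open>x\<close>.\<close>

lemma degree_zero_central:
  assumes "s \<in> dg_grade A 0" "x \<in> carrier A"
  shows "s \<otimes> x = x \<otimes> s"
proof -
  obtain c where c: "homogeneous_parts A (dg_grade A) x c" using direct_sum[OF assms(2)] by blast
  let ?F = "{n. c n \<noteq> \<zero>}"
  have F: "finite ?F" "c \<in> ?F \<rightarrow> carrier A" "x = finsum A c ?F"
    using c grade_carrier unfolding homogeneous_parts_def by auto
  have "s \<otimes> c n = c n \<otimes> s" for n
    using graded_comm[OF assms(1), of "c n" n] c
    by (simp add: koszul_sign_def homogeneous_parts_def)
  then show ?thesis
    using finsum_rdistr[OF F(1) grade_carrier[OF assms(1)] F(2)]
      finsum_ldistr[OF F(1) grade_carrier[OF assms(1)] F(2)] F(3) by simp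
qed

lemma diff_closed:
  assumes "x \<in> carrier A" shows "dg_diff A x \<in> carrier A"
proof -
  obtain c where c: "homogeneous_parts A (dg_grade A) x c" using direct_sum[OF assms] by blast
  have "finite F \<Longrightarrow> dg_diff A (finsum A c F) \<in> carrier A" for F
  proof (induction F rule: finite_induct)
    case empty
    then show ?case by (simp add: diff_zero)
  next
    case (insert n F)
    have cn: "c m \<in> dg_grade A m" for m using c by (simp add: homogeneous_parts_def)
    then have "c \<in> F \<rightarrow> carrier A" "c n \<in> carrier A" using grade_carrier by auto
    then show ?case
      using insert diff_add[of "c n" "finsum A c F"] grade_carrier[OF diff_grade[OF cn]] by simp
  qed
  then show ?thesis using c by (simp add: homogeneous_parts_def)
qed

lemma diff_degree_zero_mult:
  assumes "s \<in> dg_grade A 0" "x \<in> carrier A"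
  shows "dg_diff A (s \<otimes> x) = s \<otimes> dg_diff A x"
  using leibniz[OF assms] diff_degree_zero[OF assms(1)] assms(2) diff_closed[OF assms(2)]
    grade_carrier[OF assms(1)] by (simp add: koszul_sign_def)

lemma central_multiplicative_set_degree_zero:
  assumes "S \<subseteq> dg_grade A 0" "\<one> \<in> S" "\<And>s t. \<lbrakk>s \<in> S; t \<in> S\<rbrakk> \<Longrightarrow> s \<otimes> t \<in> S"
  shows "central_multiplicative_set A S"
  using assms grade_carrier degree_zero_central unfolding central_multiplicative_set_def by blast

text \<open>Elements of degree zero are cocycles, so the differential commutes with multiplication
  by denominators and carries a relation between fractions to one between their
  differentials.\<close>

lemma diff_ring_frac:
  assumes S: "S \<subseteq> dg_grade A 0" "central_multiplicative_set A S" and "a \<in> carrier A" "s \<in> S"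
  shows "dg_diff (dg_ring_of_fractions A S) (ring_frac A S a s) = ring_frac A S (dg_diff A a) s"
proof -
  note eq_iff = ring_frac_eq_iff[OF S(2)]
  have val: "ring_frac A S (dg_diff A b) t = ring_frac A S (dg_diff A a) s"
    if bt: "(b, t) \<in> ring_frac A S a s" for b t
  proof -
    obtain u where c: "b \<in> carrier A" "t \<in> S" "u \<in> S" and u: "u \<otimes> (s \<otimes> b) = u \<otimes> (t \<otimes> a)"
      using bt by (rule ring_frac_memE)
    have cc: "s \<in> dg_grade A 0" "t \<in> dg_grade A 0" "u \<in> dg_grade A 0" using c assms S by auto
    have "dg_diff A (u \<otimes> (r \<otimes> x)) = u \<otimes> (r \<otimes> dg_diff A x)"
      if "r \<in> dg_grade A 0" "x \<in> carrier A" for r x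
      using that cc grade_carrier by (simp add: diff_degree_zero_mult)
    then have "u \<otimes> (s \<otimes> dg_diff A b) = u \<otimes> (t \<otimes> dg_diff A a)" using u cc c assms(3) by metis
    then show ?thesis using c assms(3,4) diff_closed by (subst eq_iff) auto
  qed
  have "dg_diff (dg_ring_of_fractions A S) (ring_frac A S a s) =
      (\<Union>p\<in>ring_frac A S a s. case p of (b, t) \<Rightarrow> ring_frac A S (dg_diff A b) t)"
    by (simp add: dg_ring_of_fractions_def ring.defs dg_ring.defs)
  also have "\<dots> = ring_frac A S (dg_diff A a) s"
  proof (intro equalityI UN_least)
    fix p assume "p \<in> ring_frac A S a s"
    then show "(case p of (b, t) \<Rightarrow> ring_frac A S (dg_diff A b) t) \<subseteq> ring_frac A S (dg_diff A a) s"
      using val by (cases p) (simp only: prod.case subset_refl)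
  next
    show "ring_frac A S (dg_diff A a) s \<subseteq>
      (\<Union>p\<in>ring_frac A S a s. case p of (b, t) \<Rightarrow> ring_frac A S (dg_diff A b) t)"
      using ring_frac_self[OF S(2) assms(3,4)] by (intro UN_upper[of "(a, s)", THEN subset_trans[rotated]]) auto
  qed
  finally show ?thesis .
qed

end

text \<open>That the localization is again a DG-ring enters as an assumption, because each of the
  two local conditions to be compared contains it.\<close>

locale dg_localization = comm_dg_ring A for A :: "'a dg_ring" (structure) +
  fixes P assumes prime: "primeideal P (H0 A)"
    and comm_dg_ring_localization: "comm_dg_ring (dg_localize_at A P)"
begin

abbreviation "Loc \<equiv> dg_localize_at A P"
abbreviation "complement \<equiv> dg_grade A 0 - {a \<in> dg_grade A 0. H0_proj A a \<in> P}"

sublocale P: primeideal P "H0 A" by (rule prime)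
sublocale p: ring_hom_ring "dg_zero_part A" "H0 A" "H0_proj A" by (rule H0_proj_hom)
sublocale L: comm_dg_ring "Loc" by (rule comm_dg_ring_localization)

lemma complement: "central_multiplicative_set A complement"
proof (rule central_multiplicative_set_degree_zero)
  show "\<one> \<in> complement" using one_grade p.hom_one P.one_not_mem by simp
  show "s \<otimes> t \<in> complement" if "s \<in> complement" "t \<in> complement" for s t
    using that p.hom_mult[of s t] p.R.m_closed[of s t] P.not_mem_mult[of "H0_proj A s" "H0_proj A t"]
      p.hom_closed by auto
qed auto

lemma complement_H0: "central_multiplicative_set (H0 A) (carrier (H0 A) - P)"
  using P.one_not_mem P.not_mem_mult P.m_comm unfolding central_multiplicative_set_def by auto

lemma proj_complement: "s \<in> complement \<Longrightarrow> H0_proj A s \<in> carrier (H0 A) - P"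
  using p.hom_closed by auto

lemma complement_lift:
  assumes "v \<in> carrier (H0 A) - P" obtains s where "s \<in> complement" "v = H0_proj A s"
  using assms carrier_H0 by auto

text \<open>A fraction of degree 0 may also have representatives with inhomogeneous numerator; these are
  disregarded.\<close>

definition to_localized_H0 :: "('a \<times> 'a) set \<Rightarrow> ('a set \<times> 'a set) set" where
  "to_localized_H0 U = (\<Union>(a, s)\<in>U \<inter> dg_grade A 0 \<times> complement.
     ring_frac (H0 A) (carrier (H0 A) - P) (H0_proj A a) (H0_proj A s))"

lemma to_localized_H0:
  assumes "a \<in> dg_grade A 0" "s \<in> complement"
  shows "to_localized_H0 (ring_frac A complement a s) =
    ring_frac (H0 A) (carrier (H0 A) - P) (H0_proj A a) (H0_proj A s)" (is "_ = ?r")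
proof -
  have ac: "a \<in> carrier A" using grade_carrier assms by blast
  have val: "ring_frac (H0 A) (carrier (H0 A) - P) (H0_proj A b) (H0_proj A t) = ?r"
    if bt: "(b, t) \<in> ring_frac A complement a s" and b: "b \<in> dg_grade A 0" for b t
  proof -
    have bc: "b \<in> carrier A" using grade_carrier b by blast
    obtain u where c: "t \<in> complement" "u \<in> complement" and u: "u \<otimes> (s \<otimes> b) = u \<otimes> (t \<otimes> a)"
      using bt by (rule ring_frac_memE)
    have hom: "H0_proj A (u \<otimes> (x \<otimes> y)) =
        H0_proj A u \<otimes>\<^bsub>H0 A\<^esub> (H0_proj A x \<otimes>\<^bsub>H0 A\<^esub> H0_proj A y)"
      if "x \<in> dg_grade A 0" "y \<in> dg_grade A 0" for x y
      using that c(2) p.hom_mult[of u "x \<otimes> y"] p.hom_mult[of x y] p.R.m_closed[of x y] by simp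
    have "H0_proj A u \<otimes>\<^bsub>H0 A\<^esub> (H0_proj A s \<otimes>\<^bsub>H0 A\<^esub> H0_proj A b) =
        H0_proj A u \<otimes>\<^bsub>H0 A\<^esub> (H0_proj A t \<otimes>\<^bsub>H0 A\<^esub> H0_proj A a)"
      using hom[of s b] hom[of t a] u assms b c by simp
    then show ?thesis
      using p.hom_closed[of a] p.hom_closed[of b] assms(1) b proj_complement[OF c(1)]
        proj_complement[OF c(2)] proj_complement[OF assms(2)]
      by (subst P.ring_frac_eq_iff[OF complement_H0]) auto
  qed
  have "(a, s) \<in> ring_frac A complement a s \<inter> dg_grade A 0 \<times> complement"
    using ring_frac_self[OF complement ac assms(2)] assms by blast
  moreover have "(case p of (b, t) \<Rightarrow>
      ring_frac (H0 A) (carrier (H0 A) - P) (H0_proj A b) (H0_proj A t)) = ?r"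
    if "p \<in> ring_frac A complement a s \<inter> dg_grade A 0 \<times> complement" for p
    using that val by (cases p) (simp only: prod.case, blast)
  ultimately show ?thesis unfolding to_localized_H0_def by blast
qed

lemma Loc_grade: "dg_grade Loc n = {ring_frac A complement a s | a s. a \<in> dg_grade A n \<and> s \<in> complement}"
  by (simp add: dg_localize_at_def dg_ring_of_fractions_simps)

lemma localize_at_H0_carrier: "carrier (localize_at (H0 A) P) =
    {ring_frac (H0 A) (carrier (H0 A) - P) a s | a s. a \<in> carrier (H0 A) \<and> s \<in> carrier (H0 A) - P}"
  by (simp add: localize_at_def ring_of_fractions_def)

lemma to_localized_H0_ring_hom:
  "to_localized_H0 \<in> ring_hom (dg_zero_part Loc) (localize_at (H0 A) P)"
proof (rule ring_hom_memI)
  fix x assume "x \<in> carrier (dg_zero_part Loc)"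
  then obtain a s where x: "x = ring_frac A complement a s" and a: "a \<in> dg_grade A 0"
    and s: "s \<in> complement" by (auto simp: Loc_grade)
  have "H0_proj A a \<in> carrier (H0 A)" using p.hom_closed[of a] a by simp
  then show "to_localized_H0 x \<in> carrier (localize_at (H0 A) P)"
    unfolding x to_localized_H0[OF a s] localize_at_H0_carrier using proj_complement[OF s] by blast
  fix y assume "y \<in> carrier (dg_zero_part Loc)"
  then obtain b t where y: "y = ring_frac A complement b t" and b: "b \<in> dg_grade A 0"
    and t: "t \<in> complement" by (auto simp: Loc_grade)
  note c = grade_carrier[OF a] grade_carrier[OF b]
  have s0: "s \<in> dg_grade A 0" and t0: "t \<in> dg_grade A 0" using s t by auto
  have st: "s \<otimes> t \<in> complement" using mult_set_mult[OF complement s t] .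
  have ab: "a \<otimes> b \<in> dg_grade A 0" and tasb: "(t \<otimes> a) \<oplus> (s \<otimes> b) \<in> dg_grade A 0"
    and ta: "t \<otimes> a \<in> dg_grade A 0" and sb: "s \<otimes> b \<in> dg_grade A 0"
    using p.R.m_closed[of a b] p.R.m_closed[of t a] p.R.m_closed[of s b]
      p.R.a_closed[of "t \<otimes> a" "s \<otimes> b"] a b s0 t0 by auto
  note pc = p.hom_closed[of a] p.hom_closed[of b]
  have "x \<otimes>\<^bsub>dg_zero_part Loc\<^esub> y = ring_frac A complement (a \<otimes> b) (s \<otimes> t)"
    using ring_frac_mult[OF complement c(1) s c(2) t] x y
    by (simp add: dg_localize_at_def dg_ring_of_fractions_simps)
  then show "to_localized_H0 (x \<otimes>\<^bsub>dg_zero_part Loc\<^esub> y) =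
      to_localized_H0 x \<otimes>\<^bsub>localize_at (H0 A) P\<^esub> to_localized_H0 y"
    using to_localized_H0[OF ab st] to_localized_H0[OF a s] to_localized_H0[OF b t] x y
      P.ring_frac_mult[OF complement_H0 _ proj_complement[OF s] _ proj_complement[OF t]] pc a b s0 t0
      p.hom_mult[of a b] p.hom_mult[of s t] by (simp add: localize_at_def)
  have "x \<oplus>\<^bsub>dg_zero_part Loc\<^esub> y = ring_frac A complement ((t \<otimes> a) \<oplus> (s \<otimes> b)) (s \<otimes> t)"
    using ring_frac_add[OF complement c(1) s c(2) t] x y
    by (simp add: dg_localize_at_def dg_ring_of_fractions_simps)
  then show "to_localized_H0 (x \<oplus>\<^bsub>dg_zero_part Loc\<^esub> y) =
      to_localized_H0 x \<oplus>\<^bsub>localize_at (H0 A) P\<^esub> to_localized_H0 y"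
    using to_localized_H0[OF tasb st] to_localized_H0[OF a s] to_localized_H0[OF b t] x y
      P.ring_frac_add[OF complement_H0 _ proj_complement[OF s] _ proj_complement[OF t]] pc a b s0 t0
      p.hom_mult[of t a] p.hom_mult[of s b] p.hom_mult[of s t] p.hom_add[of "t \<otimes> a" "s \<otimes> b"] ta sb
    by (simp add: localize_at_def)
next
  have "\<one> \<in> complement" using mult_set_one[OF complement] .
  then show "to_localized_H0 \<one>\<^bsub>dg_zero_part Loc\<^esub> = \<one>\<^bsub>localize_at (H0 A) P\<^esub>"
    using to_localized_H0[OF one_grade] p.hom_one
    by (simp add: dg_localize_at_def dg_ring_of_fractions_simps localize_at_def ring_of_fractions_def)
qed

lemma to_localized_H0_surj:
  "to_localized_H0 ` carrier (dg_zero_part Loc) = carrier (localize_at (H0 A) P)"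
proof
  show "to_localized_H0 ` carrier (dg_zero_part Loc) \<subseteq> carrier (localize_at (H0 A) P)"
    using ring_hom_memE(1)[OF to_localized_H0_ring_hom] by blast
  show "carrier (localize_at (H0 A) P) \<subseteq> to_localized_H0 ` carrier (dg_zero_part Loc)"
  proof
    fix z assume "z \<in> carrier (localize_at (H0 A) P)"
    then obtain x v where z: "z = ring_frac (H0 A) (carrier (H0 A) - P) x v"
      and "x \<in> carrier (H0 A)" "v \<in> carrier (H0 A) - P" by (auto simp: localize_at_H0_carrier)
    moreover obtain a where a: "a \<in> dg_grade A 0" "x = H0_proj A a"
      using \<open>x \<in> carrier (H0 A)\<close> carrier_H0 by blast
    moreover obtain s where s: "s \<in> complement" "v = H0_proj A s"
      using \<open>v \<in> carrier (H0 A) - P\<close> by (rule complement_lift)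
    ultimately have "z = to_localized_H0 (ring_frac A complement a s)"
      using to_localized_H0[OF a(1) s(1)] by simp
    moreover have "ring_frac A complement a s \<in> carrier (dg_zero_part Loc)"
      using a(1) s(1) by (auto simp: Loc_grade)
    ultimately show "z \<in> to_localized_H0 ` carrier (dg_zero_part Loc)" by blast
  qed
qed

lemma zero_localize_at_H0: "\<zero>\<^bsub>localize_at (H0 A) P\<^esub> = to_localized_H0 \<zero>\<^bsub>dg_zero_part Loc\<^esub>"
proof -
  have "\<zero> \<in> dg_grade A 0" using additive_subgroup.zero_closed[OF grade_subgroup] .
  then show ?thesis
    using to_localized_H0[OF _ mult_set_one[OF complement], of \<zero>] p.hom_zero p.hom_one
    by (simp add: dg_localize_at_def dg_ring_of_fractions_simps localize_at_def ring_of_fractions_def)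
qed

text \<open>The ring axioms are inherited from the degree-zero part of \<open>Loc\<close>, of which
  this ring is a surjective image.\<close>

lemma cring_localize_at_H0: "cring (localize_at (H0 A) P)"
proof -
  interpret R: cring "dg_zero_part Loc" by (rule L.cring_zero_part)
  \<comment> \<open>The image of a ring under a homomorphism is described by replacing
    \<open>carrier\<close> and \<open>zero\<close>; here both fields already have these
    values.\<close>
  have "localize_at (H0 A) P \<lparr>carrier := to_localized_H0 ` carrier (dg_zero_part Loc),
      zero := to_localized_H0 \<zero>\<^bsub>dg_zero_part Loc\<^esub>\<rparr> = localize_at (H0 A) P"
    unfolding to_localized_H0_surj zero_localize_at_H0[symmetric] by simp
  then have "ring (localize_at (H0 A) P)"
    using R.ring_hom_imp_img_ring[OF to_localized_H0_ring_hom] by simp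
  then interpret h: ring_hom_ring "dg_zero_part Loc" "localize_at (H0 A) P" to_localized_H0
    using R.ring_axioms to_localized_H0_ring_hom by (simp add: ring_hom_ringI2)
  have "x \<otimes>\<^bsub>localize_at (H0 A) P\<^esub> y = y \<otimes>\<^bsub>localize_at (H0 A) P\<^esub> x"
    if xy: "x \<in> carrier (localize_at (H0 A) P)" "y \<in> carrier (localize_at (H0 A) P)" for x y
  proof -
    obtain u v where uv: "u \<in> carrier (dg_zero_part Loc)" "v \<in> carrier (dg_zero_part Loc)"
      "x = to_localized_H0 u" "y = to_localized_H0 v"
      using xy unfolding to_localized_H0_surj[symmetric] by blast
    then show ?thesis using h.hom_mult[OF uv(1,2)] h.hom_mult[OF uv(2,1)] R.m_comm[OF uv(1,2)] by metis
  qed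
  then show ?thesis
    using h.S.ring_axioms h.S.monoid_axioms
    by (intro cring.intro comm_monoid.intro comm_monoid_axioms.intro) auto
qed

text \<open>Exactness of localization, in degree zero: if \<open>a / s\<close> maps to zero, some
  \<open>u\<close> outside the prime makes \<open>u \<otimes> a\<close> the differential of some
  \<open>b\<close>, and then \<open>a / s\<close> is the differential of
  \<open>b / (u \<otimes> s)\<close>.\<close>

lemma to_localized_H0_kernel:
  "a_kernel (dg_zero_part Loc) (localize_at (H0 A) P) to_localized_H0 = coboundaries (dg_self Loc) 0"
proof -
  have S0: "complement \<subseteq> dg_grade A 0" by blast
  have diff: "dg_diff Loc (ring_frac A complement a s) = ring_frac A complement (dg_diff A a) s"
    if "a \<in> carrier A" "s \<in> complement" for a s
    unfolding dg_localize_at_def using diff_ring_frac[OF S0 complement that] .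
  have z0: "\<zero> \<in> dg_grade A 0" using additive_subgroup.zero_closed[OF grade_subgroup] .
  have zeroL: "\<zero>\<^bsub>localize_at (H0 A) P\<^esub> = ring_frac (H0 A) (carrier (H0 A) - P) \<zero>\<^bsub>H0 A\<^esub> \<one>\<^bsub>H0 A\<^esub>"
    by (simp add: localize_at_def ring_of_fractions_def)
  have oneH: "\<one>\<^bsub>H0 A\<^esub> \<in> carrier (H0 A) - P" using P.one_not_mem by simp
  have zero_iff: "to_localized_H0 (ring_frac A complement a s) = \<zero>\<^bsub>localize_at (H0 A) P\<^esub> \<longleftrightarrow>
      (\<exists>u\<in>complement. u \<otimes> a \<in> coboundaries (dg_self A) 0)"
    if a: "a \<in> dg_grade A 0" and s: "s \<in> complement" for a s
  proof -
    have pa: "H0_proj A a \<in> carrier (H0 A)" using p.hom_closed[of a] a by simp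
    have "to_localized_H0 (ring_frac A complement a s) = \<zero>\<^bsub>localize_at (H0 A) P\<^esub> \<longleftrightarrow>
      (\<exists>v\<in>carrier (H0 A) - P. v \<otimes>\<^bsub>H0 A\<^esub> H0_proj A a = \<zero>\<^bsub>H0 A\<^esub>)"
      unfolding to_localized_H0[OF a s] zeroL
      using P.ring_frac_eq_iff[OF complement_H0 pa proj_complement[OF s] cring.cring_simprules(2)[OF cring_H0] oneH]
        pa proj_complement[OF s] by simp
    also have "\<dots> \<longleftrightarrow> (\<exists>u\<in>complement. H0_proj A (u \<otimes> a) = H0_proj A \<zero>)"
    proof -
      have img: "carrier (H0 A) - P = H0_proj A ` complement"
      proof (intro equalityI subsetI)
        fix v assume "v \<in> carrier (H0 A) - P"
        then obtain s where "s \<in> complement" "v = H0_proj A s" by (rule complement_lift)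
        then show "v \<in> H0_proj A ` complement" by blast
      qed (use proj_complement in blast)
      have "H0_proj A u \<otimes>\<^bsub>H0 A\<^esub> H0_proj A a = \<zero>\<^bsub>H0 A\<^esub> \<longleftrightarrow> H0_proj A (u \<otimes> a) = H0_proj A \<zero>"
        if "u \<in> complement" for u
        using p.hom_mult[of u a] that a p.hom_zero by simp
      then show ?thesis unfolding img bex_simps(7) by (rule bex_cong[OF refl])
    qed
    also have "\<dots> \<longleftrightarrow> (\<exists>u\<in>complement. u \<otimes> a \<in> coboundaries (dg_self A) 0)"
    proof -
      have "H0_proj A (u \<otimes> a) = H0_proj A \<zero> \<longleftrightarrow> u \<otimes> a \<in> coboundaries (dg_self A) 0"
        if u: "u \<in> complement" for u
      proof -
        have "u \<otimes> a \<in> dg_grade A 0" using p.R.m_closed[of u a] u a by simp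
        then show ?thesis
          using H0_proj_eq_iff[OF _ z0, of "u \<otimes> a"] p.R.minus_zero grade_carrier by simp
      qed
      then show ?thesis by blast
    qed
    finally show ?thesis .
  qed
  show ?thesis
  proof (intro equalityI subsetI)
    fix x assume "x \<in> a_kernel (dg_zero_part Loc) (localize_at (H0 A) P) to_localized_H0"
    then have x: "x \<in> dg_grade Loc 0" "to_localized_H0 x = \<zero>\<^bsub>localize_at (H0 A) P\<^esub>"
      by (auto simp: a_kernel_def')
    then obtain a s where as: "x = ring_frac A complement a s" "a \<in> dg_grade A 0" "s \<in> complement"
      by (auto simp: Loc_grade)
    then obtain u where u: "u \<in> complement" "u \<otimes> a \<in> coboundaries (dg_self A) 0"
      using zero_iff x(2) by blast
    then obtain b where b: "b \<in> dg_grade A (-1)" "u \<otimes> a = dg_diff A b"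
      by (auto simp: coboundaries_def)
    note c = grade_carrier[OF as(2)] mult_set_carrier[OF complement as(3)]
      mult_set_carrier[OF complement u(1)]
    have us: "u \<otimes> s \<in> complement" using mult_set_mult[OF complement u(1) as(3)] .
    have "ring_frac A complement a s = ring_frac A complement (u \<otimes> a) (u \<otimes> s)"
      using c as(3) us mult_set_one[OF complement]
      by (subst ring_frac_eq_iff[OF complement])
        (auto intro!: bexI[of _ \<one>] simp: m_assoc mult_set_lcomm[OF complement as(3)])
    then have "x = dg_diff Loc (ring_frac A complement b (u \<otimes> s))"
      using diff[OF grade_carrier[OF b(1)] us] as(1) b(2) by simp
    moreover have "ring_frac A complement b (u \<otimes> s) \<in> dg_grade Loc (-1)"
      using b(1) us by (auto simp: Loc_grade)
    ultimately show "x \<in> coboundaries (dg_self Loc) 0" by (auto simp: coboundaries_def)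
  next
    fix x assume "x \<in> coboundaries (dg_self Loc) 0"
    then obtain b s where b: "b \<in> dg_grade A (-1)" "s \<in> complement"
      "x = dg_diff Loc (ring_frac A complement b s)" by (auto simp: coboundaries_def Loc_grade)
    have db: "dg_diff A b \<in> dg_grade A 0" using diff_grade[OF b(1)] by simp
    have x: "x = ring_frac A complement (dg_diff A b) s" using diff[OF grade_carrier[OF b(1)] b(2)] b(3) by simp
    have "\<one> \<otimes> dg_diff A b \<in> coboundaries (dg_self A) 0"
      using b(1) grade_carrier[OF db] by (auto simp: coboundaries_def)
    then have "to_localized_H0 x = \<zero>\<^bsub>localize_at (H0 A) P\<^esub>"
      using zero_iff[OF db b(2)] x mult_set_one[OF complement] by blast
    moreover have "x \<in> dg_grade Loc 0" unfolding x Loc_grade using db b(2) by blast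
    ultimately show "x \<in> a_kernel (dg_zero_part Loc) (localize_at (H0 A) P) to_localized_H0"
      by (simp add: a_kernel_def')
  qed
qed

theorem H0_localization: "\<exists>h. h \<in> ring_iso (H0 Loc) (localize_at (H0 A) P)"
proof -
  interpret R: cring "dg_zero_part Loc" by (rule L.cring_zero_part)
  interpret S: cring "localize_at (H0 A) P" by (rule cring_localize_at_H0)
  interpret h: ring_hom_ring "dg_zero_part Loc" "localize_at (H0 A) P" to_localized_H0
    using R.ring_axioms S.ring_axioms to_localized_H0_ring_hom by (simp add: ring_hom_ringI2)
  show ?thesis
    using h.FactRing_iso_set[OF to_localized_H0_surj] unfolding to_localized_H0_kernel H0_def[of Loc] by blast
qed

lemma regular_local_ring_H0_localization:
  "regular_local_ring (H0 Loc) \<longleftrightarrow> regular_local_ring (localize_at (H0 A) P)"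
proof -
  obtain h where h: "h \<in> ring_iso (H0 Loc) (localize_at (H0 A) P)" using H0_localization by blast
  have "inv_into (carrier (H0 Loc)) h \<in> ring_iso (localize_at (H0 A) P) (H0 Loc)"
    using ring_iso_set_sym[OF _ h] L.cring_H0 by (simp add: cring_def)
  then show ?thesis
    using regular_local_ring_iso[OF L.cring_H0 cring_localize_at_H0 h]
      regular_local_ring_iso[OF cring_localize_at_H0 L.cring_H0] by (intro iffI)
qed

end

text \<open>Both local conditions include that the localization is a noetherian local DG-ring with
  bounded cohomology. If this fails, both sides are false. If it holds, its maximal ideal is unique,
  the local equivalence applies, and regularity is transported along the isomorphism between the
  zeroth cohomology of the localization and the localization of \<open>H0 A\<close>.\<close>

lemma local_sequence_regular_iff:
  assumes "comm_dg_ring A" "primeideal P (H0 A)"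
  shows "local_sequence_regular (dg_localize_at A P) \<longleftrightarrow>
    local_cohen_macaulay (dg_localize_at A P) \<and> regular_local_ring (localize_at (H0 A) P)"
proof (cases "bounded_cohomology (dg_localize_at A P) \<and>
    (\<exists>m. noetherian_local_dg_ring (dg_localize_at A P) m)")
  case True
  then obtain m where m: "bounded_cohomology (dg_localize_at A P)"
    "noetherian_local_dg_ring (dg_localize_at A P) m" by blast
  interpret noetherian_local_dg "dg_localize_at A P" m
    using m by unfold_locales
  interpret A: comm_dg_ring A by fact
  interpret dg_localization A P
    by (intro dg_localization.intro dg_localization_axioms.intro assms comm_dg_ring_axioms)
  have uniq: "m' = m" if "noetherian_local_dg_ring (dg_localize_at A P) m'" for m'
    using that local_H0 by (auto simp: noetherian_local_dg_ring_def local_ring_def)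
  have ex: "(\<exists>m'. noetherian_local_dg_ring (dg_localize_at A P) m' \<and> Q m') \<longleftrightarrow> Q m" for Q
    using m(2) uniq by blast
  show ?thesis
    unfolding local_sequence_regular_def local_cohen_macaulay_def ex
      regular_local_ring_H0_localization[symmetric] sequence_regular_iff
    by (simp add: m(1))
qed (auto simp: local_sequence_regular_def local_cohen_macaulay_def)

theorem corollary4p4:
  fixes A :: "'a dg_ring"
  assumes "comm_dg_ring A"
    and "noetherian_dg_ring A"
    and "bounded_cohomology A"
  shows "sequence_regular A \<longleftrightarrow> cohen_macaulay A \<and> regular_ring (H0 A)"
proof -
  interpret comm_dg_ring A by fact
  have "noetherian_ring (H0 A)" using assms(2) by (simp add: noetherian_dg_ring_def)
  then show ?thesis
    using local_sequence_regular_iff[OF assms(1)] assms(2,3) cring_H0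
    unfolding sequence_regular_def cohen_macaulay_def regular_ring_def by blast
qed

end
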